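(* Let $n\ge3$, $s\in(0,1)$, and let $\Omega\subset\mathbb{R}^n$ be an open bounded domain. Suppose $u\in\mathcal{X}^{1,2}(\Omega)$ is a weak solution of $$-\Delta u+(-\Delta)^su+a(x)u=f(x)\quad\text{in }\Omega.$$ Assume $a,f\in L^l(\Omega)$ for some $l>n/2$. Then $u\in L^\infty(\Omega)$.
   Context: $\mathcal{X}^{1,2}(\Omega)$ is the completion of $C_0^\infty(\Omega)$ with respect to the norm $\|u\|_{\mathcal{X}^{1,2}(\Omega)}=\big(\|\nabla u\|_{L^2(\mathbb{R}^n)}^2+[u]_s^2\big)^{1/2}$, where $[u]_s^2=\int_{\mathbb{R}^n}\int_{\mathbb{R}^n}\frac{(u(x)-u(y))^2}{|x-y|^{n+2s}}dx\,dy$. Its elements are functions on $\mathbb{R}^n$ vanishing a.e. outside $\Omega$. Put $$B_s(u,v)=\int_{\mathbb{R}^n}\nabla u\cdot\nabla v\,dx+\int_{\mathbb{R}^n}\int_{\mathbb{R}^n}\frac{(u(x)-u(y))(v(x)-v(y))}{|x-y|^{n+2s}}dx\,dy.$$ A weak solution of the equation is $u\in\mathcal{X}^{1,2}(\Omega)$ with $B_s(u,\phi)+\int_\Omega a u\phi\,dx=\int_\Omega f\phi\,dx$ for all $\phi\in\mathcal{X}^{1,2}(\Omega)$ (the fractional Laplacian is normalized so that this is the weak form). *)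

theory Defs
  imports "HOL-Analysis.Analysis"
begin

text \<open>All integrals are taken with respect to \<open>lebesgue\<close>, so that functions need only be
  Lebesgue measurable.\<close>

definition gradient :: "('a::euclidean_space \<Rightarrow> real) \<Rightarrow> 'a \<Rightarrow> 'a" where
  "gradient f x = (\<Sum>b\<in>Basis. frechet_derivative f (at x) b *\<^sub>R b)"

text \<open>A function is \<open>C\<^sup>k\<^sup>+\<^sup>1\<close> iff it is differentiable and all its first partial derivatives
  are \<open>C\<^sup>k\<close>.\<close>

primrec Ck :: "nat \<Rightarrow> ('a::euclidean_space \<Rightarrow> real) \<Rightarrow> bool" where
  "Ck 0 f \<longleftrightarrow> continuous_on UNIV f"
| "Ck (Suc k) f \<longleftrightarrow> (\<forall>x. f differentiable (at x)) \<and>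
     (\<forall>b\<in>Basis. Ck k (\<lambda>x. frechet_derivative f (at x) b))"

definition test_functions :: "'a::euclidean_space set \<Rightarrow> ('a \<Rightarrow> real) set" where
  "test_functions \<Omega> = {\<phi>. (\<forall>k. Ck k \<phi>) \<and>
     compact (closure {x. \<phi> x \<noteq> 0}) \<and> closure {x. \<phi> x \<noteq> 0} \<subseteq> \<Omega>}"

definition locally_integrable :: "('a::euclidean_space \<Rightarrow> 'b::euclidean_space) \<Rightarrow> bool" where
  "locally_integrable f \<longleftrightarrow> (\<forall>K. compact K \<longrightarrow> set_integrable lebesgue K f)"

definition has_weak_gradient ::
    "('a::euclidean_space \<Rightarrow> real) \<Rightarrow> ('a \<Rightarrow> 'a) \<Rightarrow> bool" where
  "has_weak_gradient u G \<longleftrightarrow> locally_integrable u \<and> locally_integrable G \<and>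
     (\<forall>\<psi>\<in>test_functions UNIV.
        (LINT x|lebesgue. u x *\<^sub>R gradient \<psi> x) = - (LINT x|lebesgue. \<psi> x *\<^sub>R G x))"

text \<open>The weak gradient is determined almost everywhere; the choice of a representative does not
  affect the integrals below.\<close>

definition weak_gradient :: "('a::euclidean_space \<Rightarrow> real) \<Rightarrow> 'a \<Rightarrow> 'a" where
  "weak_gradient u = (SOME G. has_weak_gradient u G)"

definition gagliardo_form ::
    "real \<Rightarrow> ('a::euclidean_space \<Rightarrow> real) \<Rightarrow> ('a \<Rightarrow> real) \<Rightarrow> real" where
  "gagliardo_form s u v =
     (LINT x|lebesgue. (LINT y|lebesgue.
        (u x - u y) * (v x - v y) / norm (x - y) powr (real DIM('a) + 2 * s)))"

text \<open>The norm is only applied to test functions, on which, for \<open>0 < s < 1\<close>, both integrals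
  converge.\<close>

definition X12_norm :: "real \<Rightarrow> ('a::euclidean_space \<Rightarrow> real) \<Rightarrow> real" where
  "X12_norm s \<phi> = sqrt ((LINT x|lebesgue. (norm (gradient \<phi> x))\<^sup>2) + gagliardo_form s \<phi> \<phi>)"

text \<open>The completion of the test functions on a bounded open set \<open>\<Omega>\<close>, realized as a space of
  functions: by the Poincare inequality a Cauchy sequence for the norm converges in \<open>L\<^sup>2\<close>, and an
  element of the completion is identified (up to null sets) with this limit. Limits vanish
  almost everywhere outside \<open>\<Omega>\<close> because the test functions do.\<close>

definition X12 :: "real \<Rightarrow> 'a::euclidean_space set \<Rightarrow> ('a \<Rightarrow> real) set" where
  "X12 s \<Omega> = {u \<in> borel_measurable lebesgue. \<exists>\<phi>. (\<forall>k::nat. \<phi> k \<in> test_functions \<Omega>) \<and>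
     (\<forall>e>0. \<exists>N. \<forall>j\<ge>N. \<forall>k\<ge>N. X12_norm s (\<lambda>x. \<phi> j x - \<phi> k x) < e) \<and>
     (\<lambda>k. \<integral>\<^sup>+x. ennreal ((\<phi> k x - u x)\<^sup>2) \<partial>lebesgue) \<longlonglongrightarrow> 0}"

definition B_form :: "real \<Rightarrow> ('a::euclidean_space \<Rightarrow> real) \<Rightarrow> ('a \<Rightarrow> real) \<Rightarrow> real" where
  "B_form s u v =
     (LINT x|lebesgue. weak_gradient u x \<bullet> weak_gradient v x) + gagliardo_form s u v"

definition L_p :: "real \<Rightarrow> 'a::euclidean_space set \<Rightarrow> ('a \<Rightarrow> real) set" where
  "L_p p \<Omega> = {f \<in> borel_measurable (lebesgue_on \<Omega>).
     integrable (lebesgue_on \<Omega>) (\<lambda>x. \<bar>f x\<bar> powr p)}"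

definition L_infinity :: "'a::euclidean_space set \<Rightarrow> ('a \<Rightarrow> real) set" where
  "L_infinity \<Omega> = {f \<in> borel_measurable (lebesgue_on \<Omega>).
     \<exists>C. AE x in lebesgue_on \<Omega>. \<bar>f x\<bar> \<le> C}"

text \<open>Weak solutions of \<open>- \<Delta> u + (- \<Delta>)\<^sup>s u + a u = f\<close> in \<open>\<Omega>\<close>.\<close>

definition weak_solution ::
    "real \<Rightarrow> 'a::euclidean_space set \<Rightarrow> ('a \<Rightarrow> real) \<Rightarrow> ('a \<Rightarrow> real) \<Rightarrow> ('a \<Rightarrow> real) \<Rightarrow> bool" where
  "weak_solution s \<Omega> a f u \<longleftrightarrow> u \<in> X12 s \<Omega> \<and>
     (\<forall>\<phi>\<in>X12 s \<Omega>. B_form s u \<phi> + (LINT x|lebesgue_on \<Omega>. a x * u x * \<phi> x)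
        = (LINT x|lebesgue_on \<Omega>. f x * \<phi> x))"

end

theory Submission
  imports Defs
begin

text \<open>De Giorgi's truncation method. With \<open>G\<close> a smooth approximation of \<open>t \<mapsto> max 0 (t - k)\<close> satisfying
  \<open>0 \<le> G' \<le> 1\<close>, the test function \<open>G(u)\<close> gives \<open>\<integral> |\<nabla>G(u)|\<^sup>2 \<le> \<integral> (|f| + |a| |u|) G(u)\<close>: the local part
  dominates the left-hand side because \<open>G'\<^sup>2 \<le> G'\<close>, and the nonlocal part is nonnegative because
  \<open>G\<close> is monotone. To stay within smooth functions, \<open>G\<close> is applied not to \<open>u\<close> but to test functions
  converging to \<open>u\<close>, and only the limiting inequality is used. Since \<open>l > n/2\<close>, there is an exponent
  \<open>q\<close> with \<open>2l/(l - 1) < q < 2n/(n - 2)\<close>; the Sobolev inequality for this subcritical \<open>q\<close> and Hoelder's inequality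
  turn the energy inequality into a decay estimate for the measures \<open>|{u > k}|\<close> that forces them
  to vanish for large \<open>k\<close>. The same argument for \<open>- u\<close> gives the lower bound.

  The Sobolev inequality is obtained without polar coordinates: for \<open>\<phi>\<close> supported in a ball,
  \<open>\<phi>(x) = - \<integral>\<^sub>0\<^sup>1 m \<tau>\<^sup>m\<^sup>-\<^sup>1 \<nabla>\<phi>(x + \<tau>\<^sup>m z) \<bullet> z d\<tau>\<close> whenever \<open>x + z\<close> lies outside the support, and this is averaged
  over \<open>z\<close> in another ball; for large \<open>m\<close> the powers of \<open>\<tau>\<close> that arise are integrable.\<close>

section \<open>Smooth functions and test functions\<close>

text \<open>Testing with \<open>G(u)\<close> itself would require a chain rule for weak gradients
  and membership of \<open>G(u)\<close> in \<open>X12\<close>. Composing with the approximants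
  avoids both but creates a diagonal problem: the weak formulation yields the limit of
  \<open>energy s (\<phi> j) \<psi>\<close> for a fixed \<open>\<psi>\<close>, while the truncated
  approximant \<open>\<psi> k\<close> changes with \<open>k\<close>. The Cauchy property controls
  the error, because composition with a nondecreasing 1-Lipschitz function does not increase
  \<open>X12_norm\<close>, so that the \<open>\<psi> k\<close> stay bounded.

  The coefficient \<open>a\<close> may have any sign, hence the term
  \<open>\<bar>a\<bar> \<bar>u\<bar>\<close> has to be absorbed. This works at high levels, where
  the Hoelder estimate carries the measure of \<open>{u > k}\<close> to the power
  \<open>1 - 1/l - 2/q\<close>; this exponent is positive exactly when
  \<open>q > 2l/(l - 1)\<close>. The strict upper bound on \<open>q\<close> is what lets a crude
  averaging argument prove the Sobolev inequality.

  \<open>weak_gradient\<close> is picked by choice, so \<open>B_form\<close> can be evaluated only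
  once weak gradients are known to be unique almost everywhere.\<close>

lemma frechet_derivative_eqI:
  "(f has_derivative f') (at x) \<Longrightarrow> frechet_derivative f (at x) = f'"
  using frechet_derivative_at by metis

text \<open>Allows a derivative to be supplied as a \<open>has_derivative\<close> fact, so that
  \<open>frechet_derivative\<close> need not be computed in each closure property.\<close>

lemma Ck_SucI:
  fixes f :: "'a::euclidean_space \<Rightarrow> real"
  assumes "\<And>x. (f has_derivative f' x) (at x)" and "\<And>b. b \<in> Basis \<Longrightarrow> Ck k (\<lambda>x. f' x b)"
  shows "Ck (Suc k) f"
proof -
  have "(\<lambda>x. frechet_derivative f (at x) b) = (\<lambda>x. f' x b)" for b
    using frechet_derivative_eqI[OF assms(1)] by simp
  then show ?thesis
    using assms by (auto simp: differentiable_def)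
qed

lemma Ck_SucI_real:
  fixes f :: "real \<Rightarrow> real"
  assumes "\<And>x. (f has_real_derivative f' x) (at x)" and "Ck k f'"
  shows "Ck (Suc k) f"
  by (rule Ck_SucI[where f' = "\<lambda>x h. f' x * h"])
     (use assms in \<open>auto simp: has_field_derivative_def\<close>)

lemma Ck_SucD:
  fixes f :: "'a::euclidean_space \<Rightarrow> real"
  shows "Ck (Suc k) f \<Longrightarrow> Ck k f"
proof (induction k arbitrary: f)
  case 0
  then show ?case
    by (simp add: continuous_on_eq_continuous_at differentiable_imp_continuous_within)
next
  case (Suc k)
  have "Ck k (\<lambda>x. frechet_derivative f (at x) b)" if "b \<in> Basis" for b
    by (rule Suc.IH) (use Suc.prems that in simp)
  with Suc.prems show ?case by simp
qed

lemma Ck_continuous: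
  fixes f :: "'a::euclidean_space \<Rightarrow> real"
  shows "Ck k f \<Longrightarrow> continuous_on UNIV f"
  by (induction k) (use Ck_SucD in auto)

lemma Ck_const: "Ck k (\<lambda>x::'a::euclidean_space. c)"
proof (induction k arbitrary: c)
  case (Suc k)
  show ?case by (rule Ck_SucI[where f' = "\<lambda>x h. 0"]) (use Suc in auto)
qed simp

lemma Ck_inner_left: "Ck k (\<lambda>x::'a::euclidean_space. x \<bullet> v)"
proof (cases k)
  case (Suc k')
  show ?thesis unfolding Suc
    by (rule Ck_SucI[where f' = "\<lambda>x h. h \<bullet> v"]) (auto intro!: derivative_eq_intros Ck_const)
qed (auto intro!: continuous_intros)

lemma Ck_add:
  fixes f g :: "'a::euclidean_space \<Rightarrow> real"
  shows "Ck k f \<Longrightarrow> Ck k g \<Longrightarrow> Ck k (\<lambda>x. f x + g x)"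
proof (induction k arbitrary: f g)
  case (Suc k)
  show ?case
  proof (rule Ck_SucI)
    show "((\<lambda>x. f x + g x) has_derivative
        (\<lambda>h. frechet_derivative f (at x) h + frechet_derivative g (at x) h)) (at x)" for x
      using Suc.prems by (auto intro!: derivative_intros simp: frechet_derivative_works[symmetric])
  qed (use Suc in auto)
qed (auto intro: continuous_intros)

lemma Ck_mult:
  fixes f g :: "'a::euclidean_space \<Rightarrow> real"
  shows "Ck k f \<Longrightarrow> Ck k g \<Longrightarrow> Ck k (\<lambda>x. f x * g x)"
proof (induction k arbitrary: f g)
  case (Suc k)
  show ?case
  proof (rule Ck_SucI)
    show "((\<lambda>x. f x * g x) has_derivative
        (\<lambda>h. f x * frechet_derivative g (at x) h + frechet_derivative f (at x) h * g x)) (at x)" for x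
      using Suc.prems by (auto intro!: has_derivative_mult simp: frechet_derivative_works[symmetric])
    fix b :: 'a assume "b \<in> Basis"
    then show "Ck k (\<lambda>x. f x * frechet_derivative g (at x) b + frechet_derivative f (at x) b * g x)"
      using Suc.prems Ck_SucD[OF Suc.prems(1)] Ck_SucD[OF Suc.prems(2)]
      by (intro Ck_add Suc.IH) auto
  qed
qed (auto intro: continuous_intros)

lemma Ck_cmult:
  fixes f :: "'a::euclidean_space \<Rightarrow> real"
  shows "Ck k f \<Longrightarrow> Ck k (\<lambda>x. c * f x)"
  by (rule Ck_mult[OF Ck_const])

lemma Ck_diff:
  fixes f g :: "'a::euclidean_space \<Rightarrow> real"
  shows "Ck k f \<Longrightarrow> Ck k g \<Longrightarrow> Ck k (\<lambda>x. f x - g x)"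
  using Ck_add[of k f "\<lambda>x. (-1) * g x"] Ck_cmult[of k g "-1"] by simp

lemma Ck_prod:
  fixes f :: "'b \<Rightarrow> 'a::euclidean_space \<Rightarrow> real"
  shows "(\<And>i. i \<in> I \<Longrightarrow> Ck k (f i)) \<Longrightarrow> Ck k (\<lambda>x. \<Prod>i\<in>I. f i x)"
  by (induction I rule: infinite_finite_induct) (auto intro: Ck_const Ck_mult)

text \<open>The induction generalizes over both functions, because its step applies the hypothesis
  to \<open>f\<close> and the derivative of \<open>g\<close>.\<close>

lemma Ck_compose:
  fixes f :: "'a::euclidean_space \<Rightarrow> real" and g :: "real \<Rightarrow> real"
  shows "Ck k g \<Longrightarrow> Ck k f \<Longrightarrow> Ck k (\<lambda>x. g (f x))"
proof (induction k arbitrary: f g)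
  case 0
  then show ?case
    using continuous_on_compose2[of UNIV g UNIV f] by simp
next
  case (Suc k)
  define g' where "g' t = frechet_derivative g (at t) 1" for t
  have g': "(g has_derivative (\<lambda>h. h * g' t)) (at t)" for t
  proof -
    have *: "(g has_derivative frechet_derivative g (at t)) (at t)"
      using Suc.prems(1) by (simp add: frechet_derivative_works[symmetric])
    have "frechet_derivative g (at t) h = h * g' t" for h
      using linear_cmul[OF has_derivative_linear[OF *], of h 1] by (simp add: g'_def)
    then have "frechet_derivative g (at t) = (\<lambda>h. h * g' t)" by auto
    with * show ?thesis by simp
  qed
  have Ckg': "Ck k g'"
    using Suc.prems(1) by (simp add: g'_def[abs_def])
  show ?case
  proof (rule Ck_SucI)
    show "((\<lambda>x. g (f x)) has_derivative
        (\<lambda>h. frechet_derivative f (at x) h * g' (f x))) (at x)" for x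
      using Suc.prems(2)
      by (intro has_derivative_compose[OF _ g']) (simp add: frechet_derivative_works[symmetric])
    fix b :: 'a assume "b \<in> Basis"
    then show "Ck k (\<lambda>x. frechet_derivative f (at x) b * g' (f x))"
      using Suc.prems Ck_SucD[OF Suc.prems(2)]
      by (intro Ck_mult Suc.IH[OF Ckg']) auto
  qed
qed

text \<open>The polynomial factor makes this family closed under differentiation.\<close>

definition flat :: "real poly \<Rightarrow> real \<Rightarrow> real" where
  "flat p t = (if t > 0 then poly p (1 / t) * exp (- 1 / t) else 0)"

lemma poly_exp_tendsto_0: "((\<lambda>t. poly p t * exp (- t)) \<longlongrightarrow> 0) (at_top :: real filter)"
proof -
  have "((\<lambda>t. \<Sum>i\<le>degree p. coeff p i * (t ^ i / exp t)) \<longlongrightarrow> (\<Sum>i\<le>degree p. coeff p i * 0)) (at_top :: real filter)"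
    by (intro tendsto_sum tendsto_mult tendsto_const tendsto_power_div_exp_0)
  moreover have "poly p t * exp (- t) = (\<Sum>i\<le>degree p. coeff p i * (t ^ i / exp t))" for t
    by (simp add: poly_altdef sum_distrib_right exp_minus divide_inverse mult.assoc)
  ultimately show ?thesis by simp
qed

lemma flat_tendsto_0: "(flat p \<longlongrightarrow> 0) (at 0)"
proof -
  have "(flat p \<longlongrightarrow> 0) (at_right 0)"
  proof (rule Lim_transform_eventually)
    show "((\<lambda>t. poly p (inverse t) * exp (- inverse t)) \<longlongrightarrow> 0) (at_right 0)"
      by (rule filterlim_compose[OF poly_exp_tendsto_0 filterlim_inverse_at_top_right])
    show "\<forall>\<^sub>F t in at_right 0. poly p (inverse t) * exp (- inverse t) = flat p t"
      by (auto simp: eventually_at_filter flat_def inverse_eq_divide)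
  qed
  moreover have "(flat p \<longlongrightarrow> 0) (at_left 0)"
    by (rule Lim_transform_eventually[OF tendsto_const])
       (auto simp: eventually_at_filter flat_def)
  ultimately show ?thesis
    by (simp add: filterlim_split_at_real)
qed

text \<open>For positive \<open>t\<close>, differentiating \<open>p(1/t) exp(-1/t)\<close> gives
  \<open>(1/t)^2 (p - p')(1/t) exp(-1/t)\<close>, again a member of the family. At 0 the difference
  quotient \<open>flat p h / h\<close> is \<open>flat (pCons 0 p) h\<close>, so the derivative there
  follows from the limit of another member.\<close>

lemma flat_has_derivative:
  "(flat p has_real_derivative flat (monom 1 2 * (p - pderiv p)) t) (at t)"
proof (cases t "0::real" rule: linorder_cases)
  case less
  then have "\<forall>\<^sub>F x in nhds t. flat p x = 0"
    using eventually_nhds_in_open[of "{..<0}" t] by (auto elim!: eventually_mono simp: flat_def)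
  then show ?thesis
    using less by (auto simp: DERIV_cong_ev flat_def)
next
  case equal
  have "((\<lambda>h. flat p h / h) \<longlongrightarrow> 0) (at 0)"
  proof (rule Lim_transform_eventually[OF flat_tendsto_0[of "pCons 0 p"]])
    show "\<forall>\<^sub>F h in at 0. flat (pCons 0 p) h = flat p h / h"
      by (auto simp: eventually_at_filter flat_def)
  qed
  then show ?thesis
    using equal by (simp add: DERIV_def flat_def)
next
  case greater
  then have "\<forall>\<^sub>F x in nhds t. flat p x = poly p (1 / x) * exp (- 1 / x)"
    using eventually_nhds_in_open[of "{0<..}" t] by (auto elim!: eventually_mono simp: flat_def)
  moreover have "((\<lambda>x. poly p (1 / x) * exp (- 1 / x)) has_real_derivative
      flat (monom 1 2 * (p - pderiv p)) t) (at t)"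
    using greater
    by (auto intro!: derivative_eq_intros DERIV_chain2[OF poly_DERIV]
        simp: flat_def poly_monom field_simps power2_eq_square)
  ultimately show ?thesis
    by (subst DERIV_cong_ev) auto
qed

lemma Ck_flat: "Ck k (flat p)"
proof (induction k arbitrary: p)
  case 0
  show ?case
    by (auto intro!: DERIV_isCont[OF flat_has_derivative] continuous_at_imp_continuous_on)
next
  case (Suc k)
  show ?case by (rule Ck_SucI_real[OF flat_has_derivative Suc])
qed

lemma flat_1_bounds: "0 \<le> flat 1 t" "flat 1 t \<le> 1"
  by (auto simp: flat_def)

section \<open>Gradients and closure properties of test functions\<close>

lemma has_derivative_gradient:
  fixes f :: "'a::euclidean_space \<Rightarrow> real"
  assumes "f differentiable (at x)"
  shows "(f has_derivative (\<lambda>h. gradient f x \<bullet> h)) (at x)"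
proof -
  have *: "(f has_derivative frechet_derivative f (at x)) (at x)"
    using assms by (simp add: frechet_derivative_works[symmetric])
  have "frechet_derivative f (at x) h = gradient f x \<bullet> h" for h
  proof -
    have "frechet_derivative f (at x) h = frechet_derivative f (at x) (\<Sum>b\<in>Basis. (h \<bullet> b) *\<^sub>R b)"
      by (simp add: euclidean_representation)
    also have "\<dots> = gradient f x \<bullet> h"
      using has_derivative_linear[OF *]
      by (simp add: linear_sum linear_cmul gradient_def inner_sum_left inner_commute[of h] mult.commute)
    finally show ?thesis .
  qed
  then have "frechet_derivative f (at x) = (\<lambda>h. gradient f x \<bullet> h)" by auto
  with * show ?thesis by simp
qed

lemma gradient_eqI:
  fixes f :: "'a::euclidean_space \<Rightarrow> real"
  assumes "(f has_derivative (\<lambda>h. v \<bullet> h)) (at x)"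
  shows "gradient f x = v"
  unfolding gradient_def frechet_derivative_eqI[OF assms] by (simp add: euclidean_representation)

lemma gradient_inner_Basis:
  fixes f :: "'a::euclidean_space \<Rightarrow> real"
  shows "b \<in> Basis \<Longrightarrow> gradient f x \<bullet> b = frechet_derivative f (at x) b"
  unfolding gradient_def by (simp add: inner_sum_left_Basis)

lemma test_functions_Ck: "\<phi> \<in> test_functions \<Omega> \<Longrightarrow> Ck k \<phi>"
  by (simp add: test_functions_def)

lemma test_functions_differentiable: "\<phi> \<in> test_functions \<Omega> \<Longrightarrow> \<phi> differentiable (at x)"
  using test_functions_Ck[of \<phi> \<Omega> "Suc 0"] by simp

lemma test_functions_has_derivative:
  "\<phi> \<in> test_functions \<Omega> \<Longrightarrow> (\<phi> has_derivative (\<lambda>h. gradient \<phi> x \<bullet> h)) (at x)"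
  by (intro has_derivative_gradient test_functions_differentiable)

lemma test_functions_continuous: "\<phi> \<in> test_functions \<Omega> \<Longrightarrow> continuous_on UNIV \<phi>"
  by (rule Ck_continuous[OF test_functions_Ck])

lemma test_functions_continuous_gradient:
  assumes "\<phi> \<in> test_functions \<Omega>"
  shows "continuous_on UNIV (gradient \<phi>)"
  unfolding gradient_def
  using test_functions_Ck[OF assms, of "Suc 0"]
  by (intro continuous_on_sum continuous_on_scaleR continuous_on_const) simp

lemma test_functionsI:
  assumes "\<And>k. Ck k \<phi>" "compact K" "K \<subseteq> \<Omega>" "\<And>x. x \<notin> K \<Longrightarrow> \<phi> x = 0"
  shows "\<phi> \<in> test_functions \<Omega>"
proof -
  have "closure {x. \<phi> x \<noteq> 0} \<subseteq> K"
    using assms(4) compact_imp_closed[OF assms(2)] by (intro closure_minimal) blast+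
  moreover from this have "compact (closure {x. \<phi> x \<noteq> 0})"
    using compact_Int_closed[OF assms(2) closed_closure[of "{x. \<phi> x \<noteq> 0}"]]
    by (simp add: Int_absorb1)
  ultimately show ?thesis
    using assms(1,3) by (auto simp: test_functions_def)
qed

lemma test_functions_support:
  assumes "\<phi> \<in> test_functions \<Omega>"
  obtains K where "compact K" "K \<subseteq> \<Omega>" "\<And>x. x \<notin> K \<Longrightarrow> \<phi> x = 0" "\<And>x. x \<notin> K \<Longrightarrow> gradient \<phi> x = 0"
proof -
  define K where "K = closure {x. \<phi> x \<noteq> 0}"
  have K: "compact K" "K \<subseteq> \<Omega>"
    using assms unfolding test_functions_def K_def by blast+
  have zero: "\<phi> x = 0" if "x \<notin> K" for x
    using that closure_subset[of "{x. \<phi> x \<noteq> 0}"] unfolding K_def by blast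
  have "gradient \<phi> x = 0" if "x \<notin> K" for x
  proof (rule gradient_eqI)
    have "((\<lambda>x. 0) has_derivative (\<lambda>h. 0 \<bullet> h)) (at x)"
      by simp
    then show "(\<phi> has_derivative (\<lambda>h. 0 \<bullet> h)) (at x)"
      by (rule has_derivative_transform_within_open[where s = "- K"])
         (use that zero compact_imp_closed[OF K(1)] in \<open>auto simp: open_Compl\<close>)
  qed
  with K zero show ?thesis by (rule that)
qed

lemma test_functions_mono: "\<phi> \<in> test_functions \<Omega> \<Longrightarrow> \<Omega> \<subseteq> \<Omega>' \<Longrightarrow> \<phi> \<in> test_functions \<Omega>'"
  unfolding test_functions_def by blast

lemma test_functions_diff:
  assumes "\<phi> \<in> test_functions \<Omega>" "\<psi> \<in> test_functions \<Omega>"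
  shows "(\<lambda>x. \<phi> x - \<psi> x) \<in> test_functions \<Omega>"
proof -
  obtain K where K: "compact K" "K \<subseteq> \<Omega>" "\<And>x. x \<notin> K \<Longrightarrow> \<phi> x = 0"
    using test_functions_support[OF assms(1)] by metis
  obtain L where L: "compact L" "L \<subseteq> \<Omega>" "\<And>x. x \<notin> L \<Longrightarrow> \<psi> x = 0"
    using test_functions_support[OF assms(2)] by metis
  show ?thesis
    by (rule test_functionsI[where K = "K \<union> L"])
       (use K L assms in \<open>auto intro!: Ck_diff test_functions_Ck[OF assms(1)] test_functions_Ck[OF assms(2)]\<close>)
qed

lemma test_functions_mult:
  assumes "\<phi> \<in> test_functions \<Omega>" "\<And>k. Ck k \<psi>"
  shows "(\<lambda>x. \<phi> x * \<psi> x) \<in> test_functions \<Omega>"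
proof -
  obtain K where K: "compact K" "K \<subseteq> \<Omega>" "\<And>x. x \<notin> K \<Longrightarrow> \<phi> x = 0"
    using test_functions_support[OF assms(1)] by metis
  show ?thesis
    by (rule test_functionsI[where K = K])
       (use K assms in \<open>auto intro: Ck_mult[OF test_functions_Ck[OF assms(1)]]\<close>)
qed

lemma test_functions_uminus:
  assumes "\<phi> \<in> test_functions \<Omega>"
  shows "(\<lambda>x. - \<phi> x) \<in> test_functions \<Omega>"
  using test_functions_mult[OF assms Ck_const[where c = "-1"]] by simp

lemma test_functions_compose:
  assumes "\<phi> \<in> test_functions \<Omega>" "\<And>k. Ck k g" "g 0 = 0"
  shows "(\<lambda>x. g (\<phi> x)) \<in> test_functions \<Omega>"
proof -
  obtain K where K: "compact K" "K \<subseteq> \<Omega>" "\<And>x. x \<notin> K \<Longrightarrow> \<phi> x = 0"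
    using test_functions_support[OF assms(1)] by metis
  show ?thesis
    by (rule test_functionsI[where K = K])
       (use K assms(3) Ck_compose[OF assms(2) test_functions_Ck[OF assms(1)]] in auto)
qed

lemma test_functions_partial_derivative:
  assumes "\<phi> \<in> test_functions \<Omega>" "b \<in> Basis"
  shows "(\<lambda>x. gradient \<phi> x \<bullet> b) \<in> test_functions \<Omega>"
proof -
  obtain K where K: "compact K" "K \<subseteq> \<Omega>" "\<And>x. x \<notin> K \<Longrightarrow> gradient \<phi> x = 0"
    using test_functions_support[OF assms(1)] by metis
  show ?thesis
  proof (rule test_functionsI[where K = K])
    show "Ck k (\<lambda>x. gradient \<phi> x \<bullet> b)" for k
      using test_functions_Ck[OF assms(1), of "Suc k"] assms(2) by (simp add: gradient_inner_Basis)
  qed (use K in auto)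
qed

lemma gradient_diff:
  assumes "\<phi> \<in> test_functions \<Omega>" "\<psi> \<in> test_functions \<Omega>'"
  shows "gradient (\<lambda>x. \<phi> x - \<psi> x) x = gradient \<phi> x - gradient \<psi> x"
  using assms[THEN test_functions_has_derivative]
  by (intro gradient_eqI) (auto intro!: derivative_eq_intros simp: inner_diff_left)

lemma gradient_mult:
  assumes "\<phi> \<in> test_functions \<Omega>" "\<psi> \<in> test_functions \<Omega>'"
  shows "gradient (\<lambda>x. \<phi> x * \<psi> x) x = \<phi> x *\<^sub>R gradient \<psi> x + \<psi> x *\<^sub>R gradient \<phi> x"
  using assms[THEN test_functions_has_derivative]
  by (intro gradient_eqI) (auto intro!: derivative_eq_intros simp: inner_add_left)

lemma gradient_compose:
  assumes "\<phi> \<in> test_functions \<Omega>" "(g has_real_derivative d) (at (\<phi> x))"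
  shows "gradient (\<lambda>x. g (\<phi> x)) x = d *\<^sub>R gradient \<phi> x"
  using has_derivative_compose[OF test_functions_has_derivative[OF assms(1), of x], of g "\<lambda>h. d * h"] assms(2)
  by (intro gradient_eqI) (simp add: has_field_derivative_def)

section \<open>Integral inequalities\<close>

lemma powr_powr_le_weighted_sum:
  fixes x y a b :: real
  assumes "0 \<le> x" "0 \<le> y" "0 < a" "0 < b" "a + b = 1"
  shows "x powr a * y powr b \<le> a * x + b * y"
proof (cases "x = 0 \<or> y = 0")
  case False
  then show ?thesis using Youngs_inequality_0[of a b x y] assms by simp
qed (use assms in auto)

text \<open>After division by the two integrals this is the weighted Young inequality integrated
  pointwise; if one integral is zero, the product vanishes almost everywhere. Stating it for
  integrable nonnegative functions with exponents summing to 1, rather than for conjugate norms,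
  makes it easy to iterate.\<close>

lemma Hoelder2:
  fixes f g :: "'a \<Rightarrow> real"
  assumes f: "integrable M f" "\<And>x. 0 \<le> f x" and g: "integrable M g" "\<And>x. 0 \<le> g x"
    and ab: "0 < a" "0 < b" "a + b = 1"
  shows "integrable M (\<lambda>x. f x powr a * g x powr b)"
    and "(LINT x|M. f x powr a * g x powr b) \<le> (LINT x|M. f x) powr a * (LINT x|M. g x) powr b"
proof -
  define F where "F = (LINT x|M. f x)"
  define G where "G = (LINT x|M. g x)"
  have [measurable]: "f \<in> borel_measurable M" "g \<in> borel_measurable M"
    using f g by auto
  have FG: "0 \<le> F" "0 \<le> G" using f g by (auto simp: F_def G_def)
  show int: "integrable M (\<lambda>x. f x powr a * g x powr b)"
  proof (rule Bochner_Integration.integrable_bound)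
    show "integrable M (\<lambda>x. a * f x + b * g x)"
      using f g by auto
    show "AE x in M. norm (f x powr a * g x powr b) \<le> norm (a * f x + b * g x)"
      using powr_powr_le_weighted_sum[OF f(2) g(2) ab] by (intro AE_I2) (smt (verit) mult_nonneg_nonneg powr_ge_zero real_norm_def)
  qed measurable
  show "(LINT x|M. f x powr a * g x powr b) \<le> F powr a * G powr b"
  proof (cases "F = 0 \<or> G = 0")
    case True
    then have "(AE x in M. f x = 0) \<or> (AE x in M. g x = 0)"
      using integral_nonneg_eq_0_iff_AE[OF f(1)] integral_nonneg_eq_0_iff_AE[OF g(1)] f(2) g(2)
      by (auto simp: F_def G_def)
    then have "AE x in M. f x powr a * g x powr b = 0"
      by (auto elim: AE_mp)
    then have "(LINT x|M. f x powr a * g x powr b) = 0"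
      by (intro integral_eq_zero_AE)
    then show ?thesis by simp
  next
    case False
    with FG have pos: "F > 0" "G > 0" by auto
    have "(LINT x|M. f x powr a * g x powr b) \<le> (LINT x|M. F powr a * G powr b * (a * (f x / F) + b * (g x / G)))"
    proof (rule integral_mono[OF int])
      show "integrable M (\<lambda>x. F powr a * G powr b * (a * (f x / F) + b * (g x / G)))"
        using f g by auto
      fix x
      have "f x powr a * g x powr b = F powr a * G powr b * ((f x / F) powr a * (g x / G) powr b)"
        using pos f(2)[of x] g(2)[of x] by (simp add: powr_divide)
      also have "\<dots> \<le> F powr a * G powr b * (a * (f x / F) + b * (g x / G))"
        using pos f(2)[of x] g(2)[of x] ab by (intro mult_left_mono powr_powr_le_weighted_sum) auto
      finally show "f x powr a * g x powr b \<le> F powr a * G powr b * (a * (f x / F) + b * (g x / G))" .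
    qed
    also have "\<dots> = F powr a * G powr b * (a * (F / F) + b * (G / G))"
      using f g by (simp add: F_def G_def)
    also have "\<dots> = F powr a * G powr b"
      using pos ab by simp
    finally show ?thesis .
  qed
qed

text \<open>The last two functions are merged into the geometric mean \<open>k\<close> with weights
  \<open>b/(b + c)\<close> and \<open>c/(b + c)\<close>, and the two-function inequality is used
  twice.\<close>

lemma Hoelder3:
  fixes f g h :: "'a \<Rightarrow> real"
  assumes f: "integrable M f" "\<And>x. 0 \<le> f x" and g: "integrable M g" "\<And>x. 0 \<le> g x"
    and h: "integrable M h" "\<And>x. 0 \<le> h x"
    and abc: "0 < a" "0 < b" "0 < c" "a + b + c = 1"
  shows "integrable M (\<lambda>x. f x powr a * g x powr b * h x powr c)"
    and "(LINT x|M. f x powr a * g x powr b * h x powr c)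
      \<le> (LINT x|M. f x) powr a * (LINT x|M. g x) powr b * (LINT x|M. h x) powr c"
proof -
  define k where "k x = g x powr (b / (b + c)) * h x powr (c / (b + c))" for x
  have bc: "b / (b + c) + c / (b + c) = 1" using abc by (simp add: add_divide_distrib[symmetric])
  have k: "integrable M k"
    "(LINT x|M. k x) \<le> (LINT x|M. g x) powr (b / (b + c)) * (LINT x|M. h x) powr (c / (b + c))"
    unfolding k_def using Hoelder2[OF g h _ _ bc] abc by auto
  have k0: "0 \<le> k x" for x by (simp add: k_def)
  have eq: "f x powr a * g x powr b * h x powr c = f x powr a * k x powr (b + c)" for x
    using abc by (simp add: k_def powr_mult powr_powr)
  have *: "0 < a" "0 < b + c" "a + (b + c) = 1" using abc by auto
  show "integrable M (\<lambda>x. f x powr a * g x powr b * h x powr c)"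
    unfolding eq by (rule Hoelder2(1)[OF f k(1) k0 *])
  have "(LINT x|M. f x powr a * g x powr b * h x powr c) \<le> (LINT x|M. f x) powr a * (LINT x|M. k x) powr (b + c)"
    unfolding eq by (rule Hoelder2(2)[OF f k(1) k0 *])
  also have "\<dots> \<le> (LINT x|M. f x) powr a * ((LINT x|M. g x) powr (b / (b + c)) * (LINT x|M. h x) powr (c / (b + c))) powr (b + c)"
    using k0 * k(2) by (intro mult_left_mono powr_mono2) auto
  also have "\<dots> = (LINT x|M. f x) powr a * (LINT x|M. g x) powr b * (LINT x|M. h x) powr c"
    using abc by (simp add: powr_mult powr_powr)
  finally show "(LINT x|M. f x powr a * g x powr b * h x powr c)
      \<le> (LINT x|M. f x) powr a * (LINT x|M. g x) powr b * (LINT x|M. h x) powr c" .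
qed

text \<open>The case of both exponents 1/2, applied to the squared norms. The vector-valued form
  serves gradients as well as real difference quotients, whose inner product is
  multiplication.\<close>

lemma L2_inner:
  fixes f g :: "'a \<Rightarrow> 'b::euclidean_space"
  assumes [measurable]: "f \<in> borel_measurable M" "g \<in> borel_measurable M"
    and f: "integrable M (\<lambda>x. (norm (f x))\<^sup>2)" and g: "integrable M (\<lambda>x. (norm (g x))\<^sup>2)"
  shows "integrable M (\<lambda>x. f x \<bullet> g x)"
    and "\<bar>LINT x|M. f x \<bullet> g x\<bar> \<le> sqrt (LINT x|M. (norm (f x))\<^sup>2) * sqrt (LINT x|M. (norm (g x))\<^sup>2)"
proof -
  have eq: "(norm (f x))\<^sup>2 powr (1/2) * (norm (g x))\<^sup>2 powr (1/2) = norm (f x) * norm (g x)" for x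
    by (simp add: powr_half_sqrt)
  have *: "integrable M (\<lambda>x. norm (f x) * norm (g x))"
    "(LINT x|M. norm (f x) * norm (g x)) \<le> sqrt (LINT x|M. (norm (f x))\<^sup>2) * sqrt (LINT x|M. (norm (g x))\<^sup>2)"
    using Hoelder2[OF f _ g, of "1/2" "1/2"] unfolding eq by (auto simp: powr_half_sqrt)
  show int: "integrable M (\<lambda>x. f x \<bullet> g x)"
    by (rule Bochner_Integration.integrable_bound[OF *(1)]) (auto simp: Cauchy_Schwarz_ineq2)
  have "\<bar>LINT x|M. f x \<bullet> g x\<bar> \<le> (LINT x|M. norm (f x) * norm (g x))"
    using order_trans[OF integral_norm_bound[of M "\<lambda>x. f x \<bullet> g x"] integral_mono[OF integrable_norm[OF int] *(1)]]
    by (simp add: Cauchy_Schwarz_ineq2)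
  with *(2) show "\<bar>LINT x|M. f x \<bullet> g x\<bar> \<le> sqrt (LINT x|M. (norm (f x))\<^sup>2) * sqrt (LINT x|M. (norm (g x))\<^sup>2)"
    by simp
qed

lemma integrable_norm_power2_diff:
  fixes f g :: "'a \<Rightarrow> 'b::euclidean_space"
  assumes [measurable]: "f \<in> borel_measurable M" "g \<in> borel_measurable M"
    and f: "integrable M (\<lambda>x. (norm (f x))\<^sup>2)" and g: "integrable M (\<lambda>x. (norm (g x))\<^sup>2)"
  shows "integrable M (\<lambda>x. (norm (f x - g x))\<^sup>2)"
proof (rule Bochner_Integration.integrable_bound)
  show "integrable M (\<lambda>x. 2 * (norm (f x))\<^sup>2 + 2 * (norm (g x))\<^sup>2)"
    using f g by auto
  have "(norm (f x - g x))\<^sup>2 \<le> 2 * (norm (f x))\<^sup>2 + 2 * (norm (g x))\<^sup>2" for x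
  proof -
    have "(norm (f x - g x))\<^sup>2 \<le> (norm (f x) + norm (g x))\<^sup>2"
      by (intro power_mono norm_triangle_ineq4) auto
    also have "\<dots> \<le> 2 * (norm (f x))\<^sup>2 + 2 * (norm (g x))\<^sup>2"
      using sum_squares_bound[of "norm (f x)" "norm (g x)"] by (simp add: power2_sum)
    finally show ?thesis .
  qed
  then show "AE x in M. norm ((norm (f x - g x))\<^sup>2) \<le> norm (2 * (norm (f x))\<^sup>2 + 2 * (norm (g x))\<^sup>2)"
    by simp
qed measurable

text \<open>A convergent sequence \<open>r\<close> of bounds is allowed instead of one constant:
  completeness arguments use a constant, but the energy inequality has right-hand sides that
  themselves converge.\<close>

lemma Fatou_real:
  fixes f :: "'a \<Rightarrow> real" and F :: "nat \<Rightarrow> 'a \<Rightarrow> real"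
  assumes f: "f \<in> borel_measurable M" and F: "\<And>k. integrable M (F k)" "\<And>k x. 0 \<le> F k x"
    and le: "\<And>k. (LINT x|M. F k x) \<le> r k" and r: "r \<longlonglongrightarrow> R"
    and ae: "AE x in M. (\<lambda>k. F k x) \<longlonglongrightarrow> f x"
  shows "integrable M f" "(LINT x|M. f x) \<le> R"
proof -
  have nonneg: "AE x in M. 0 \<le> f x"
    using ae by eventually_elim (rule LIMSEQ_le_const, use F(2) in auto)
  have R0: "0 \<le> R"
    by (rule LIMSEQ_le_const[OF r]) (use F(2) in \<open>auto intro!: exI[of _ 0] order_trans[OF _ le] integral_nonneg_AE\<close>)
  have "(\<integral>\<^sup>+x. ennreal (f x) \<partial>M) = (\<integral>\<^sup>+x. liminf (\<lambda>k. ennreal (F k x)) \<partial>M)"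
  proof (rule nn_integral_cong_AE)
    show "AE x in M. ennreal (f x) = liminf (\<lambda>k. ennreal (F k x))"
      using ae by eventually_elim (auto intro!: lim_imp_Liminf[symmetric] tendsto_ennrealI)
  qed
  also have "\<dots> \<le> liminf (\<lambda>k. \<integral>\<^sup>+x. ennreal (F k x) \<partial>M)"
    using F(1) by (intro nn_integral_liminf) auto
  also have "\<dots> \<le> liminf (\<lambda>k. ennreal (r k))"
    by (intro Liminf_mono always_eventually allI)
       (use F le in \<open>auto simp: nn_integral_eq_integral intro!: ennreal_leI\<close>)
  also have "\<dots> = ennreal R"
    using r by (intro lim_imp_Liminf tendsto_ennrealI) auto
  finally have *: "(\<integral>\<^sup>+x. ennreal (f x) \<partial>M) \<le> ennreal R" .
  show int: "integrable M f"
    using * nonneg f by (intro integrableI_nonneg) (auto simp: less_top[symmetric] top_unique)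
  show "(LINT x|M. f x) \<le> R"
    using * R0 nn_integral_eq_integral[OF int nonneg] by simp
qed

section \<open>De Giorgi's iteration\<close>

text \<open>The ratio \<open>\<mu> = 2 powr (- 1 / \<delta>)\<close> is chosen so that
  \<open>(\<mu> powr \<delta>) ^ j\<close> cancels the growing factor \<open>2 ^ j\<close>. Then
  \<open>a j \<le> a 0 * \<mu> ^ j\<close> reproduces itself as soon as
  \<open>c * a 0 powr \<delta> \<le> \<mu>\<close>, which is the smallness hypothesis.\<close>

lemma fast_geometric_convergence:
  fixes a :: "nat \<Rightarrow> real"
  assumes a0: "\<And>j. 0 \<le> a j" and step: "\<And>j. a (Suc j) \<le> c * 2 ^ j * a j powr (1 + \<delta>)"
    and "0 \<le> c" "0 < \<delta>" and small: "c * 2 powr (1 / \<delta>) * a 0 powr \<delta> \<le> 1"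
  shows "a \<longlonglongrightarrow> 0"
proof -
  define \<mu> where "\<mu> = 2 powr (- 1 / \<delta>)"
  have \<mu>: "0 < \<mu>" "\<mu> < 1" "\<mu> powr \<delta> = 1 / 2" "2 powr (1 / \<delta>) * \<mu> = 1"
    unfolding \<mu>_def powr_powr using \<open>0 < \<delta>\<close> powr_less_mono[of "- 1 / \<delta>" 0 2]
    by (simp_all add: powr_minus_divide powr_add[symmetric])
  have small': "c * a 0 powr \<delta> \<le> \<mu>"
  proof -
    have "c * a 0 powr \<delta> = c * 2 powr (1 / \<delta>) * a 0 powr \<delta> * \<mu>"
      using \<mu>(4) by (simp add: algebra_simps)
    also have "\<dots> \<le> 1 * \<mu>"
      using small \<mu> by (intro mult_right_mono) auto
    finally show ?thesis by simp
  qed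
  have le: "a j \<le> a 0 * \<mu> ^ j" for j
  proof (induction j)
    case (Suc j)
    have "a (Suc j) \<le> c * 2 ^ j * a j powr (1 + \<delta>)" by (rule step)
    also have "\<dots> \<le> c * 2 ^ j * (a 0 * \<mu> ^ j) powr (1 + \<delta>)"
      using Suc a0 assms(3,4) by (intro mult_left_mono powr_mono2) auto
    also have "(a 0 * \<mu> ^ j) powr (1 + \<delta>) = a 0 * a 0 powr \<delta> * \<mu> ^ j * (\<mu> powr \<delta>) ^ j"
      using a0[of 0] \<mu>(1) by (simp add: powr_mult powr_add powr_realpow[symmetric] powr_powr mult.commute)
    also have "c * 2 ^ j * (a 0 * a 0 powr \<delta> * \<mu> ^ j * (\<mu> powr \<delta>) ^ j) = (c * a 0 powr \<delta>) * (a 0 * \<mu> ^ j)"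
      unfolding \<mu>(3) by (simp add: power_one_over)
    also have "\<dots> \<le> \<mu> * (a 0 * \<mu> ^ j)"
      using small' a0 \<mu> by (intro mult_right_mono) auto
    finally show ?case by (simp add: algebra_simps)
  qed simp
  show ?thesis
  proof (rule tendsto_sandwich[OF _ _ tendsto_const])
    show "(\<lambda>j. a 0 * \<mu> ^ j) \<longlonglongrightarrow> 0"
      using \<mu> by (auto intro!: tendsto_mult_right_zero LIMSEQ_power_zero)
  qed (use a0 le in auto)
qed

text \<open>The hypothesis \<open>energy\<close> is all that the equation and the Sobolev inequality
  contribute; the rest is measure theory. On \<open>{u > k}\<close> the factor
  \<open>1 + \<bar>u\<bar>\<close> is at most \<open>2 (w + k)\<close>, which splits the right-hand
  side into a part quadratic in \<open>w\<close> and a part linear in \<open>w\<close>. Hoelder's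
  inequality puts a positive power of the measure of \<open>{u > k}\<close> in front of each. Once
  that measure is small the quadratic part is absorbed on the left, and Chebyshev's inequality turns
  the remainder into a superlinear recursion for the measures along increasing levels.\<close>

lemma De_Giorgi_iteration:
  fixes u g :: "'a \<Rightarrow> real"
  assumes "finite_measure M" and [measurable]: "u \<in> borel_measurable M" "g \<in> borel_measurable M"
    and g: "integrable M (\<lambda>x. g x powr l)" "\<And>x. 0 \<le> g x"
    and u: "integrable M (\<lambda>x. \<bar>u x\<bar> powr q)"
    and lq: "1 < l" "2 < q" "1 / l + 2 / q < 1" and "0 \<le> C"
    and energy: "\<And>k. 1 \<le> k \<Longrightarrow> (LINT x|M. max 0 (u x - k) powr q) powr (2 / q)
      \<le> C * (LINT x|M. g x * (1 + \<bar>u x\<bar>) * max 0 (u x - k))"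
  shows "\<exists>K. AE x in M. u x \<le> K"
proof -
  interpret finite_measure M by fact
  define w where "w k x = max 0 (u x - k)" for k x
  define A where "A k = {x \<in> space M. k < u x}" for k
  have [measurable]: "A k \<in> sets M" "w k \<in> borel_measurable M" for k
    by (auto simp: A_def w_def[abs_def])
  \<comment> \<open>The power \<open>1 / q\<close> puts the measure on the scale of an L^q norm, so
    that Chebyshev's inequality below becomes linear in \<open>\<alpha> h\<close> and
    \<open>W k\<close>.\<close>
  define \<alpha> where "\<alpha> k = measure M (A k) powr (1 / q)" for k
  define W where "W k = (LINT x|M. w k x powr q) powr (1 / q)" for k
  define G where "G = (LINT x|M. g x powr l) powr (1 / l)"
  \<comment> \<open>The Hoelder exponent left for the indicator of \<open>A k\<close> after
    \<open>g\<close> in L^l and two factors \<open>w\<close> in L^q. With a single factor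
    \<open>w\<close> the remainder is \<open>\<theta> + 1 / q\<close>. Inserting the indicator costs
    nothing, as \<open>w k\<close> vanishes off \<open>A k\<close>.\<close>
  define \<theta> where "\<theta> = 1 - 1 / l - 2 / q"
  define \<delta> where "\<delta> = q * \<theta>"
  define D where "D = 2 * C * G"
  have \<theta>: "0 < \<theta>" "0 < \<delta>" using lq by (auto simp: \<theta>_def \<delta>_def)
  have \<theta>q: "0 < 1 / l" "0 < 1 / q" "0 < \<theta> + 1 / q" "1 / l + 1 / q + (\<theta> + 1 / q) = 1"
    using lq \<theta>(1) add_pos_pos[OF \<theta>(1), of "1 / q"] by (simp_all add: \<theta>_def)
  have W2: "(W k)\<^sup>2 = (LINT x|M. w k x powr q) powr (2 / q)" for k
    unfolding W_def power2_eq_square by (simp flip: powr_add add_divide_distrib)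
  have w0: "0 \<le> w k x" for k x by (simp add: w_def)
  have \<alpha>0: "0 \<le> \<alpha> k" and W0: "0 \<le> W k" and G0: "0 \<le> G" and D0: "0 \<le> D" for k
    using \<open>0 \<le> C\<close> by (auto simp: \<alpha>_def W_def G_def D_def)
  have wq: "integrable M (\<lambda>x. w k x powr q)" if "0 \<le> k" for k
    by (rule Bochner_Integration.integrable_bound[OF u])
       (use that lq in \<open>auto simp: w_def intro!: powr_mono2\<close>)
  have iA: "integrable M (indicat_real (A k))" for k
    by (simp add: integrable_indicator_iff emeasure_eq_measure)
  have I2: "integrable M (\<lambda>x. g x * (w k x)\<^sup>2 * indicator (A k) x)"
    "(LINT x|M. g x * (w k x)\<^sup>2 * indicator (A k) x) \<le> G * (W k)\<^sup>2 * \<alpha> k powr \<delta>" if k: "0 \<le> k" for k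
  proof -
    have eq: "g x * (w k x)\<^sup>2 * indicator (A k) x
      = (g x powr l) powr (1 / l) * (w k x powr q) powr (2 / q) * indicat_real (A k) x powr \<theta>" for x
      using lq g(2)[of x] w0[of k x] by (auto simp: powr_powr indicator_def powr_numeral)
    show "integrable M (\<lambda>x. g x * (w k x)\<^sup>2 * indicator (A k) x)"
      unfolding eq using lq \<theta> by (intro Hoelder3(1)[OF g(1) _ wq[OF k] _ iA]) (auto simp: \<theta>_def)
    have "(LINT x|M. g x * (w k x)\<^sup>2 * indicator (A k) x)
      \<le> (LINT x|M. g x powr l) powr (1 / l) * (LINT x|M. w k x powr q) powr (2 / q)
        * (LINT x|M. indicat_real (A k) x) powr \<theta>"
      unfolding eq using lq \<theta> by (intro Hoelder3(2)[OF g(1) _ wq[OF k] _ iA]) (auto simp: \<theta>_def)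
    also have "(LINT x|M. w k x powr q) powr (2 / q) = (W k)\<^sup>2"
      by (simp add: W2)
    also have "(LINT x|M. indicat_real (A k) x) powr \<theta> = \<alpha> k powr \<delta>"
      using lq by (simp add: \<alpha>_def \<delta>_def powr_powr)
    finally show "(LINT x|M. g x * (w k x)\<^sup>2 * indicator (A k) x) \<le> G * (W k)\<^sup>2 * \<alpha> k powr \<delta>"
      by (simp add: G_def)
  qed
  have I1: "integrable M (\<lambda>x. g x * w k x * indicator (A k) x)"
    "(LINT x|M. g x * w k x * indicator (A k) x) \<le> G * W k * \<alpha> k powr (1 + \<delta>)" if k: "0 \<le> k" for k
  proof -
    have eq: "g x * w k x * indicator (A k) x
      = (g x powr l) powr (1 / l) * (w k x powr q) powr (1 / q) * indicat_real (A k) x powr (\<theta> + 1 / q)" for x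
      using lq g(2)[of x] w0[of k x] by (auto simp: powr_powr indicator_def)
    show "integrable M (\<lambda>x. g x * w k x * indicator (A k) x)"
      unfolding eq using \<theta>q by (intro Hoelder3(1)[OF g(1) _ wq[OF k] _ iA]) auto
    have "(LINT x|M. g x * w k x * indicator (A k) x)
      \<le> (LINT x|M. g x powr l) powr (1 / l) * (LINT x|M. w k x powr q) powr (1 / q)
        * (LINT x|M. indicat_real (A k) x) powr (\<theta> + 1 / q)"
      unfolding eq using \<theta>q by (intro Hoelder3(2)[OF g(1) _ wq[OF k] _ iA]) auto
    also have "(LINT x|M. indicat_real (A k) x) powr (\<theta> + 1 / q) = \<alpha> k powr (1 + \<delta>)"
      using lq by (simp add: \<alpha>_def \<delta>_def powr_powr add_divide_distrib add.commute)
    finally show "(LINT x|M. g x * w k x * indicator (A k) x) \<le> G * W k * \<alpha> k powr (1 + \<delta>)"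
      by (simp add: G_def W_def)
  qed
  have main: "(W k)\<^sup>2 \<le> D * \<alpha> k powr \<delta> * (W k)\<^sup>2 + D * k * W k * \<alpha> k powr (1 + \<delta>)" if k: "1 \<le> k" for k
  proof -
    have k0: "0 \<le> k" using k by simp
    have "(W k)\<^sup>2 = (LINT x|M. max 0 (u x - k) powr q) powr (2 / q)"
      by (simp add: W2 w_def)
    also have "\<dots> \<le> C * (LINT x|M. g x * (1 + \<bar>u x\<bar>) * max 0 (u x - k))"
      by (rule energy[OF k])
    also have "\<dots> \<le> C * (LINT x|M. 2 * (g x * (w k x)\<^sup>2 * indicator (A k) x) + 2 * k * (g x * w k x * indicator (A k) x))"
    proof (intro mult_left_mono integral_mono' \<open>0 \<le> C\<close>)
      fix x assume x: "x \<in> space M"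
      show "g x * (1 + \<bar>u x\<bar>) * max 0 (u x - k) \<le> 2 * (g x * (w k x)\<^sup>2 * indicator (A k) x) + 2 * k * (g x * w k x * indicator (A k) x)"
      proof (cases "k < u x")
        case True
        \<comment> \<open>Here \<open>u x = w k x + k\<close>, and \<open>1 \<le> k\<close> gives
          \<open>1 + u x \<le> 2 * u x\<close>.\<close>
        have "g x * (1 + \<bar>u x\<bar>) * w k x \<le> g x * (2 * (w k x + k)) * w k x"
          using True k g(2)[of x] by (intro mult_right_mono mult_left_mono) (auto simp: w_def)
        also have "\<dots> = 2 * (g x * (w k x)\<^sup>2 * indicator (A k) x) + 2 * k * (g x * w k x * indicator (A k) x)"
          using True x by (simp add: A_def algebra_simps power2_eq_square)
        finally show ?thesis by (simp add: w_def)
      qed (simp add: A_def)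
    qed (use I1(1)[OF k0] I2(1)[OF k0] g(2) w0 k0 in \<open>auto intro!: mult_nonneg_nonneg add_nonneg_nonneg\<close>)
    also have "\<dots> = C * (2 * (LINT x|M. g x * (w k x)\<^sup>2 * indicator (A k) x) + 2 * k * (LINT x|M. g x * w k x * indicator (A k) x))"
      using I1(1)[OF k0] I2(1)[OF k0] by simp
    also have "\<dots> \<le> C * (2 * (G * (W k)\<^sup>2 * \<alpha> k powr \<delta>) + 2 * k * (G * W k * \<alpha> k powr (1 + \<delta>)))"
      using I1(2)[OF k0] I2(2)[OF k0] k \<open>0 \<le> C\<close> by (intro mult_left_mono add_mono) auto
    also have "\<dots> = D * \<alpha> k powr \<delta> * (W k)\<^sup>2 + D * k * W k * \<alpha> k powr (1 + \<delta>)"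
      by (simp add: D_def algebra_simps)
    finally show ?thesis .
  qed
  have W_le: "W k \<le> 2 * D * k * \<alpha> k powr (1 + \<delta>)" if k: "1 \<le> k" "D * \<alpha> k powr \<delta> \<le> 1 / 2" for k
  proof (cases "W k = 0")
    case True
    then show ?thesis using D0 k by simp
  next
    case False
    have "D * \<alpha> k powr \<delta> * (W k)\<^sup>2 \<le> 1 / 2 * (W k)\<^sup>2"
      using k by (intro mult_right_mono) auto
    with main[OF k(1)] have "(W k)\<^sup>2 \<le> 2 * D * k * W k * \<alpha> k powr (1 + \<delta>)" by simp
    then have "W k * W k \<le> W k * (2 * D * k * \<alpha> k powr (1 + \<delta>))"
      by (simp add: power2_eq_square algebra_simps)
    with False W0[of k] show ?thesis by simp
  qed
  have Markov: "(h - k) * \<alpha> h \<le> W k" if "0 \<le> k" "k < h" for h k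
  proof -
    have "(h - k) powr q * measure M (A h) = (LINT x|M. (h - k) powr q * indicator (A h) x)"
      by simp
    also have "\<dots> \<le> (LINT x|M. w k x powr q)"
      by (intro integral_mono wq that integrable_mult_right iA) (use that lq in \<open>auto simp: indicator_def A_def w_def intro!: powr_mono2\<close>)
    finally have "((h - k) powr q * measure M (A h)) powr (1 / q) \<le> W k"
      unfolding W_def using lq by (intro powr_mono2) auto
    then show ?thesis
      using that lq by (simp add: powr_mult powr_powr \<alpha>_def)
  qed
  have \<alpha>_mono: "\<alpha> h \<le> \<alpha> k" if "k \<le> h" for h k
    unfolding \<alpha>_def A_def using that lq by (intro powr_mono2 finite_measure_mono) auto
  \<comment> \<open>Chebyshev's inequality from level 0 provides the initial smallness needed to
    start the iteration.\<close>
  have \<alpha>_lim: "((\<lambda>k. \<alpha> k) \<longlongrightarrow> 0) at_top"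
  proof (rule tendsto_sandwich[OF _ _ tendsto_const])
    show "((\<lambda>k. W 0 / k) \<longlongrightarrow> 0) at_top"
      by (intro tendsto_divide_0[OF tendsto_const] filterlim_at_top_imp_at_infinity filterlim_ident)
    show "\<forall>\<^sub>F k in at_top. \<alpha> k \<le> W 0 / k"
      using eventually_gt_at_top[of 0]
    proof eventually_elim
      case (elim k)
      with Markov[of 0 k] show ?case by (simp add: pos_le_divide_eq mult.commute)
    qed
  qed (use \<alpha>0 in auto)
  have "((\<lambda>k. \<alpha> k powr \<delta>) \<longlongrightarrow> 0) at_top"
    using tendsto_powr'[OF \<alpha>_lim tendsto_const, of \<delta>] \<theta> \<alpha>0 by simp
  from tendsto_mult_right_zero[OF this]
  have lim: "((\<lambda>k. c * \<alpha> k powr \<delta>) \<longlongrightarrow> 0) at_top" for c .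
  have "\<forall>\<^sub>F k in at_top. D * \<alpha> k powr \<delta> < 1 / 2" "\<forall>\<^sub>F k in at_top. 8 * D * 2 powr (1 / \<delta>) * \<alpha> k powr \<delta> < 1"
    by (rule order_tendstoD(2)[OF lim], simp)+
  with eventually_ge_at_top[of 1]
  have "\<forall>\<^sub>F k in at_top. 1 \<le> k \<and> D * \<alpha> k powr \<delta> < 1 / 2 \<and> 8 * D * 2 powr (1 / \<delta>) * \<alpha> k powr \<delta> < 1"
    by eventually_elim auto
  \<comment> \<open>The second condition permits absorption at level \<open>K\<close> and,
    \<open>\<alpha>\<close> being antitone, at every higher level. The third is the starting
    condition of the geometric decay with constant \<open>8 * D\<close>.\<close>
  then obtain K where K: "1 \<le> K" "D * \<alpha> K powr \<delta> < 1 / 2" "8 * D * 2 powr (1 / \<delta>) * \<alpha> K powr \<delta> < 1"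
    using eventually_happens[of _ "at_top :: real filter"] by auto
  \<comment> \<open>The levels increase from \<open>K\<close> to at most \<open>2 * K\<close> with
    gaps \<open>K * (1/2) ^ Suc j\<close>. Bounding \<open>\<kappa> j\<close> by
    \<open>2 * K\<close> and dividing by the gap turns the factor \<open>2 * D * \<kappa> j\<close>
    into \<open>8 * D * 2 ^ j\<close>.\<close>
  define \<kappa> where "\<kappa> j = K * (2 - (1 / 2) ^ j)" for j :: nat
  have \<kappa>: "K \<le> \<kappa> j" "\<kappa> j \<le> 2 * K" "\<kappa> (Suc j) - \<kappa> j = K * (1 / 2) ^ Suc j" for j
    using K(1) power_le_one[of "1/2::real" j] mult_left_mono[of 1 "2 - (1/2)^j" K]
    by (auto simp: \<kappa>_def algebra_simps)
  have "(\<lambda>j. \<alpha> (\<kappa> j)) \<longlonglongrightarrow> 0"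
  proof (rule fast_geometric_convergence[where c = "8 * D" and \<delta> = \<delta>])
    fix j
    have "D * \<alpha> (\<kappa> j) powr \<delta> \<le> D * \<alpha> K powr \<delta>"
      using D0 \<theta> \<alpha>0 \<kappa> by (intro mult_left_mono powr_mono2 \<alpha>_mono) auto
    with K have small: "D * \<alpha> (\<kappa> j) powr \<delta> \<le> 1 / 2" by simp
    have pos: "0 < K * (1 / 2) ^ Suc j" using K by simp
    have "(\<kappa> (Suc j) - \<kappa> j) * \<alpha> (\<kappa> (Suc j)) \<le> W (\<kappa> j)"
    proof (rule Markov)
      show "0 \<le> \<kappa> j" using \<kappa>(1)[of j] K by linarith
      show "\<kappa> j < \<kappa> (Suc j)" using \<kappa>(3)[of j] pos by linarith
    qed
    also have "\<dots> \<le> 2 * D * \<kappa> j * \<alpha> (\<kappa> j) powr (1 + \<delta>)"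
      by (rule W_le) (use small \<kappa>(1)[of j] K in auto)
    also have "\<dots> \<le> 2 * D * (2 * K) * \<alpha> (\<kappa> j) powr (1 + \<delta>)"
      using D0 \<kappa> by (intro mult_right_mono mult_left_mono) auto
    also have "\<dots> = K * (1 / 2) ^ Suc j * (8 * D * 2 ^ j * \<alpha> (\<kappa> j) powr (1 + \<delta>))"
      by (simp add: power_one_over)
    finally show "\<alpha> (\<kappa> (Suc j)) \<le> 8 * D * 2 ^ j * \<alpha> (\<kappa> j) powr (1 + \<delta>)"
      unfolding \<kappa>(3) using pos by (simp only: mult_le_cancel_left_pos)
  next
    have "\<kappa> 0 = K" by (simp add: \<kappa>_def)
    then show "8 * D * 2 powr (1 / \<delta>) * \<alpha> (\<kappa> 0) powr \<delta> \<le> 1" using K by simp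
  qed (use D0 \<theta> \<alpha>0 in auto)
  then have "\<alpha> (2 * K) \<le> 0"
    using \<alpha>_mono[OF \<kappa>(2)] by (intro LIMSEQ_le_const) auto
  then have "measure M (A (2 * K)) = 0"
    using \<alpha>0[of "2 * K"] by (simp add: \<alpha>_def)
  then have "A (2 * K) \<in> null_sets M"
    by (auto simp: null_sets_def emeasure_eq_measure)
  then have "AE x in M. u x \<le> 2 * K"
    by (rule AE_I') (auto simp: A_def)
  then show ?thesis ..
qed

section \<open>A subcritical Sobolev inequality\<close>

lemma nn_integral_lborel_affine:
  fixes f :: "'a::euclidean_space \<Rightarrow> ennreal"
  assumes [measurable]: "f \<in> borel_measurable borel" and "c \<noteq> 0"
  shows "(\<integral>\<^sup>+x. f x \<partial>lborel) = ennreal (\<bar>c\<bar> ^ DIM('a)) * (\<integral>\<^sup>+x. f (t + c *\<^sub>R x) \<partial>lborel)"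
  by (subst lborel_affine[OF assms(2), of t])
     (simp add: nn_integral_density nn_integral_distr nn_integral_cmult)

text \<open>Jensen's inequality for the power \<open>p\<close> on a set of measure at most 1. A
  number \<open>Y\<close> below the integral replaces the integral itself, so that the integral of
  \<open>h\<close> is allowed to be infinite.\<close>

lemma powr_le_nn_integral:
  fixes h :: "'a \<Rightarrow> real"
  assumes [measurable]: "h \<in> borel_measurable M" "A \<in> sets M" and A: "emeasure M A \<le> 1"
    and h: "\<And>x. 0 \<le> h x" and p: "1 < p" and Y: "0 \<le> Y"
    and le: "ennreal Y \<le> (\<integral>\<^sup>+x. ennreal (h x) * indicator A x \<partial>M)"
  shows "ennreal (Y powr p) \<le> (\<integral>\<^sup>+x. ennreal (h x powr p) * indicator A x \<partial>M)" (is "_ \<le> ?I")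
proof (cases "Y = 0 \<or> ?I = \<infinity>")
  case False
  then have "0 < Y" and fin: "?I \<noteq> \<infinity>" using Y by auto
  then obtain i where i: "?I = ennreal i" "0 \<le> i" by (cases ?I) auto
  \<comment> \<open>Young's inequality with weights \<open>1 / p\<close> and
    \<open>1 - 1 / p\<close> is applied to \<open>h powr p * Y powr (1 - p)\<close> and
    \<open>Y\<close>, whose weighted geometric mean is exactly \<open>h\<close>. This is a bound of
    \<open>h\<close> that is affine in \<open>h powr p\<close>, hence can be integrated.\<close>
  define c where "c = Y powr (1 - p) / p"
  have c: "0 \<le> c" using p by (simp add: c_def)
  have pt: "h x \<le> c * h x powr p + (1 - 1 / p) * Y" for x
  proof -
    have "(h x powr p * Y powr (1 - p)) powr (1 / p) * Y powr (1 - 1 / p)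
        \<le> 1 / p * (h x powr p * Y powr (1 - p)) + (1 - 1 / p) * Y"
      using p Y by (intro powr_powr_le_weighted_sum) auto
    moreover have "(h x powr p * Y powr (1 - p)) powr (1 / p) * Y powr (1 - 1 / p) = h x"
    proof -
      have "(1 - p) * (1 / p) + (1 - 1 / p) = 0" "p * (1 / p) = 1"
        using p by (simp_all add: field_simps)
      then show ?thesis
        using \<open>0 < Y\<close> h[of x] unfolding powr_mult powr_powr mult.assoc powr_add[symmetric] by simp
    qed
    ultimately show ?thesis by (simp add: c_def mult.commute)
  qed
  have "ennreal Y \<le> (\<integral>\<^sup>+x. ennreal c * (ennreal (h x powr p) * indicator A x) + ennreal ((1 - 1 / p) * Y) * indicator A x \<partial>M)"
  proof (intro order_trans[OF le] nn_integral_mono)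
    fix x
    have "ennreal (h x) \<le> ennreal (c * h x powr p + (1 - 1 / p) * Y)"
      by (rule ennreal_leI[OF pt])
    also have "\<dots> = ennreal c * ennreal (h x powr p) + ennreal ((1 - 1 / p) * Y)"
      using c p Y by (subst ennreal_plus) (auto simp: ennreal_mult')
    finally show "ennreal (h x) * indicator A x
        \<le> ennreal c * (ennreal (h x powr p) * indicator A x) + ennreal ((1 - 1 / p) * Y) * indicator A x"
      by (cases "x \<in> A") auto
  qed
  also have "\<dots> = ennreal c * ?I + ennreal ((1 - 1 / p) * Y) * emeasure M A"
    by (simp add: nn_integral_add nn_integral_cmult)
  also have "\<dots> \<le> ennreal c * ?I + ennreal ((1 - 1 / p) * Y) * 1"
    using A by (intro add_mono mult_left_mono) auto
  also have "\<dots> = ennreal (c * i + (1 - 1 / p) * Y)"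
    unfolding i(1) using i(2) c p Y by (subst ennreal_plus) (auto simp: ennreal_mult')
  finally have "Y \<le> c * i + (1 - 1 / p) * Y"
    using i c p Y by (subst (asm) ennreal_le_iff) auto
  then have "Y / p \<le> Y powr (1 - p) * i / p" by (simp add: c_def algebra_simps)
  then have "Y \<le> Y powr (1 - p) * i" using p by (simp add: field_simps)
  then have "Y powr (p - 1) * Y powr 1 \<le> Y powr (p - 1) * (Y powr (1 - p) * i)"
    using \<open>0 < Y\<close> by (intro mult_left_mono) auto
  then have "Y powr p \<le> i"
    using \<open>0 < Y\<close> unfolding mult.assoc[symmetric] powr_add[symmetric] by simp
  then show ?thesis using i by (simp add: ennreal_leI)
qed auto

lemma continuous_compact_support_integrable:
  fixes f :: "'a::euclidean_space \<Rightarrow> real"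
  assumes "continuous_on UNIV f" "compact K" "\<And>x. x \<notin> K \<Longrightarrow> f x = 0"
  shows "integrable lborel f"
proof -
  have "set_integrable lborel K f"
    unfolding set_integrable_def
    by (rule borel_integrable_compact) (use assms continuous_on_subset[OF assms(1)] in auto)
  moreover have "(\<lambda>x. indicator K x *\<^sub>R f x) = f"
  proof
    show "indicator K x *\<^sub>R f x = f x" for x
      by (cases "x \<in> K") (auto simp: assms(3))
  qed
  ultimately show ?thesis by (simp only: set_integrable_def)
qed

lemma test_functions_gradient_square:
  assumes "\<phi> \<in> test_functions \<Omega>"
  shows "continuous_on UNIV (\<lambda>x. (norm (gradient \<phi> x))\<^sup>2)"
    and "integrable lborel (\<lambda>x. (norm (gradient \<phi> x))\<^sup>2)"
proof -
  show cont: "continuous_on UNIV (\<lambda>x. (norm (gradient \<phi> x))\<^sup>2)"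
    by (intro continuous_intros test_functions_continuous_gradient[OF assms])
  obtain K where K: "compact K" "\<And>x. x \<notin> K \<Longrightarrow> gradient \<phi> x = 0"
    using test_functions_support[OF assms] by metis
  show "integrable lborel (\<lambda>x. (norm (gradient \<phi> x))\<^sup>2)"
    by (rule continuous_compact_support_integrable[OF cont K(1)]) (simp add: K(2))
qed

text \<open>The fundamental theorem of calculus along the curve
  \<open>x + \<tau> ^ m *\<^sub>R z\<close>, which runs from \<open>x\<close> to a zero of
  \<open>\<phi>\<close>, followed by the Cauchy-Schwarz inequality on the unit interval.
  Parametrizing the segment by \<open>\<tau> ^ m\<close> slows the curve down near \<open>x\<close>
  and produces the weight \<open>\<tau> ^ (2 * m - 2)\<close>.\<close>

lemma square_le_integral_gradient:
  fixes \<phi> :: "'a::euclidean_space \<Rightarrow> real"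
  assumes \<phi>: "\<phi> \<in> test_functions \<Omega>" and z: "\<phi> (x + z) = 0" "norm z \<le> L" and m: "1 \<le> m"
  shows "ennreal ((\<phi> x)\<^sup>2) \<le> (\<integral>\<^sup>+\<tau>. ennreal ((L * real m)\<^sup>2 * (\<tau> ^ (2 * m - 2) * (norm (gradient \<phi> (x + \<tau> ^ m *\<^sub>R z)))\<^sup>2)) * indicator {0..1} \<tau> \<partial>lborel)"
proof -
  define p' where "p' \<tau> = gradient \<phi> (x + \<tau> ^ m *\<^sub>R z) \<bullet> ((real m * \<tau> ^ (m - 1)) *\<^sub>R z)" for \<tau> :: real
  have deriv: "((\<lambda>\<tau>. \<phi> (x + \<tau> ^ m *\<^sub>R z)) has_real_derivative p' \<tau>) (at \<tau>)" for \<tau>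
  proof -
    have "((\<lambda>\<tau>. x + \<tau> ^ m *\<^sub>R z) has_derivative (\<lambda>h. (h * (real m * \<tau> ^ (m - 1))) *\<^sub>R z)) (at \<tau>)"
      by (auto intro!: derivative_eq_intros)
    from has_derivative_compose[OF this test_functions_has_derivative[OF \<phi>]]
    show ?thesis
      unfolding has_field_derivative_def
      by (rule has_derivative_eq_rhs) (auto simp: p'_def)
  qed
  have cont: "continuous_on UNIV p'"
    unfolding p'_def
    by (intro continuous_intros continuous_on_compose2[OF test_functions_continuous_gradient[OF \<phi>]]) auto
  then have [measurable]: "p' \<in> borel_measurable borel"
    by (rule borel_measurable_continuous_onI)
  have cont_at: "isCont p' \<tau>" for \<tau>
    using cont by (simp add: continuous_on_eq_continuous_at)
  have FTC: "(LINT \<tau>|lborel. p' \<tau> * indicator {0..1} \<tau>) = - \<phi> x"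
    using integral_FTC_Icc_real[of 0 1 "\<lambda>\<tau>. \<phi> (x + \<tau> ^ m *\<^sub>R z)" p'] deriv cont_at z m
    by (simp add: power_0_left)
  have "set_integrable lborel {0..1} (\<lambda>\<tau>. (p' \<tau>)\<^sup>2)"
    unfolding set_integrable_def
    by (rule borel_integrable_compact) (auto intro!: continuous_intros continuous_on_subset[OF cont])
  then have sq: "integrable lborel (\<lambda>\<tau>. (p' \<tau>)\<^sup>2 * indicator {0..1} \<tau>)"
    by (simp add: set_integrable_def mult.commute)
  have ind: "(norm (a * indicat_real S b))\<^sup>2 = a\<^sup>2 * indicator S b" for a :: real and S and b :: real
    by (auto simp: indicator_def)
  have ind': "(norm (indicat_real S b))\<^sup>2 = indicator S b" for S and b :: real
    by (auto simp: indicator_def)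
  have ind'': "(a * indicat_real S b) \<bullet> indicat_real S b = a * indicat_real S b" for a :: real and S and b :: real
    by (auto simp: indicator_def)
  have "\<bar>LINT \<tau>|lborel. p' \<tau> * indicator {0..1} \<tau>\<bar> \<le> sqrt (LINT \<tau>|lborel. (p' \<tau>)\<^sup>2 * indicator {0..1} \<tau>)"
    using L2_inner(2)[of "\<lambda>\<tau>. p' \<tau> * indicator {0..1} \<tau>" lborel "indicat_real {0..1}"] sq
    unfolding ind ind' ind'' by simp
  from power_mono[OF this, of 2]
  have "(\<phi> x)\<^sup>2 \<le> (LINT \<tau>|lborel. (p' \<tau>)\<^sup>2 * indicator {0..1} \<tau>)"
    unfolding FTC by (simp add: integral_nonneg_AE)
  then have "ennreal ((\<phi> x)\<^sup>2) \<le> (\<integral>\<^sup>+\<tau>. ennreal ((p' \<tau>)\<^sup>2 * indicator {0..1} \<tau>) \<partial>lborel)"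
    by (subst nn_integral_eq_integral[OF sq]) (auto intro!: ennreal_leI)
  also have "\<dots> \<le> (\<integral>\<^sup>+\<tau>. ennreal ((L * real m)\<^sup>2 * (\<tau> ^ (2 * m - 2) * (norm (gradient \<phi> (x + \<tau> ^ m *\<^sub>R z)))\<^sup>2)) * indicator {0..1} \<tau> \<partial>lborel)"
  proof (intro nn_integral_mono)
    fix \<tau> :: real
    have "(p' \<tau>)\<^sup>2 \<le> (L * real m)\<^sup>2 * (\<tau> ^ (2 * m - 2) * (norm (gradient \<phi> (x + \<tau> ^ m *\<^sub>R z)))\<^sup>2)" if "0 \<le> \<tau>"
    proof -
      have e: "2 * m - 2 = (m - 1) * 2" by simp
      have "\<bar>p' \<tau>\<bar> \<le> norm (gradient \<phi> (x + \<tau> ^ m *\<^sub>R z)) * (real m * \<tau> ^ (m - 1) * norm z)"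
        unfolding p'_def using that Cauchy_Schwarz_ineq2[of "gradient \<phi> (x + \<tau> ^ m *\<^sub>R z)" "(real m * \<tau> ^ (m - 1)) *\<^sub>R z"] by simp
      also have "\<dots> \<le> norm (gradient \<phi> (x + \<tau> ^ m *\<^sub>R z)) * (real m * \<tau> ^ (m - 1) * L)"
        using that z by (intro mult_left_mono) auto
      finally have "\<bar>p' \<tau>\<bar>\<^sup>2 \<le> (norm (gradient \<phi> (x + \<tau> ^ m *\<^sub>R z)) * (real m * \<tau> ^ (m - 1) * L))\<^sup>2"
        by (rule power_mono) (rule abs_ge_zero)
      also have "\<dots> = (L * real m)\<^sup>2 * (\<tau> ^ (2 * m - 2) * (norm (gradient \<phi> (x + \<tau> ^ m *\<^sub>R z)))\<^sup>2)"
        unfolding e power_mult power_mult_distrib by (simp only: mult_ac)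
      finally show ?thesis by simp
    qed
    then show "ennreal ((p' \<tau>)\<^sup>2 * indicator {0..1} \<tau>) \<le> ennreal ((L * real m)\<^sup>2 * (\<tau> ^ (2 * m - 2) * (norm (gradient \<phi> (x + \<tau> ^ m *\<^sub>R z)))\<^sup>2)) * indicator {0..1} \<tau>"
      by (auto simp: indicator_def intro!: ennreal_leI)
  qed
  finally show ?thesis .
qed

text \<open>Averaging over \<open>z\<close> bounds the square of \<open>\<phi> x\<close> by a
  multiple of the integral over \<open>\<tau>\<close> of \<open>h \<tau> x\<close>, the weighted
  integral of the squared gradient over the set \<open>x + \<tau> ^ m Z\<close>. For fixed
  \<open>\<tau>\<close>, rescaling in \<open>z\<close> bounds the supremum of
  \<open>h \<tau>\<close>, and Fubini's theorem computes its integral over \<open>x\<close>.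
  Interpolation between the two bounds the integral of \<open>h \<tau> x powr p\<close> by a
  multiple of \<open>\<tau> powr e\<close>, and Jensen's inequality in \<open>\<tau>\<close>
  completes the estimate.\<close>

lemma subcritical_Sobolev:
  fixes R q :: real
  assumes "0 < R" and q: "2 < q" "q * (real DIM('a::euclidean_space) - 2) < 2 * real DIM('a)"
  obtains C where "0 \<le> C"
    and "\<And>\<phi>::'a \<Rightarrow> real. \<phi> \<in> test_functions (ball 0 R) \<Longrightarrow> integrable lborel (\<lambda>x. \<bar>\<phi> x\<bar> powr q)"
    and "\<And>\<phi>::'a \<Rightarrow> real. \<phi> \<in> test_functions (ball 0 R) \<Longrightarrow>
      (LINT x|lborel. \<bar>\<phi> x\<bar> powr q) powr (2 / q) \<le> C * (LINT x|lborel. (norm (gradient \<phi> x))\<^sup>2)"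
proof -
  define n where "n = DIM('a)"
  \<comment> \<open>The estimate concerns the square of \<open>\<phi>\<close>, and its power
    \<open>p\<close> is \<open>\<bar>\<phi>\<bar> powr q\<close>.\<close>
  define p where "p = q / 2"
  have p: "1 < p" using q by (simp add: p_def)
  \<comment> \<open>This equals \<open>n - q (n - 2) / 2\<close>, so its positivity is precisely
    subcriticality of \<open>q\<close>.\<close>
  define d where "d = q - real n * (q - 2) / 2"
  have d: "0 < d" using q by (simp add: d_def n_def algebra_simps)
  \<comment> \<open>The final exponent of \<open>\<tau>\<close> is \<open>e = m * d - q\<close>.
    Taking \<open>m\<close> at least \<open>q / d\<close> makes it nonnegative, so that
    \<open>\<tau> powr e\<close> is at most 1 on the unit interval.\<close>
  define m where "m = nat \<lceil>q / d\<rceil> + 1"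
  have m: "1 \<le> m" "q \<le> real m * d"
  proof -
    have "q / d \<le> real m" unfolding m_def by linarith
    then show "q \<le> real m * d" using d by (simp add: field_simps)
  qed (simp add: m_def)
  define e where "e = (2 * real m - 2 - real m * real n) * (p - 1) + (2 * real m - 2)"
  have e: "0 \<le> e"
  proof -
    have "e = real m * d - q" by (simp add: e_def d_def p_def field_simps)
    then show ?thesis using m by simp
  qed
  obtain b :: 'a where b: "b \<in> Basis" using nonempty_Basis by blast
  \<comment> \<open>The centre has norm \<open>3 * R\<close> and the radius is \<open>R\<close>: for
    \<open>norm x < R\<close> and \<open>z\<close> in \<open>Z\<close> the point
    \<open>x + z\<close> stays at distance at least \<open>3 * R - R - R\<close> from the origin,
    hence outside the support, and \<open>norm z\<close> is at most \<open>4 * R\<close>.\<close>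
  define Z where "Z = ball ((3 * R) *\<^sub>R b) R"
  have [measurable]: "Z \<in> sets borel" by (simp add: Z_def)
  have Z: "R \<le> norm (x + z)" "norm z \<le> 4 * R" if "z \<in> Z" "norm x < R" for x z
  proof -
    have "norm ((3 * R) *\<^sub>R b - z) < R" using that by (simp add: Z_def dist_norm)
    moreover have "norm ((3 * R) *\<^sub>R b) = 3 * R" using b \<open>0 < R\<close> by simp
    moreover have "norm ((3 * R) *\<^sub>R b) \<le> norm ((3 * R) *\<^sub>R b - z) + norm (x + z) + norm x"
      using norm_triangle_ineq[of "(3 * R) *\<^sub>R b - z" "z"] norm_triangle_ineq4[of "x + z" x] by simp
    moreover have "norm z \<le> norm ((3 * R) *\<^sub>R b - z) + norm ((3 * R) *\<^sub>R b)"
      using norm_triangle_ineq4[of "(3 * R) *\<^sub>R b" "(3 * R) *\<^sub>R b - z"] by simp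
    ultimately show "R \<le> norm (x + z)" "norm z \<le> 4 * R" using that by linarith+
  qed
  define \<zeta> where "\<zeta> = measure lborel Z"
  have Zfin: "emeasure lborel Z = ennreal \<zeta>"
    unfolding \<zeta>_def Z_def using emeasure_lborel_ball_finite[of "(3 * R) *\<^sub>R b" R] by (intro emeasure_eq_ennreal_measure) auto
  have \<zeta>: "0 < \<zeta>"
    unfolding \<zeta>_def Z_def using \<open>0 < R\<close> by (intro content_ball_pos)
  define K where "K = (4 * R * real m)\<^sup>2 / \<zeta>"
  have K: "0 < K" using \<open>0 < R\<close> m \<zeta> by (simp add: K_def)
  have main: "(\<integral>\<^sup>+x. ennreal (\<bar>\<phi> x\<bar> powr q) \<partial>lborel)
      \<le> ennreal (K powr p * \<zeta> * (LINT x|lborel. (norm (gradient \<phi> x))\<^sup>2) powr p)"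
    if \<phi>: "\<phi> \<in> test_functions (ball 0 R)" for \<phi> :: "'a \<Rightarrow> real"
  proof -
    define g where "g x = (norm (gradient \<phi> x))\<^sup>2" for x
    have g0: "0 \<le> g x" for x by (simp add: g_def)
    have g_int: "integrable lborel g" and g_cont: "continuous_on UNIV g"
      using test_functions_gradient_square[OF \<phi>] by (auto simp: g_def[abs_def])
    have [measurable]: "g \<in> borel_measurable borel"
      using g_cont by (rule borel_measurable_continuous_onI)
    have [measurable]: "\<phi> \<in> borel_measurable borel"
      using test_functions_continuous[OF \<phi>] by (rule borel_measurable_continuous_onI)
    define G where "G = (LINT x|lborel. g x)"
    have G0: "0 \<le> G" by (simp add: G_def g0)
    have nnG: "(\<integral>\<^sup>+x. ennreal (g x) \<partial>lborel) = ennreal G"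
      unfolding G_def by (rule nn_integral_eq_integral[OF g_int]) (simp add: g0)
    define h where "h \<tau> x = (\<integral>\<^sup>+z. ennreal (\<tau> ^ (2 * m - 2) * g (x + \<tau> ^ m *\<^sub>R z)) * indicator Z z \<partial>lborel)" for \<tau> :: real and x
    have [measurable]: "(\<lambda>(\<tau>, x). h \<tau> x) \<in> borel_measurable (lborel \<Otimes>\<^sub>M lborel)"
      unfolding h_def by measurable
    have h_le: "h \<tau> x \<le> ennreal (\<tau> powr (2 * real m - 2 - real m * real n) * G)" if \<tau>: "0 < \<tau>" for \<tau> x
    proof -
      have "h \<tau> x \<le> (\<integral>\<^sup>+z. ennreal (\<tau> ^ (2 * m - 2)) * ennreal (g (x + \<tau> ^ m *\<^sub>R z)) \<partial>lborel)"
        unfolding h_def using \<tau> g0 by (intro nn_integral_mono) (auto simp: indicator_def ennreal_mult)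
      also have "\<dots> = ennreal (\<tau> ^ (2 * m - 2)) * (\<integral>\<^sup>+z. ennreal (g (x + \<tau> ^ m *\<^sub>R z)) \<partial>lborel)"
        by (rule nn_integral_cmult) measurable
      also have "(\<integral>\<^sup>+z. ennreal (g (x + \<tau> ^ m *\<^sub>R z)) \<partial>lborel) = ennreal (\<tau> powr (- real m * real n) * G)"
      proof -
        have "ennreal G = ennreal ((\<tau> ^ m) ^ n) * (\<integral>\<^sup>+z. ennreal (g (x + \<tau> ^ m *\<^sub>R z)) \<partial>lborel)"
          using nn_integral_lborel_affine[of "\<lambda>x. ennreal (g x)" "\<tau> ^ m" x] \<tau> by (simp add: nnG n_def)
        then have "ennreal (\<tau> powr (- real m * real n)) * ennreal G = ennreal (\<tau> powr (- real m * real n)) * ennreal ((\<tau> ^ m) ^ n) * (\<integral>\<^sup>+z. ennreal (g (x + \<tau> ^ m *\<^sub>R z)) \<partial>lborel)"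
          by (simp add: mult.assoc)
        also have "ennreal (\<tau> powr (- real m * real n)) * ennreal ((\<tau> ^ m) ^ n) = 1"
        proof -
          have "(\<tau> ^ m) ^ n = \<tau> powr (real m * real n)"
            using \<tau> by (simp add: powr_realpow[symmetric] powr_powr)
          then show ?thesis
            using \<tau> by (simp add: ennreal_mult[symmetric] powr_add[symmetric])
        qed
        finally show ?thesis using G0 by (simp add: ennreal_mult)
      qed
      also have "ennreal (\<tau> ^ (2 * m - 2)) * ennreal (\<tau> powr (- real m * real n) * G) = ennreal (\<tau> powr (2 * real m - 2 - real m * real n) * G)"
      proof -
        have "\<tau> ^ (2 * m - 2) = \<tau> powr (2 * real m - 2)"
          using \<tau> m by (simp add: powr_realpow[symmetric] of_nat_diff)
        then have "\<tau> ^ (2 * m - 2) * (\<tau> powr (- real m * real n) * G) = \<tau> powr (2 * real m - 2 - real m * real n) * G"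
          by (simp add: mult.assoc[symmetric] powr_add[symmetric])
        then show ?thesis using G0 \<tau> by (subst ennreal_mult[symmetric]) auto
      qed
      finally show ?thesis .
    qed
    have h_int: "(\<integral>\<^sup>+x. h \<tau> x \<partial>lborel) = ennreal (\<tau> ^ (2 * m - 2) * G * \<zeta>)" if \<tau>: "0 < \<tau>" for \<tau>
    proof -
      have "(\<integral>\<^sup>+x. h \<tau> x \<partial>lborel) = (\<integral>\<^sup>+z. \<integral>\<^sup>+x. ennreal (\<tau> ^ (2 * m - 2) * g (x + \<tau> ^ m *\<^sub>R z)) * indicator Z z \<partial>lborel \<partial>lborel)"
        unfolding h_def by (rule lborel_pair.Fubini') measurable
      also have "\<dots> = (\<integral>\<^sup>+z. ennreal (\<tau> ^ (2 * m - 2) * G) * indicator Z z \<partial>lborel)"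
      proof (rule nn_integral_cong)
        fix z
        have "(\<integral>\<^sup>+x. ennreal (\<tau> ^ (2 * m - 2) * g (x + \<tau> ^ m *\<^sub>R z)) * indicator Z z \<partial>lborel)
          = (\<integral>\<^sup>+x. (ennreal (\<tau> ^ (2 * m - 2)) * indicator Z z) * ennreal (g (\<tau> ^ m *\<^sub>R z + 1 *\<^sub>R x)) \<partial>lborel)"
          using g0 \<tau> by (simp add: ennreal_mult add.commute mult_ac)
        also have "\<dots> = (ennreal (\<tau> ^ (2 * m - 2)) * indicator Z z) * (\<integral>\<^sup>+x. ennreal (g (\<tau> ^ m *\<^sub>R z + 1 *\<^sub>R x)) \<partial>lborel)"
          by (rule nn_integral_cmult) measurable
        also have "(\<integral>\<^sup>+x. ennreal (g (\<tau> ^ m *\<^sub>R z + 1 *\<^sub>R x)) \<partial>lborel) = ennreal G"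
          using nn_integral_lborel_affine[of "\<lambda>x. ennreal (g x)" 1 "\<tau> ^ m *\<^sub>R z"] by (simp add: nnG)
        finally show "(\<integral>\<^sup>+x. ennreal (\<tau> ^ (2 * m - 2) * g (x + \<tau> ^ m *\<^sub>R z)) * indicator Z z \<partial>lborel)
          = ennreal (\<tau> ^ (2 * m - 2) * G) * indicator Z z"
          using \<tau> G0 by (simp add: ennreal_mult mult_ac)
      qed
      also have "\<dots> = ennreal (\<tau> ^ (2 * m - 2) * G * \<zeta>)"
        using \<tau> G0 \<zeta> by (simp add: nn_integral_cmult Zfin ennreal_mult)
      finally show ?thesis .
    qed
    \<comment> \<open>Real powers require a real-valued function. The bound \<open>h_le\<close>
      makes \<open>h\<close> finite for positive \<open>\<tau>\<close>, and the single point 0 is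
      discarded as a null set.\<close>
    define H where "H \<tau> x = enn2real (h \<tau> x)" for \<tau> x
    have [measurable]: "(\<lambda>(\<tau>, x). H \<tau> x) \<in> borel_measurable (lborel \<Otimes>\<^sub>M lborel)"
      unfolding H_def by measurable
    have H0: "0 \<le> H \<tau> x" for \<tau> x by (simp add: H_def)
    have hH: "h \<tau> x = ennreal (H \<tau> x)" if "0 < \<tau>" for \<tau> x
      unfolding H_def using h_le[OF that, of x] by (subst ennreal_enn2real) (auto intro: le_less_trans)
    have pt: "ennreal (\<bar>\<phi> x\<bar> powr q) \<le> ennreal (K powr p) * (\<integral>\<^sup>+\<tau>. ennreal (H \<tau> x powr p) * indicator {0..1} \<tau> \<partial>lborel)" for x
    proof (cases "norm x < R")
      case False
      then have "\<phi> x = 0"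
        using test_functions_support[OF \<phi>] by (metis in_mono mem_ball_0)
      then show ?thesis by simp
    next
      case True
      have "ennreal ((\<phi> x)\<^sup>2) * ennreal \<zeta> = (\<integral>\<^sup>+z. ennreal ((\<phi> x)\<^sup>2) * indicator Z z \<partial>lborel)"
        by (simp add: nn_integral_cmult Zfin)
      also have "\<dots> \<le> (\<integral>\<^sup>+z. (\<integral>\<^sup>+\<tau>. ennreal ((4 * R * real m)\<^sup>2 * (\<tau> ^ (2 * m - 2) * g (x + \<tau> ^ m *\<^sub>R z))) * indicator {0..1} \<tau> \<partial>lborel) * indicator Z z \<partial>lborel)"
      proof (rule nn_integral_mono)
        fix z
        have "\<phi> (x + z) = 0" if "z \<in> Z"
          using test_functions_support[OF \<phi>] Z(1)[OF that True] by (metis in_mono leD mem_ball_0)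
        then show "ennreal ((\<phi> x)\<^sup>2) * indicator Z z \<le> (\<integral>\<^sup>+\<tau>. ennreal ((4 * R * real m)\<^sup>2 * (\<tau> ^ (2 * m - 2) * g (x + \<tau> ^ m *\<^sub>R z))) * indicator {0..1} \<tau> \<partial>lborel) * indicator Z z"
          using square_le_integral_gradient[OF \<phi> _ Z(2)[OF _ True] m(1)] unfolding g_def
          by (cases "z \<in> Z") auto
      qed
      also have "\<dots> = (\<integral>\<^sup>+z. (\<integral>\<^sup>+\<tau>. ennreal ((4 * R * real m)\<^sup>2) * (ennreal (\<tau> ^ (2 * m - 2) * g (x + \<tau> ^ m *\<^sub>R z)) * indicator Z z) * indicator {0..1} \<tau> \<partial>lborel) \<partial>lborel)"
        using g0 by (intro nn_integral_cong, subst nn_integral_multc[symmetric], measurable)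
          (auto intro!: nn_integral_cong simp: indicator_def ennreal_mult)
      also have "\<dots> = (\<integral>\<^sup>+\<tau>. (\<integral>\<^sup>+z. ennreal ((4 * R * real m)\<^sup>2) * (ennreal (\<tau> ^ (2 * m - 2) * g (x + \<tau> ^ m *\<^sub>R z)) * indicator Z z) * indicator {0..1} \<tau> \<partial>lborel) \<partial>lborel)"
        by (rule lborel_pair.Fubini') measurable
      also have "\<dots> = (\<integral>\<^sup>+\<tau>. ennreal ((4 * R * real m)\<^sup>2) * h \<tau> x * indicator {0..1} \<tau> \<partial>lborel)"
        unfolding h_def by (intro nn_integral_cong) (simp add: nn_integral_cmult nn_integral_multc)
      also have "\<dots> = (\<integral>\<^sup>+\<tau>. ennreal ((4 * R * real m)\<^sup>2) * (ennreal (H \<tau> x) * indicator {0..1} \<tau>) \<partial>lborel)"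
        by (intro nn_integral_cong_AE, use AE_lborel_singleton[of 0] in eventually_elim)
           (auto simp: indicator_def hH)
      also have "\<dots> = ennreal ((4 * R * real m)\<^sup>2) * (\<integral>\<^sup>+\<tau>. ennreal (H \<tau> x) * indicator {0..1} \<tau> \<partial>lborel)"
        by (rule nn_integral_cmult) measurable
      finally have *: "ennreal ((\<phi> x)\<^sup>2) * ennreal \<zeta> \<le> ennreal ((4 * R * real m)\<^sup>2) * (\<integral>\<^sup>+\<tau>. ennreal (H \<tau> x) * indicator {0..1} \<tau> \<partial>lborel)" .
      have "ennreal ((\<phi> x)\<^sup>2 / K) = ennreal (1 / (4 * R * real m)\<^sup>2) * (ennreal ((\<phi> x)\<^sup>2) * ennreal \<zeta>)"
        using \<open>0 < R\<close> m \<zeta> by (simp add: K_def ennreal_mult[symmetric] mult_ac)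
      also have "\<dots> \<le> ennreal (1 / (4 * R * real m)\<^sup>2) * (ennreal ((4 * R * real m)\<^sup>2) * (\<integral>\<^sup>+\<tau>. ennreal (H \<tau> x) * indicator {0..1} \<tau> \<partial>lborel))"
        by (intro mult_left_mono *) simp
      also have "\<dots> = (\<integral>\<^sup>+\<tau>. ennreal (H \<tau> x) * indicator {0..1} \<tau> \<partial>lborel)"
        using \<open>0 < R\<close> m by (simp add: mult.assoc[symmetric] ennreal_mult[symmetric])
      finally have "ennreal (((\<phi> x)\<^sup>2 / K) powr p) \<le> (\<integral>\<^sup>+\<tau>. ennreal (H \<tau> x powr p) * indicator {0..1} \<tau> \<partial>lborel)"
        using K p H0 by (intro powr_le_nn_integral) auto
      then have "ennreal (K powr p) * ennreal (((\<phi> x)\<^sup>2 / K) powr p) \<le> ennreal (K powr p) * (\<integral>\<^sup>+\<tau>. ennreal (H \<tau> x powr p) * indicator {0..1} \<tau> \<partial>lborel)"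
        by (intro mult_left_mono) auto
      also have "ennreal (K powr p) * ennreal (((\<phi> x)\<^sup>2 / K) powr p) = ennreal (\<bar>\<phi> x\<bar> powr q)"
      proof -
        have "(\<phi> x)\<^sup>2 powr p = \<bar>\<phi> x\<bar> powr q"
        proof -
          have "(\<phi> x)\<^sup>2 = \<bar>\<phi> x\<bar> powr 2" by (simp add: powr_numeral)
          then show ?thesis by (simp only: powr_powr) (simp add: p_def)
        qed
        then show ?thesis
          using K by (simp add: ennreal_mult[symmetric] powr_divide)
      qed
      finally show ?thesis .
    qed
    have "(\<integral>\<^sup>+x. ennreal (\<bar>\<phi> x\<bar> powr q) \<partial>lborel) \<le> (\<integral>\<^sup>+x. ennreal (K powr p) * (\<integral>\<^sup>+\<tau>. ennreal (H \<tau> x powr p) * indicator {0..1} \<tau> \<partial>lborel) \<partial>lborel)"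
      by (intro nn_integral_mono pt)
    also have "\<dots> = ennreal (K powr p) * (\<integral>\<^sup>+x. (\<integral>\<^sup>+\<tau>. ennreal (H \<tau> x powr p) * indicator {0..1} \<tau> \<partial>lborel) \<partial>lborel)"
      by (rule nn_integral_cmult) measurable
    also have "(\<integral>\<^sup>+x. (\<integral>\<^sup>+\<tau>. ennreal (H \<tau> x powr p) * indicator {0..1} \<tau> \<partial>lborel) \<partial>lborel)
        = (\<integral>\<^sup>+\<tau>. (\<integral>\<^sup>+x. ennreal (H \<tau> x powr p) * indicator {0..1} \<tau> \<partial>lborel) \<partial>lborel)"
      by (rule lborel_pair.Fubini') measurable
    also have "\<dots> \<le> (\<integral>\<^sup>+\<tau>. ennreal (\<zeta> * G powr p) * indicator {0..1} \<tau> \<partial>(lborel :: real measure))"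
    proof (intro nn_integral_mono_AE, use AE_lborel_singleton[of "0::real"] in eventually_elim)
      fix \<tau> :: real assume "\<tau> \<noteq> 0"
      show "(\<integral>\<^sup>+x. ennreal (H \<tau> x powr p) * indicator {0..1} \<tau> \<partial>lborel) \<le> ennreal (\<zeta> * G powr p) * indicator {0..1} \<tau>"
      proof (cases "\<tau> \<in> {0..1}")
        case True
        with \<open>\<tau> \<noteq> 0\<close> have \<tau>: "0 < \<tau>" "\<tau> \<le> 1" by auto
        \<comment> \<open>The supremum bound for \<open>h \<tau>\<close> raised to
          \<open>p - 1\<close>. Hence \<open>H powr p\<close> is at most \<open>c * H\<close>, and
          only the integral of \<open>H\<close> remains to be inserted.\<close>
        define c where "c = (\<tau> powr (2 * real m - 2 - real m * real n) * G) powr (p - 1)"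
        have "(\<integral>\<^sup>+x. ennreal (H \<tau> x powr p) * indicator {0..1} \<tau> \<partial>lborel) \<le> (\<integral>\<^sup>+x. ennreal c * h \<tau> x \<partial>lborel)"
        proof (intro nn_integral_mono)
          fix x
          have "H \<tau> x \<le> \<tau> powr (2 * real m - 2 - real m * real n) * G"
            using h_le[OF \<tau>(1), of x] G0 unfolding hH[OF \<tau>(1)] by (subst (asm) ennreal_le_iff) auto
          then have "H \<tau> x powr (p - 1) \<le> c"
            unfolding c_def using H0 p by (intro powr_mono2) auto
          then have "H \<tau> x powr (p - 1) * H \<tau> x \<le> c * H \<tau> x"
            using H0 by (intro mult_right_mono)
          moreover have "H \<tau> x powr (p - 1) * H \<tau> x = H \<tau> x powr p"
            using H0[of \<tau> x] powr_add[of "H \<tau> x" "p - 1" 1] by (cases "H \<tau> x = 0") auto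
          ultimately show "ennreal (H \<tau> x powr p) * indicator {0..1} \<tau> \<le> ennreal c * h \<tau> x"
            using True H0[of \<tau> x] by (simp add: hH[OF \<tau>(1)] c_def ennreal_mult[symmetric] ennreal_leI)
        qed
        also have "\<dots> = ennreal c * ennreal (\<tau> ^ (2 * m - 2) * G * \<zeta>)"
          using \<tau> by (simp add: nn_integral_cmult h_int)
        also have "\<dots> = ennreal (\<tau> powr e * (\<zeta> * G powr p))"
        proof -
          have "\<tau> ^ (2 * m - 2) = \<tau> powr (2 * real m - 2)"
            using \<tau> m by (simp add: powr_realpow[symmetric] of_nat_diff)
          moreover have "G powr (p - 1) * G = G powr p"
            using G0 powr_add[of G "p - 1" 1] by (cases "G = 0") auto
          ultimately have "c * (\<tau> ^ (2 * m - 2) * G * \<zeta>) = \<tau> powr e * (\<zeta> * G powr p)"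
            by (simp add: c_def e_def powr_mult powr_powr powr_add mult_ac)
          then show ?thesis using \<tau> G0 \<zeta> by (subst ennreal_mult[symmetric]) (auto simp: c_def)
        qed
        also have "\<dots> \<le> ennreal (1 * (\<zeta> * G powr p))"
          using \<tau> e \<zeta> powr_mono2[of e \<tau> 1] by (intro ennreal_leI mult_right_mono) auto
        finally show ?thesis using True by simp
      qed simp
    qed
    also have "\<dots> = ennreal (\<zeta> * G powr p)"
      by (simp add: nn_integral_cmult)
    also have "ennreal (K powr p) * ennreal (\<zeta> * G powr p) = ennreal (K powr p * \<zeta> * G powr p)"
      using \<zeta> by (simp add: ennreal_mult[symmetric] mult_ac)
    finally show ?thesis
      by (simp add: G_def g_def mult_left_mono)
  qed
  show ?thesis
  proof (rule that[of "(K powr p * \<zeta>) powr (2 / q)"])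
    fix \<phi> :: "'a \<Rightarrow> real" assume \<phi>: "\<phi> \<in> test_functions (ball 0 R)"
    have [measurable]: "\<phi> \<in> borel_measurable borel"
      using test_functions_continuous[OF \<phi>] by (rule borel_measurable_continuous_onI)
    show int: "integrable lborel (\<lambda>x. \<bar>\<phi> x\<bar> powr q)"
      using main[OF \<phi>] by (intro integrableI_nonneg) (auto intro: le_less_trans)
    let ?G = "LINT x|lborel. (norm (gradient \<phi> x))\<^sup>2"
    have G0: "0 \<le> ?G" by simp
    have "(LINT x|lborel. \<bar>\<phi> x\<bar> powr q) \<le> K powr p * \<zeta> * ?G powr p"
      using main[OF \<phi>] nn_integral_eq_integral[OF int] \<zeta> by simp
    then have "(LINT x|lborel. \<bar>\<phi> x\<bar> powr q) powr (2 / q) \<le> (K powr p * \<zeta> * ?G powr p) powr (2 / q)"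
      using q by (intro powr_mono2) auto
    also have "\<dots> = (K powr p * \<zeta>) powr (2 / q) * ?G"
      using q \<zeta> G0 by (simp add: powr_mult powr_powr p_def)
    finally show "(LINT x|lborel. \<bar>\<phi> x\<bar> powr q) powr (2 / q) \<le> (K powr p * \<zeta>) powr (2 / q) * ?G" .
  qed simp
qed

section \<open>The Gagliardo form\<close>

text \<open>Half of the kernel exponent is assigned to each factor, so that the Gagliardo form
  becomes an L^2 inner product on the product space. Cauchy-Schwarz and L^2 limits then treat it
  exactly like the gradient term.\<close>

definition diff_quot :: "real \<Rightarrow> ('a::euclidean_space \<Rightarrow> real) \<Rightarrow> 'a \<times> 'a \<Rightarrow> real" where
  "diff_quot s u p = (u (fst p) - u (snd p)) / norm (fst p - snd p) powr ((real DIM('a) + 2 * s) / 2)"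

lemma diff_quot_mult:
  fixes u v :: "'a::euclidean_space \<Rightarrow> real"
  shows "diff_quot s u (x, y) * diff_quot s v (x, y) =
    (u x - u y) * (v x - v y) / norm (x - y) powr (real DIM('a) + 2 * s)"
proof -
  have "norm (x - y) powr (real DIM('a) + 2 * s) =
      norm (x - y) powr ((real DIM('a) + 2 * s) / 2) * norm (x - y) powr ((real DIM('a) + 2 * s) / 2)"
    by (simp only: powr_add[symmetric] field_sum_of_halves)
  then show ?thesis by (simp add: diff_quot_def)
qed

lemma diff_quot_measurable [measurable]:
  fixes u :: "'a::euclidean_space \<Rightarrow> real"
  assumes [measurable]: "u \<in> borel_measurable borel"
  shows "diff_quot s u \<in> borel_measurable (lborel \<Otimes>\<^sub>M lborel)"
  unfolding diff_quot_def[abs_def] by measurable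

lemma diff_quot_diff: "diff_quot s (\<lambda>x. u x - v x) p = diff_quot s u p - diff_quot s v p"
  by (simp add: diff_quot_def diff_divide_distrib)

section \<open>Square integrability of the difference quotients of test functions\<close>

lemma suminf_geometric_powr_finite:
  assumes "0 \<le> c" "a < 0"
  shows "(\<Sum>j. ennreal (c * 2 powr (a * real j))) < \<infinity>"
proof -
  have "summable (\<lambda>j. c * (2 powr a) ^ j)"
    using assms by (intro summable_mult summable_geometric) (simp add: powr_less_one)
  then have "summable (\<lambda>j. c * 2 powr (a * real j))"
    by (simp add: powr_powr[symmetric] powr_realpow)
  then show ?thesis
    using assms by (subst suminf_ennreal2) auto
qed

lemma nn_integral_suminf_cmult_indicator:
  assumes "\<And>j. A j \<in> sets M"
  shows "(\<integral>\<^sup>+z. (\<Sum>j. c j * indicator (A j) z) \<partial>M) = (\<Sum>j. c j * emeasure M (A j))"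
  by (subst nn_integral_suminf) (use assms in \<open>simp_all add: nn_integral_cmult_indicator\<close>)

text \<open>The kernel is majorized by two series of multiples of indicators of balls with dyadic
  radii, so only volumes of balls are needed. Inside the unit ball the kernel is
  \<open>norm z powr (- e)\<close>; since \<open>0 \<le> e\<close>, a point with norm between
  \<open>2 powr (- (j + 1))\<close> and \<open>2 powr (- j)\<close> is controlled by the summand
  \<open>j\<close> alone. The resulting geometric series have ratios
  \<open>2 powr (2 * s - 2)\<close> near 0 and \<open>2 powr (- 2 * s)\<close> at infinity, both
  less than 1 because \<open>0 < s < 1\<close>.\<close>

lemma truncated_kernel_integrable:
  assumes s: "0 < s" "s < 1" and n: "2 \<le> DIM('a::euclidean_space)"
  shows "(\<integral>\<^sup>+z. ennreal (min 1 ((norm z)\<^sup>2) / norm z powr (real DIM('a) + 2 * s)) \<partial>(lborel :: 'a measure)) < \<infinity>"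
proof -
  define n where "n = real DIM('a)"
  define e where "e = n + 2 * s - 2"
  have e: "0 \<le> e" "2 \<le> n" using s n by (auto simp: e_def n_def)
  define inner where "inner z = (\<Sum>j. ennreal (2 powr ((real j + 1) * e)) * indicator (cball (0::'a) (2 powr (- real j))) z)" for z :: 'a
  define outer where "outer z = (\<Sum>j. ennreal (2 powr (- real j * (n + 2 * s))) * indicator (cball (0::'a) (2 powr (real j + 1))) z)" for z :: 'a
  have pt: "ennreal (min 1 ((norm z)\<^sup>2) / norm z powr (n + 2 * s)) \<le> inner z + outer z" for z
  proof -
    consider "z = 0" | "0 < norm z" "norm z \<le> 1" | "1 < norm z" by fastforce
    then show ?thesis
    proof cases
      case 2
      define t where "t = - log 2 (norm z)"
      have t: "0 \<le> t" "norm z = 2 powr (- t)" using 2 by (auto simp: t_def)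
      define j where "j = nat \<lfloor>t\<rfloor>"
      have j: "real j \<le> t" "t \<le> real j + 1" using t unfolding j_def by linarith+
      have "min 1 ((norm z)\<^sup>2) / norm z powr (n + 2 * s) = norm z powr (- e)"
      proof -
        have "(norm z)\<^sup>2 \<le> 1" using 2 by (simp add: power_le_one)
        then have "min 1 ((norm z)\<^sup>2) = norm z powr 2" using 2 by simp
        moreover have "norm z powr 2 / norm z powr (n + 2 * s) = norm z powr (- e)"
          by (simp only: powr_diff[symmetric]) (simp only: e_def minus_diff_eq)
        ultimately show ?thesis by (simp only:)
      qed
      also have "\<dots> = 2 powr (t * e)" unfolding t(2) powr_powr by simp
      also have "\<dots> \<le> 2 powr ((real j + 1) * e)"
        using j e by (intro powr_mono mult_right_mono) auto
      finally have "ennreal (min 1 ((norm z)\<^sup>2) / norm z powr (n + 2 * s)) \<le> ennreal (2 powr ((real j + 1) * e))"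
        by (rule ennreal_leI)
      also have "\<dots> = (\<Sum>i\<in>{j}. ennreal (2 powr ((real i + 1) * e)) * indicator (cball (0::'a) (2 powr (- real i))) z)"
        using j t by (simp add: indicator_def)
      also have "\<dots> \<le> inner z"
        unfolding inner_def by (intro sum_le_suminf) auto
      finally show ?thesis by (auto intro: order_trans)
    next
      case 3
      define t where "t = log 2 (norm z)"
      have "0 < norm z" using 3 by linarith
      then have "norm z = 2 powr t" "0 \<le> t"
        using 3 zero_le_log_cancel_iff[of 2 "norm z"] by (simp_all add: t_def del: zero_less_norm_iff)
      then have t: "0 \<le> t" "norm z = 2 powr t" by auto
      define j where "j = nat \<lfloor>t\<rfloor>"
      have j: "real j \<le> t" "t \<le> real j + 1" using t unfolding j_def by linarith+
      have "min 1 ((norm z)\<^sup>2) / norm z powr (n + 2 * s) \<le> 1 / norm z powr (n + 2 * s)"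
        by (intro divide_right_mono) auto
      also have "\<dots> = 2 powr (- t * (n + 2 * s))"
        unfolding t(2) powr_powr by (simp add: powr_minus_divide)
      also have "\<dots> \<le> 2 powr (- real j * (n + 2 * s))"
        using j e s by (intro powr_mono mult_right_mono) auto
      finally have "ennreal (min 1 ((norm z)\<^sup>2) / norm z powr (n + 2 * s)) \<le> ennreal (2 powr (- real j * (n + 2 * s)))"
        by (rule ennreal_leI)
      also have "\<dots> = (\<Sum>i\<in>{j}. ennreal (2 powr (- real i * (n + 2 * s))) * indicator (cball (0::'a) (2 powr (real i + 1))) z)"
        using j t by (simp add: indicator_def)
      also have "\<dots> \<le> outer z"
        unfolding outer_def by (intro sum_le_suminf) auto
      finally show ?thesis by (auto intro: order_trans)
    qed simp
  qed
  define \<omega> where "\<omega> = unit_ball_vol n"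
  have \<omega>: "0 \<le> \<omega>" by (simp add: \<omega>_def n_def)
  have vol: "emeasure lborel (cball (0::'a) (2 powr r)) = ennreal (\<omega> * 2 powr (r * n))" for r
  proof -
    have "(2 powr r) ^ DIM('a) = 2 powr (r * n)"
      unfolding n_def by (subst powr_realpow[symmetric]) (simp_all add: powr_powr)
    then show ?thesis
      using emeasure_cball[of "2 powr r" "0::'a"] by (simp only: \<omega>_def n_def powr_ge_zero)
  qed
  have "(\<integral>\<^sup>+z. inner z \<partial>lborel) = (\<Sum>j. ennreal (2 powr ((real j + 1) * e)) * ennreal (\<omega> * 2 powr (- real j * n)))"
    unfolding inner_def by (subst nn_integral_suminf_cmult_indicator) (simp, simp only: vol)
  also have "\<dots> = (\<Sum>j. ennreal ((\<omega> * 2 powr e) * 2 powr ((2 * s - 2) * real j)))"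
  proof (intro suminf_cong)
    fix j
    have "2 powr ((real j + 1) * e) * 2 powr (- real j * n) = 2 powr e * 2 powr ((2 * s - 2) * real j)"
      unfolding powr_add[symmetric] by (simp add: e_def algebra_simps)
    then show "ennreal (2 powr ((real j + 1) * e)) * ennreal (\<omega> * 2 powr (- real j * n)) = ennreal ((\<omega> * 2 powr e) * 2 powr ((2 * s - 2) * real j))"
      using \<omega> by (simp add: ennreal_mult[symmetric] mult_ac)
  qed
  also have "\<dots> < \<infinity>"
    using s \<omega> by (intro suminf_geometric_powr_finite) auto
  finally have inner: "(\<integral>\<^sup>+z. inner z \<partial>lborel) < \<infinity>" .
  have "(\<integral>\<^sup>+z. outer z \<partial>lborel) = (\<Sum>j. ennreal (2 powr (- real j * (n + 2 * s))) * ennreal (\<omega> * 2 powr ((real j + 1) * n)))"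
    unfolding outer_def by (subst nn_integral_suminf_cmult_indicator) (simp, simp only: vol)
  also have "\<dots> = (\<Sum>j. ennreal ((\<omega> * 2 powr n) * 2 powr ((- 2 * s) * real j)))"
  proof (intro suminf_cong)
    fix j
    have "2 powr (- real j * (n + 2 * s)) * 2 powr ((real j + 1) * n) = 2 powr n * 2 powr ((- 2 * s) * real j)"
      unfolding powr_add[symmetric] by (simp add: algebra_simps)
    then show "ennreal (2 powr (- real j * (n + 2 * s))) * ennreal (\<omega> * 2 powr ((real j + 1) * n)) = ennreal ((\<omega> * 2 powr n) * 2 powr ((- 2 * s) * real j))"
      using \<omega> by (simp add: ennreal_mult[symmetric] mult_ac)
  qed
  also have "\<dots> < \<infinity>"
    using s \<omega> by (intro suminf_geometric_powr_finite) auto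
  finally have outer: "(\<integral>\<^sup>+z. outer z \<partial>lborel) < \<infinity>" .
  have "(\<integral>\<^sup>+z. ennreal (min 1 ((norm z)\<^sup>2) / norm z powr (n + 2 * s)) \<partial>(lborel :: 'a measure)) \<le> (\<integral>\<^sup>+z. inner z + outer z \<partial>lborel)"
    by (intro nn_integral_mono pt)
  also have "\<dots> = (\<integral>\<^sup>+z. inner z \<partial>lborel) + (\<integral>\<^sup>+z. outer z \<partial>lborel)"
  proof (rule nn_integral_add)
    show "inner \<in> borel_measurable lborel" "outer \<in> borel_measurable lborel"
      unfolding inner_def[abs_def] outer_def[abs_def]
      by (intro borel_measurable_suminf_order borel_measurable_times_ennreal borel_measurable_const borel_measurable_indicator, simp)+
  qed
  also have "\<dots> < \<infinity>" using inner outer by simp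
  finally show ?thesis by (simp add: n_def)
qed

lemma test_functions_bounded:
  assumes "\<phi> \<in> test_functions \<Omega>"
  obtains B where "\<And>x. \<bar>\<phi> x\<bar> \<le> B" "\<And>x. norm (gradient \<phi> x) \<le> B"
proof -
  obtain K where K: "compact K" "\<And>x. x \<notin> K \<Longrightarrow> \<phi> x = 0" "\<And>x. x \<notin> K \<Longrightarrow> gradient \<phi> x = 0"
    using test_functions_support[OF assms] by metis
  have "bounded (\<phi> ` K)" "bounded (gradient \<phi> ` K)"
    by (rule compact_imp_bounded, rule compact_continuous_image[OF continuous_on_subset K(1)],
        rule test_functions_continuous[OF assms] test_functions_continuous_gradient[OF assms], simp)+
  then obtain B1 B2 where B: "\<And>x. x \<in> K \<Longrightarrow> norm (\<phi> x) \<le> B1" "\<And>x. x \<in> K \<Longrightarrow> norm (gradient \<phi> x) \<le> B2"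
    unfolding bounded_iff by auto
  show ?thesis
  proof (rule that[of "max 0 (max B1 B2)"])
    show "\<bar>\<phi> x\<bar> \<le> max 0 (max B1 B2)" for x
      using B(1)[of x] K(2)[of x] by (cases "x \<in> K") auto
    show "norm (gradient \<phi> x) \<le> max 0 (max B1 B2)" for x
      using B(2)[of x] K(3)[of x] by (cases "x \<in> K") auto
  qed
qed

lemma test_functions_Lipschitz:
  assumes \<phi>: "\<phi> \<in> test_functions \<Omega>" and B: "\<And>x. norm (gradient \<phi> x) \<le> B"
  shows "\<bar>\<phi> x - \<phi> y\<bar> \<le> B * norm (x - y)"
proof -
  have "norm (\<phi> x - \<phi> y) \<le> B * norm (x - y)"
  proof (rule differentiable_bound[of UNIV \<phi> "\<lambda>x h. gradient \<phi> x \<bullet> h"])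
    show "onorm (\<lambda>h. gradient \<phi> x \<bullet> h) \<le> B" for x
    proof (rule onorm_le)
      show "norm (gradient \<phi> x \<bullet> h) \<le> B * norm h" for h
        using Cauchy_Schwarz_ineq2[of "gradient \<phi> x" h] mult_right_mono[OF B[of x], of "norm h"] by simp
    qed
  qed (use test_functions_has_derivative[OF \<phi>] in auto)
  then show ?thesis by simp
qed

text \<open>Boundedness and the Lipschitz property bound the squared difference of values by
  \<open>4 * B^2\<close> times the minimum of 1 and the squared distance, and the difference is zero
  unless one of the two points lies in the support. Integrating first over the other point gives the
  truncated kernel integral, and then the finite measure of the support.\<close>

lemma diff_quot_test_function:
  fixes \<phi> :: "'a::euclidean_space \<Rightarrow> real"
  assumes s: "0 < s" "s < 1" and n: "2 \<le> DIM('a)" and \<phi>: "\<phi> \<in> test_functions \<Omega>"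
  shows "integrable (lborel \<Otimes>\<^sub>M lborel) (\<lambda>p. (diff_quot s \<phi> p)\<^sup>2)"
proof -
  obtain K where K: "compact K" "\<And>x. x \<notin> K \<Longrightarrow> \<phi> x = 0"
    using test_functions_support[OF \<phi>] by metis
  obtain B where B: "\<And>x. \<bar>\<phi> x\<bar> \<le> B" "\<And>x. norm (gradient \<phi> x) \<le> B"
    using test_functions_bounded[OF \<phi>] by metis
  have [measurable]: "\<phi> \<in> borel_measurable borel"
    using test_functions_continuous[OF \<phi>] by (rule borel_measurable_continuous_onI)
  have [measurable]: "K \<in> sets borel" using K by (simp add: compact_imp_closed)
  define k where "k z = ennreal (min 1 ((norm z)\<^sup>2) / norm z powr (real DIM('a) + 2 * s))" for z :: 'a
  have [measurable]: "k \<in> borel_measurable borel" unfolding k_def[abs_def] by measurable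
  define I where "I = (\<integral>\<^sup>+z. k z \<partial>lborel)"
  have I: "I < \<infinity>" unfolding I_def k_def by (rule truncated_kernel_integrable[OF s n])
  have Kfin: "emeasure lborel K < \<infinity>" using K emeasure_bounded_finite compact_imp_bounded by blast
  have pt: "ennreal ((diff_quot s \<phi> (x, y))\<^sup>2) \<le> ennreal (4 * B\<^sup>2) * ((indicator K x + indicator K y) * k (x - y))" for x y
  proof (cases "x \<in> K \<or> y \<in> K")
    case True
    have "(\<phi> x - \<phi> y)\<^sup>2 \<le> (2 * B)\<^sup>2"
      using B(1)[of x] B(1)[of y] by (intro power2_le_iff_abs_le[THEN iffD2]) auto
    moreover have "(\<phi> x - \<phi> y)\<^sup>2 \<le> 4 * B\<^sup>2 * (norm (x - y))\<^sup>2"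
    proof (rule order_trans)
      show "(\<phi> x - \<phi> y)\<^sup>2 \<le> (B * norm (x - y))\<^sup>2"
      using test_functions_Lipschitz[OF \<phi> B(2), of x y] by (metis abs_ge_zero power2_abs power_mono)
      show "(B * norm (x - y))\<^sup>2 \<le> 4 * B\<^sup>2 * (norm (x - y))\<^sup>2"
        by (simp add: power_mult_distrib mult_right_mono)
    qed
    ultimately have le: "(\<phi> x - \<phi> y)\<^sup>2 \<le> 4 * B\<^sup>2 * min 1 ((norm (x - y))\<^sup>2)"
      by (simp add: min_def power_mult_distrib)
    have "(diff_quot s \<phi> (x, y))\<^sup>2 = (\<phi> x - \<phi> y)\<^sup>2 / norm (x - y) powr (real DIM('a) + 2 * s)"
      using diff_quot_mult[of s \<phi> x y \<phi>] by (simp add: power2_eq_square)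
    also have "\<dots> \<le> 4 * B\<^sup>2 * min 1 ((norm (x - y))\<^sup>2) / norm (x - y) powr (real DIM('a) + 2 * s)"
      by (intro divide_right_mono le) auto
    finally have "ennreal ((diff_quot s \<phi> (x, y))\<^sup>2) \<le> ennreal (4 * B\<^sup>2 * (min 1 ((norm (x - y))\<^sup>2) / norm (x - y) powr (real DIM('a) + 2 * s)))"
      by (intro ennreal_leI) simp
    also have "\<dots> = ennreal (4 * B\<^sup>2) * (1 * k (x - y))"
      unfolding k_def by (subst ennreal_mult) auto
    also have "\<dots> \<le> ennreal (4 * B\<^sup>2) * ((indicator K x + indicator K y) * k (x - y))"
      using True by (intro mult_left_mono mult_right_mono) (auto simp: indicator_def)
    finally show ?thesis .
  qed (use K in \<open>simp add: diff_quot_def\<close>)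
  have shift: "(\<integral>\<^sup>+y. k (x - y) \<partial>lborel) = I" "(\<integral>\<^sup>+x. k (x - y) \<partial>lborel) = I" for x y
    using nn_integral_lborel_affine[of k "-1" x] nn_integral_lborel_affine[of k 1 "- y"]
    by (simp_all add: I_def)
  have "(\<integral>\<^sup>+p. ennreal ((diff_quot s \<phi> p)\<^sup>2) \<partial>(lborel \<Otimes>\<^sub>M lborel))
      = (\<integral>\<^sup>+x. \<integral>\<^sup>+y. ennreal ((diff_quot s \<phi> (x, y))\<^sup>2) \<partial>lborel \<partial>lborel)"
    by (subst lborel.nn_integral_fst[symmetric]) auto
  also have "\<dots> \<le> (\<integral>\<^sup>+x. \<integral>\<^sup>+y. ennreal (4 * B\<^sup>2) * ((indicator K x + indicator K y) * k (x - y)) \<partial>lborel \<partial>lborel)"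
    by (intro nn_integral_mono pt)
  also have "\<dots> = ennreal (4 * B\<^sup>2) * ((\<integral>\<^sup>+x. \<integral>\<^sup>+y. indicator K x * k (x - y) \<partial>lborel \<partial>lborel) + (\<integral>\<^sup>+x. \<integral>\<^sup>+y. indicator K y * k (x - y) \<partial>lborel \<partial>lborel))"
    by (simp add: nn_integral_cmult nn_integral_add distrib_right)
  also have "(\<integral>\<^sup>+x. \<integral>\<^sup>+y. indicator K y * k (x - y) \<partial>lborel \<partial>lborel) = (\<integral>\<^sup>+y. \<integral>\<^sup>+x. indicator K y * k (x - y) \<partial>lborel \<partial>lborel)"
    by (rule lborel_pair.Fubini') measurable
  also have "ennreal (4 * B\<^sup>2) * ((\<integral>\<^sup>+x. \<integral>\<^sup>+y. indicator K x * k (x - y) \<partial>lborel \<partial>lborel) + \<dots>) = ennreal (4 * B\<^sup>2) * (emeasure lborel K * I + emeasure lborel K * I)"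
    by (simp add: nn_integral_cmult shift nn_integral_multc)
  also have "\<dots> < \<infinity>"
    using I Kfin by (simp add: ennreal_mult_less_top)
  finally show ?thesis
    by (intro integrableI_nonneg) auto
qed

text \<open>The definition is an iterated integral. Square integrability of both difference
  quotients makes their product integrable, which is what Fubini's theorem requires.\<close>

lemma gagliardo_form_eq:
  fixes u v :: "'a::euclidean_space \<Rightarrow> real"
  assumes [measurable]: "u \<in> borel_measurable borel" "v \<in> borel_measurable borel"
    and u: "integrable (lborel \<Otimes>\<^sub>M lborel) (\<lambda>p. (diff_quot s u p)\<^sup>2)"
    and v: "integrable (lborel \<Otimes>\<^sub>M lborel) (\<lambda>p. (diff_quot s v p)\<^sup>2)"
  shows "gagliardo_form s u v = (LINT p|(lborel \<Otimes>\<^sub>M lborel). diff_quot s u p * diff_quot s v p)"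
proof -
  have "integrable (lborel \<Otimes>\<^sub>M lborel) (\<lambda>p. diff_quot s u p * diff_quot s v p)"
    using L2_inner(1)[of "diff_quot s u" "lborel \<Otimes>\<^sub>M lborel" "diff_quot s v"] u v by simp
  then have "(LINT p|(lborel \<Otimes>\<^sub>M lborel). diff_quot s u p * diff_quot s v p)
      = (LINT x|lborel. (LINT y|lborel. diff_quot s u (x, y) * diff_quot s v (x, y)))"
    by (subst lborel_pair.integral_fst') auto
  also have "\<dots> = (LINT x|lborel. (LINT y|lborel. (u x - u y) * (v x - v y) / norm (x - y) powr (real DIM('a) + 2 * s)))"
    by (simp only: diff_quot_mult)
  also have "\<dots> = gagliardo_form s u v"
    unfolding gagliardo_form_def by (simp add: integral_completion)
  finally show ?thesis by simp
qed

section \<open>Weak gradients\<close>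

lemma test_functions_measurable:
  assumes "\<phi> \<in> test_functions \<Omega>"
  shows "\<phi> \<in> borel_measurable borel" "gradient \<phi> \<in> borel_measurable borel"
  by (rule borel_measurable_continuous_onI[OF test_functions_continuous[OF assms]]
      borel_measurable_continuous_onI[OF test_functions_continuous_gradient[OF assms]])+

lemma integral_lborel_translate:
  fixes f :: "'a::euclidean_space \<Rightarrow> real"
  assumes [measurable]: "f \<in> borel_measurable borel"
  shows "(LINT x|lborel. f (x + c)) = (LINT x|lborel. f x)"
proof -
  have "(LINT x|lborel. f x) = (LINT x|distr lborel borel ((+) c). f x)"
    by (simp add: lborel_distr_plus)
  also have "\<dots> = (LINT x|lborel. f (c + x))"
    by (rule integral_distr) auto
  finally show ?thesis by (simp add: add.commute)
qed

lemma integrable_lborel_translate: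
  fixes f :: "'a::euclidean_space \<Rightarrow> real"
  assumes "integrable lborel f"
  shows "integrable lborel (\<lambda>x. f (x + c))"
proof -
  have "integrable (distr lborel borel ((+) c)) f"
    using assms by (simp add: lborel_distr_plus)
  then have "integrable lborel (\<lambda>x. f (c + x))"
    by (rule integrable_distr[rotated]) auto
  then show ?thesis by (simp add: add.commute)
qed

text \<open>Difference quotients in direction \<open>b\<close> have integral zero by translation
  invariance, and dominated convergence passes this to the derivative. Step sizes of at most 1 keep
  all of them supported in one ball, where the Lipschitz bound provides a constant majorant
  \<open>w\<close>.\<close>

lemma integral_directional_derivative:
  fixes \<phi> :: "'a::euclidean_space \<Rightarrow> real"
  assumes \<phi>: "\<phi> \<in> test_functions \<Omega>"
  shows "(LINT x|lborel. gradient \<phi> x \<bullet> b) = 0"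
proof -
  note [measurable] = test_functions_measurable[OF \<phi>]
  obtain K where K: "compact K" "\<And>x. x \<notin> K \<Longrightarrow> \<phi> x = 0"
    using test_functions_support[OF \<phi>] by metis
  obtain B where B: "\<And>x. norm (gradient \<phi> x) \<le> B"
    using test_functions_bounded[OF \<phi>] by metis
  have B0: "0 \<le> B" using B[of 0] norm_ge_zero order_trans by blast
  obtain r where r: "\<And>x. x \<in> K \<Longrightarrow> norm x \<le> r"
    using compact_imp_bounded[OF K(1)] by (auto simp: bounded_iff)
  have int: "integrable lborel \<phi>"
    using test_functions_continuous[OF \<phi>] K by (rule continuous_compact_support_integrable)
  define h where "h k = inverse (real (Suc k))" for k
  have h: "0 < h k" "h k \<le> 1" for k by (auto simp: h_def field_simps)
  have h_lim: "h \<longlonglongrightarrow> 0" unfolding h_def[abs_def] by (rule LIMSEQ_inverse_real_of_nat)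
  define w where "w x = B * norm b * indicator (cball 0 (r + norm b)) x" for x :: 'a
  have lim: "(\<lambda>k. LINT x|lborel. (\<phi> (x + h k *\<^sub>R b) - \<phi> x) / h k) \<longlonglongrightarrow> (LINT x|lborel. gradient \<phi> x \<bullet> b)"
  proof (rule integral_dominated_convergence[where w = w])
    show "integrable lborel w"
      unfolding w_def using emeasure_bounded_finite[of "cball (0::'a) (r + norm b)"]
      by (intro integrable_mult_right integrable_real_indicator) auto
    show "AE x in lborel. (\<lambda>k. (\<phi> (x + h k *\<^sub>R b) - \<phi> x) / h k) \<longlonglongrightarrow> gradient \<phi> x \<bullet> b"
    proof (rule AE_I2)
      fix x
      have "((\<lambda>t. x + t *\<^sub>R b) has_derivative (\<lambda>t. t *\<^sub>R b)) (at 0)"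
        by (auto intro!: derivative_eq_intros)
      then have "((\<lambda>t. \<phi> (x + t *\<^sub>R b)) has_derivative (\<lambda>t. gradient \<phi> (x + 0 *\<^sub>R b) \<bullet> (t *\<^sub>R b))) (at 0)"
        by (rule has_derivative_compose[OF _ test_functions_has_derivative[OF \<phi>]])
      then have "((\<lambda>t. \<phi> (x + t *\<^sub>R b)) has_real_derivative (gradient \<phi> x \<bullet> b)) (at 0)"
        unfolding has_field_derivative_def by (rule has_derivative_eq_rhs) auto
      then have "((\<lambda>t. (\<phi> (x + t *\<^sub>R b) - \<phi> x) / t) \<longlongrightarrow> gradient \<phi> x \<bullet> b) (at 0)"
        by (simp add: DERIV_def)
      then show "(\<lambda>k. (\<phi> (x + h k *\<^sub>R b) - \<phi> x) / h k) \<longlonglongrightarrow> gradient \<phi> x \<bullet> b"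
        by (rule filterlim_compose) (use h_lim h(1) in \<open>auto simp: filterlim_at less_imp_neq[symmetric]\<close>)
    qed
    show "AE x in lborel. norm ((\<phi> (x + h k *\<^sub>R b) - \<phi> x) / h k) \<le> w x" for k
    proof (rule AE_I2)
      fix x
      show "norm ((\<phi> (x + h k *\<^sub>R b) - \<phi> x) / h k) \<le> w x"
      proof (cases "x \<in> cball 0 (r + norm b)")
        case True
        have "\<bar>\<phi> (x + h k *\<^sub>R b) - \<phi> x\<bar> \<le> B * norm ((x + h k *\<^sub>R b) - x)"
          by (rule test_functions_Lipschitz[OF \<phi> B])
        then show ?thesis
          using True h(1)[of k] by (simp add: w_def field_simps)
      next
        case False
        have "norm (h k *\<^sub>R b) \<le> norm b"
          using h[of k] by (simp add: mult_left_le_one_le)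
        moreover have "r + norm b < norm x" "norm x \<le> norm (x + h k *\<^sub>R b) + norm (h k *\<^sub>R b)"
          using False norm_triangle_ineq4[of "x + h k *\<^sub>R b" "h k *\<^sub>R b"] by auto
        ultimately have "\<not> norm (x + h k *\<^sub>R b) \<le> r" "\<not> norm x \<le> r"
          using norm_ge_zero[of b] by linarith+
        then have "\<phi> (x + h k *\<^sub>R b) = 0" "\<phi> x = 0"
          using K(2) r by blast+
        then show ?thesis using False by (simp add: w_def)
      qed
    qed
  qed simp_all
  have "(LINT x|lborel. (\<phi> (x + h k *\<^sub>R b) - \<phi> x) / h k) = 0" for k
    using int integrable_lborel_translate[OF int] by (simp add: integral_lborel_translate)
  with lim have "(\<lambda>k. 0) \<longlonglongrightarrow> (LINT x|lborel. gradient \<phi> x \<bullet> b)"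
    by (simp only:)
  then show ?thesis
    by (simp add: LIMSEQ_const_iff)
qed

lemma continuous_compact_support_integrable_lebesgue:
  fixes f :: "'a::euclidean_space \<Rightarrow> 'b::euclidean_space"
  assumes "continuous_on UNIV f" "compact K" "\<And>x. x \<notin> K \<Longrightarrow> f x = 0"
  shows "integrable lebesgue f"
proof -
  have "integrable lborel (\<lambda>x. indicator K x *\<^sub>R f x)"
    by (rule borel_integrable_compact) (use assms continuous_on_subset[OF assms(1)] in auto)
  moreover have "(\<lambda>x. indicator K x *\<^sub>R f x) = f"
  proof
    show "indicator K x *\<^sub>R f x = f x" for x
      by (cases "x \<in> K") (auto simp: assms(3))
  qed
  ultimately show ?thesis
    using borel_measurable_continuous_onI[OF assms(1)] by (simp add: integrable_completion)
qed

text \<open>By the product rule the sum of the two integrals is that of the gradient of the test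
  function \<open>\<phi> * \<psi>\<close>, each component of which integrates to zero.\<close>

lemma test_functions_integration_by_parts:
  fixes \<phi> \<psi> :: "'a::euclidean_space \<Rightarrow> real"
  assumes \<phi>: "\<phi> \<in> test_functions \<Omega>" and \<psi>: "\<psi> \<in> test_functions \<Omega>'"
  shows "integrable lebesgue (\<lambda>x. \<phi> x *\<^sub>R gradient \<psi> x)"
    and "(LINT x|lebesgue. \<phi> x *\<^sub>R gradient \<psi> x) = - (LINT x|lebesgue. \<psi> x *\<^sub>R gradient \<phi> x)"
proof -
  have int: "integrable lebesgue (\<lambda>x. f x *\<^sub>R gradient g x)"
    if f: "f \<in> test_functions S" and g: "g \<in> test_functions T" for f g :: "'a \<Rightarrow> real" and S T
  proof -
    obtain K where K: "compact K" "\<And>x. x \<notin> K \<Longrightarrow> f x = 0"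
      using test_functions_support[OF f] by metis
    show ?thesis
      by (rule continuous_compact_support_integrable_lebesgue[OF _ K(1)])
         (use K(2) f g in \<open>auto intro!: continuous_on_scaleR test_functions_continuous test_functions_continuous_gradient\<close>)
  qed
  show "integrable lebesgue (\<lambda>x. \<phi> x *\<^sub>R gradient \<psi> x)"
    by (rule int[OF \<phi> \<psi>])
  have prod: "(\<lambda>x. \<phi> x * \<psi> x) \<in> test_functions \<Omega>"
    by (rule test_functions_mult[OF \<phi> test_functions_Ck[OF \<psi>]])
  have "(LINT x|lebesgue. \<phi> x *\<^sub>R gradient \<psi> x) + (LINT x|lebesgue. \<psi> x *\<^sub>R gradient \<phi> x)
      = (LINT x|lebesgue. gradient (\<lambda>x. \<phi> x * \<psi> x) x)"
    using int[OF \<phi> \<psi>] int[OF \<psi> \<phi>] by (simp add: gradient_mult[OF \<phi> \<psi>])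
  also have "\<dots> = 0"
  proof (rule euclidean_eqI)
    fix b :: 'a assume "b \<in> Basis"
    have "integrable lebesgue (gradient (\<lambda>x. \<phi> x * \<psi> x))"
      using int[OF \<phi> \<psi>] int[OF \<psi> \<phi>] by (simp add: gradient_mult[OF \<phi> \<psi>, abs_def])
    then have "(LINT x|lebesgue. gradient (\<lambda>x. \<phi> x * \<psi> x) x) \<bullet> b = (LINT x|lebesgue. gradient (\<lambda>x. \<phi> x * \<psi> x) x \<bullet> b)"
      by simp
    also have "\<dots> = (LINT x|lborel. gradient (\<lambda>x. \<phi> x * \<psi> x) x \<bullet> b)"
      using test_functions_measurable(2)[OF prod] by (intro integral_completion) simp
    also have "\<dots> = 0"
      by (rule integral_directional_derivative[OF prod])
    finally show "(LINT x|lebesgue. gradient (\<lambda>x. \<phi> x * \<psi> x) x) \<bullet> b = 0 \<bullet> b" by simp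
  qed
  finally show "(LINT x|lebesgue. \<phi> x *\<^sub>R gradient \<psi> x) = - (LINT x|lebesgue. \<psi> x *\<^sub>R gradient \<phi> x)"
    by (simp add: eq_neg_iff_add_eq_0)
qed

lemma locally_integrable_continuous:
  fixes f :: "'a::euclidean_space \<Rightarrow> 'b::euclidean_space"
  assumes "continuous_on UNIV f"
  shows "locally_integrable f"
  unfolding locally_integrable_def set_integrable_def
proof (intro allI impI)
  fix K :: "'a set" assume K: "compact K"
  have [measurable]: "f \<in> borel_measurable borel" "K \<in> sets borel"
    using assms K by (auto intro: borel_measurable_continuous_onI simp: compact_imp_closed)
  have "integrable lborel (\<lambda>x. indicator K x *\<^sub>R f x)"
    by (rule borel_integrable_compact) (use assms K continuous_on_subset[OF assms(1)] in auto)
  then show "integrable lebesgue (\<lambda>x. indicator K x *\<^sub>R f x)"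
    by (simp add: integrable_completion)
qed

lemma has_weak_gradient_test_function:
  assumes "\<phi> \<in> test_functions \<Omega>"
  shows "has_weak_gradient \<phi> (gradient \<phi>)"
  unfolding has_weak_gradient_def
  using assms test_functions_integration_by_parts(2)[OF assms]
  by (auto intro!: locally_integrable_continuous test_functions_continuous test_functions_continuous_gradient)

section \<open>Uniqueness of weak gradients\<close>

text \<open>Products of the bumps \<open>flat 1\<close>, rescaled, approximate the indicator function of a box.\<close>

definition box_bump :: "'a::euclidean_space \<Rightarrow> 'a \<Rightarrow> real \<Rightarrow> 'a \<Rightarrow> real" where
  "box_bump a c k x = (\<Prod>b\<in>Basis. flat 1 (k * (x \<bullet> b - a \<bullet> b)) * flat 1 (k * (c \<bullet> b - x \<bullet> b)))"

lemma box_bump_bounds: "0 \<le> box_bump a c k x" "box_bump a c k x \<le> 1"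
proof -
  have "0 \<le> flat 1 (k * (x \<bullet> b - a \<bullet> b)) * flat 1 (k * (c \<bullet> b - x \<bullet> b))"
    "flat 1 (k * (x \<bullet> b - a \<bullet> b)) * flat 1 (k * (c \<bullet> b - x \<bullet> b)) \<le> 1" for b
    by (auto intro!: mult_le_one mult_nonneg_nonneg flat_1_bounds)
  then show "0 \<le> box_bump a c k x" "box_bump a c k x \<le> 1"
    unfolding box_bump_def by (auto intro!: prod_nonneg prod_le_1)
qed

lemma box_bump_eq_0:
  assumes "0 < k" "x \<notin> box a c"
  shows "box_bump a c k x = 0"
proof -
  obtain b where b: "b \<in> Basis" "\<not> (a \<bullet> b < x \<bullet> b \<and> x \<bullet> b < c \<bullet> b)"
    using assms by (auto simp: mem_box)
  have "flat 1 (k * (x \<bullet> b - a \<bullet> b)) * flat 1 (k * (c \<bullet> b - x \<bullet> b)) = 0"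
    using assms(1) b(2) by (auto simp: flat_def zero_less_mult_iff)
  with b(1) show ?thesis
    unfolding box_bump_def by (intro prod_zero) auto
qed

lemma box_bump_test_function:
  assumes "0 < k"
  shows "box_bump a c k \<in> test_functions UNIV"
proof (rule test_functionsI[where K = "cbox a c"])
  show "Ck i (box_bump a c k)" for i
    unfolding box_bump_def[abs_def]
    by (intro Ck_prod Ck_mult Ck_compose[OF Ck_flat] Ck_cmult Ck_diff Ck_inner_left Ck_const)
  show "box_bump a c k x = 0" if "x \<notin> cbox a c" for x
    using that box_subset_cbox by (intro box_bump_eq_0[OF assms]) auto
qed auto

lemma flat_1_tendsto_1:
  assumes "0 < t"
  shows "(\<lambda>k. flat 1 (real (Suc k) * t)) \<longlonglongrightarrow> 1"
proof -
  have "(\<lambda>k. exp (- (inverse (real (Suc k)) * (1 / t)))) \<longlonglongrightarrow> exp (- (0 * (1 / t)))"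
    by (intro tendsto_intros LIMSEQ_inverse_real_of_nat)
  moreover have "flat 1 (real (Suc k) * t) = exp (- (inverse (real (Suc k)) * (1 / t)))" for k
    using assms by (simp add: flat_def field_simps del: of_nat_Suc)
  ultimately show ?thesis by simp
qed

lemma box_bump_tendsto: "(\<lambda>k. box_bump a c (real (Suc k)) x) \<longlonglongrightarrow> indicator (box a c) x"
proof (cases "x \<in> box a c")
  case True
  have "(\<lambda>k. box_bump a c (real (Suc k)) x) \<longlonglongrightarrow> (\<Prod>b\<in>(Basis::'a set). 1 * 1)"
    unfolding box_bump_def
    by (intro tendsto_prod tendsto_mult flat_1_tendsto_1) (use True in \<open>auto simp: mem_box\<close>)
  then show ?thesis using True by simp
qed (use box_bump_eq_0[of "real (Suc _)" x a c] in simp)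

lemma sigma_finite_measure_lebesgue: "sigma_finite_measure (lebesgue :: 'a::euclidean_space measure)"
proof
  obtain A :: "'a set set" where "countable A" "A \<subseteq> sets lborel" "\<Union>A = UNIV" "\<forall>a\<in>A. emeasure lborel a \<noteq> \<infinity>"
    using lborel.sigma_finite_countable by auto
  then show "\<exists>A::'a set set. countable A \<and> A \<subseteq> sets lebesgue \<and> \<Union>A = space lebesgue \<and> (\<forall>a\<in>A. emeasure lebesgue a \<noteq> \<infinity>)"
    by (intro exI[of _ A]) auto
qed

text \<open>Bumps that converge boundedly to the indicator of a box show that \<open>D\<close> has
  integral zero over every box. Boxes generate the Borel sets and are stable under intersection, so
  inside a bounded box the same holds for all Borel sets, then for all Lebesgue sets, and a function
  with this property vanishes almost everywhere.\<close>

lemma du_Bois_Reymond: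
  fixes D :: "'a::euclidean_space \<Rightarrow> 'b::euclidean_space"
  assumes loc: "locally_integrable D"
    and zero: "\<And>\<psi>. \<psi> \<in> test_functions UNIV \<Longrightarrow> (LINT x|lebesgue. \<psi> x *\<^sub>R D x) = 0"
  shows "AE x in lebesgue. D x = 0"
proof -
  have cbox: "integrable lebesgue (\<lambda>x. indicator (cbox a c) x *\<^sub>R D x)" for a c
    using loc by (simp add: locally_integrable_def set_integrable_def)
  have D_cbox_meas [measurable]: "(\<lambda>x. indicator (cbox a c) x *\<^sub>R D x) \<in> borel_measurable lebesgue" for a c
    using cbox by auto
  have int_box: "integrable lebesgue (\<lambda>x. indicator A x *\<^sub>R D x)"
    if "A \<in> sets lebesgue" "A \<subseteq> cbox a c" for A a c
  proof -
    have "integrable lebesgue (\<lambda>x. indicator A x *\<^sub>R (indicator (cbox a c) x *\<^sub>R D x))"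
      by (rule integrable_mult_indicator[OF that(1) cbox])
    moreover have "indicator A x *\<^sub>R (indicator (cbox a c) x *\<^sub>R D x) = indicator A x *\<^sub>R D x" for x
      using that(2) by (auto simp: indicator_def)
    ultimately show ?thesis by (simp only:)
  qed
  have box_zero: "(LINT x|lebesgue. indicator (box a c) x *\<^sub>R D x) = 0" for a c
  proof -
    have "(\<lambda>k. LINT x|lebesgue. box_bump a c (real (Suc k)) x *\<^sub>R D x) \<longlonglongrightarrow> (LINT x|lebesgue. indicator (box a c) x *\<^sub>R D x)"
    proof (rule integral_dominated_convergence[where w = "\<lambda>x. norm (indicator (cbox a c) x *\<^sub>R D x)"])
      show "integrable lebesgue (\<lambda>x. norm (indicator (cbox a c) x *\<^sub>R D x))"
        using cbox by (rule integrable_norm)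
      show "(\<lambda>x. indicator (box a c) x *\<^sub>R D x) \<in> borel_measurable lebesgue"
        using borel_measurable_integrable[OF int_box[OF _ box_subset_cbox[of a c]]] by simp
      show "(\<lambda>x. box_bump a c (real (Suc k)) x *\<^sub>R D x) \<in> borel_measurable lebesgue" for k
      proof -
        have "box_bump a c (real (Suc k)) \<in> borel_measurable lebesgue"
          using test_functions_measurable(1)[OF box_bump_test_function[of "real (Suc k)" a c]]
          by (intro measurable_completion) simp
        then have "(\<lambda>x. box_bump a c (real (Suc k)) x *\<^sub>R (indicator (cbox a c) x *\<^sub>R D x)) \<in> borel_measurable lebesgue"
          by measurable
        moreover have "box_bump a c (real (Suc k)) x *\<^sub>R (indicator (cbox a c) x *\<^sub>R D x) = box_bump a c (real (Suc k)) x *\<^sub>R D x" for x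
          using box_bump_eq_0[of "real (Suc k)" x a c] box_subset_cbox[of a c] by (auto simp: indicator_def)
        ultimately show ?thesis by (simp only:)
      qed
      show "AE x in lebesgue. (\<lambda>k. box_bump a c (real (Suc k)) x *\<^sub>R D x) \<longlonglongrightarrow> indicator (box a c) x *\<^sub>R D x"
        by (intro AE_I2 tendsto_scaleR box_bump_tendsto tendsto_const)
      show "AE x in lebesgue. norm (box_bump a c (real (Suc k)) x *\<^sub>R D x) \<le> norm (indicator (cbox a c) x *\<^sub>R D x)" for k
      proof (rule AE_I2)
        fix x
        show "norm (box_bump a c (real (Suc k)) x *\<^sub>R D x) \<le> norm (indicator (cbox a c) x *\<^sub>R D x)"
          using box_bump_eq_0[of "real (Suc k)" x a c] box_bump_bounds[of a c "real (Suc k)" x] box_subset_cbox[of a c]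
          by (cases "x \<in> cbox a c") (auto simp: mult_left_le_one_le subset_eq)
      qed
    qed
    moreover have "(LINT x|lebesgue. box_bump a c (real (Suc k)) x *\<^sub>R D x) = 0" for k
      by (intro zero box_bump_test_function) simp
    ultimately show ?thesis by (simp add: LIMSEQ_const_iff)
  qed
  have ae: "AE x in lebesgue. indicator (box (- (real N *\<^sub>R One)) (real N *\<^sub>R One)) x *\<^sub>R D x = 0" for N :: nat
  proof -
    \<comment> \<open>Cutting off to a bounded box makes \<open>F\<close> integrable on the whole
      space, which the complement step of the induction over Borel sets needs.\<close>
    define Q :: "'a set" where "Q = box (- (real N *\<^sub>R One)) (real N *\<^sub>R One)"
    define F where "F x = indicator Q x *\<^sub>R D x" for x
    have F: "integrable lebesgue F"
      unfolding F_def Q_def by (rule int_box[OF _ box_subset_cbox]) simp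
    have FQ: "set_integrable lebesgue A F" if "A \<in> sets lebesgue" for A
      unfolding set_integrable_def by (rule integrable_mult_indicator[OF that F])
    have borel_zero: "(LINT x:A|lebesgue. F x) = 0" if "A \<in> sets borel" for A
    proof -
      let ?E = "range (\<lambda>(a, c). box a c :: 'a set)"
      have A: "A \<in> sigma_sets UNIV ?E"
        using that by (simp add: borel_eq_box)
      have leb: "X \<in> sets lebesgue" if "X \<in> sigma_sets UNIV ?E" for X
      proof -
        have "X \<in> sets borel" using that by (simp add: borel_eq_box)
        then show ?thesis by simp
      qed
      have UNIV_zero: "(LINT x:UNIV|lebesgue. F x) = 0"
        using box_zero unfolding F_def Q_def set_lebesgue_integral_def by simp
      have "Int_stable ?E" "?E \<subseteq> Pow UNIV"
        by (auto simp: Int_stable_def box_Int_box)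
      then show ?thesis
        using A
      proof (induct A rule: sigma_sets_induct_disjoint)
        case (basic X)
        then obtain a c where X: "X = box a c" by auto
        obtain a' c' where "X \<inter> Q = box a' c'" unfolding X Q_def box_Int_box by blast
        then have "(LINT x:X|lebesgue. F x) = (LINT x|lebesgue. indicator (box a' c') x *\<^sub>R D x)"
          unfolding set_lebesgue_integral_def F_def by (simp add: indicator_inter_arith[symmetric])
        then show ?case using box_zero by simp
      next
        case (compl X)
        have "(LINT x:UNIV - X|lebesgue. F x) + (LINT x:X|lebesgue. F x) = (LINT x:UNIV|lebesgue. F x)"
        proof -
          have X: "X \<in> sets lebesgue" by (rule leb[OF compl(1)])
          then have X': "UNIV - X \<in> sets lebesgue" using sets.compl_sets[OF X] by simp
          have "(UNIV - X) \<inter> X = {}" "(UNIV - X) \<union> X = UNIV" by blast+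
          then show ?thesis
            using set_integral_Un[OF _ FQ[OF X'] FQ[OF X]] by metis
        qed
        then show ?case using compl UNIV_zero by simp
      next
        case (union X)
        have "(LINT x:(\<Union>i. X i)|lebesgue. F x) = (\<Sum>i. LINT x:(X i)|lebesgue. F x)"
        proof (rule lebesgue_integral_countable_add)
          show "X i \<in> sets lebesgue" for i using union(2) leb by blast
          then show "set_integrable lebesgue (\<Union>i. X i) F" by (intro FQ) auto
          show "i \<noteq> j \<Longrightarrow> X i \<inter> X j = {}" for i j
            using union(1) by (simp add: disjoint_family_on_def)
        qed
        then show ?case using union(3) by simp
      qed (auto simp: set_lebesgue_integral_def)
    qed
    \<comment> \<open>A Lebesgue set differs from its Borel main part by a null set only.\<close>
    have "(LINT x:A|lebesgue. F x) = 0" if A: "A \<in> sets lebesgue" for A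
    proof -
      have "(LINT x:A|lebesgue. F x) = (LINT x:(main_part lborel A)|lebesgue. F x)"
        unfolding set_lebesgue_integral_def
      proof (rule integral_cong_AE)
        show "AE x in lebesgue. indicator A x *\<^sub>R F x = indicator (main_part lborel A) x *\<^sub>R F x"
          using AE_completion[OF AE_notin_null_part[OF A]]
        proof eventually_elim
          case (elim x)
          with main_part_null_part_Un[OF A] have "x \<in> A \<longleftrightarrow> x \<in> main_part lborel A" by blast
          then show ?case by (simp add: indicator_def)
        qed
      qed (use FQ[OF A] FQ[of "main_part lborel A"] main_part_sets[OF A] in \<open>auto simp: set_integrable_def\<close>)
      also have "\<dots> = 0"
        using main_part_sets[OF A] by (intro borel_zero) simp
      finally show ?thesis .
    qed
    then have "AE x in lebesgue. F x = 0"
      by (rule sigma_finite_measure.density_zero[OF sigma_finite_measure_lebesgue F])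
    then show ?thesis by (simp add: F_def Q_def)
  qed
  then have "AE x in lebesgue. \<forall>N::nat. indicator (box (- (real N *\<^sub>R One)) (real N *\<^sub>R One)) x *\<^sub>R D x = 0"
    unfolding AE_all_countable by (intro allI ae)
  then show ?thesis
  proof eventually_elim
    case (elim x)
    have "x \<in> (\<Union>N::nat. box (- (real N *\<^sub>R One)) (real N *\<^sub>R One))"
      unfolding UN_box_eq_UNIV by simp
    then obtain N :: nat where "x \<in> box (- (real N *\<^sub>R One)) (real N *\<^sub>R One)" by blast
    with elim[rule_format, of N] show ?case by (simp add: indicator_def)
  qed
qed

text \<open>This makes the chosen \<open>weak_gradient\<close> accessible: it agrees almost
  everywhere with any weak gradient constructed by hand. The difference of two candidates is
  orthogonal to all test functions.\<close>

lemma has_weak_gradient_unique: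
  fixes u :: "'a::euclidean_space \<Rightarrow> real"
  assumes G: "has_weak_gradient u G" and H: "has_weak_gradient u H"
  shows "AE x in lebesgue. G x = H x"
proof -
  have GH: "locally_integrable G" "locally_integrable H"
    using assms by (auto simp: has_weak_gradient_def)
  have int: "integrable lebesgue (\<lambda>x. \<psi> x *\<^sub>R F x)"
    if F: "locally_integrable F" and \<psi>: "\<psi> \<in> test_functions UNIV" for F :: "'a \<Rightarrow> 'a" and \<psi>
  proof -
    obtain K where K: "compact K" "\<And>x. x \<notin> K \<Longrightarrow> \<psi> x = 0"
      using test_functions_support[OF \<psi>] by metis
    obtain B where B: "\<And>x. \<bar>\<psi> x\<bar> \<le> B"
      using test_functions_bounded[OF \<psi>] by metis
    have eq: "(\<lambda>x. \<psi> x *\<^sub>R (indicator K x *\<^sub>R F x)) = (\<lambda>x. \<psi> x *\<^sub>R F x)"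
    proof
      show "\<psi> x *\<^sub>R (indicator K x *\<^sub>R F x) = \<psi> x *\<^sub>R F x" for x
        by (cases "x \<in> K") (auto simp: K(2))
    qed
    have FK: "integrable lebesgue (\<lambda>x. indicator K x *\<^sub>R F x)"
      using F K by (simp add: locally_integrable_def set_integrable_def)
    have [measurable]: "\<psi> \<in> borel_measurable lebesgue"
      using test_functions_measurable(1)[OF \<psi>] by (intro measurable_completion) simp
    have [measurable]: "(\<lambda>x. indicator K x *\<^sub>R F x) \<in> borel_measurable lebesgue"
      using FK by auto
    have "integrable lebesgue (\<lambda>x. \<psi> x *\<^sub>R (indicator K x *\<^sub>R F x))"
    proof (rule Bochner_Integration.integrable_bound[OF integrable_mult_right[OF integrable_norm[OF FK], of B]])
      show "AE x in lebesgue. norm (\<psi> x *\<^sub>R (indicator K x *\<^sub>R F x)) \<le> norm (B * norm (indicator K x *\<^sub>R F x))"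
      proof (rule AE_I2)
        fix x
        have "norm (\<psi> x *\<^sub>R (indicator K x *\<^sub>R F x)) = \<bar>\<psi> x\<bar> * norm (indicator K x *\<^sub>R F x)"
          by (rule norm_scaleR)
        also have "\<dots> \<le> B * norm (indicator K x *\<^sub>R F x)"
          by (intro mult_right_mono B norm_ge_zero)
        finally show "norm (\<psi> x *\<^sub>R (indicator K x *\<^sub>R F x)) \<le> norm (B * norm (indicator K x *\<^sub>R F x))"
          by (rule order_trans) simp
      qed
    qed measurable
    then show ?thesis by (simp only: eq)
  qed
  have "AE x in lebesgue. G x - H x = 0"
  proof (rule du_Bois_Reymond)
    show "locally_integrable (\<lambda>x. G x - H x)"
      using GH unfolding locally_integrable_def by (auto intro!: set_integral_diff)
    fix \<psi> :: "'a \<Rightarrow> real" assume \<psi>: "\<psi> \<in> test_functions UNIV"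
    have "(LINT x|lebesgue. \<psi> x *\<^sub>R G x) = (LINT x|lebesgue. \<psi> x *\<^sub>R H x)"
      using G H \<psi> unfolding has_weak_gradient_def by (metis neg_equal_iff_equal)
    then show "(LINT x|lebesgue. \<psi> x *\<^sub>R (G x - H x)) = 0"
      using int[OF GH(1) \<psi>] int[OF GH(2) \<psi>] by (simp add: scaleR_diff_right)
  qed
  then show ?thesis by eventually_elim simp
qed

lemma has_weak_gradient_weak_gradient:
  "has_weak_gradient u G \<Longrightarrow> has_weak_gradient u (weak_gradient u)"
  unfolding weak_gradient_def by (rule someI[of "has_weak_gradient u"])

lemma weak_gradient_AE_eq:
  "has_weak_gradient u G \<Longrightarrow> AE x in lebesgue. weak_gradient u x = G x"
  by (rule has_weak_gradient_unique[OF has_weak_gradient_weak_gradient])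

section \<open>The energy form and its closure\<close>

text \<open>Completeness of L^2 with the limit already identified by almost everywhere convergence.
  Fatou's lemma in the second index of \<open>F k - F j\<close> carries the Cauchy bound over to
  \<open>F k - f\<close>.\<close>

lemma L2_limit:
  fixes F :: "nat \<Rightarrow> 'a \<Rightarrow> 'b::euclidean_space"
  assumes [measurable]: "\<And>k. F k \<in> borel_measurable M" "f \<in> borel_measurable M"
    and int: "\<And>k. integrable M (\<lambda>x. (norm (F k x))\<^sup>2)"
    and Cauchy: "\<And>e. 0 < e \<Longrightarrow> \<exists>N. \<forall>i\<ge>N. \<forall>j\<ge>N. (LINT x|M. (norm (F i x - F j x))\<^sup>2) < e"
    and ae: "AE x in M. (\<lambda>k. F k x) \<longlonglongrightarrow> f x"
  shows "integrable M (\<lambda>x. (norm (f x))\<^sup>2)"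
    and "(\<lambda>k. LINT x|M. (norm (F k x - f x))\<^sup>2) \<longlonglongrightarrow> 0"
proof -
  have diff_int: "integrable M (\<lambda>x. (norm (F i x - F j x))\<^sup>2)" for i j
    by (intro integrable_norm_power2_diff int) simp_all
  have *: "\<exists>N. \<forall>k\<ge>N. integrable M (\<lambda>x. (norm (F k x - f x))\<^sup>2) \<and> (LINT x|M. (norm (F k x - f x))\<^sup>2) \<le> e"
    if e: "0 < e" for e
  proof -
    obtain N where N: "\<And>i j. i \<ge> N \<Longrightarrow> j \<ge> N \<Longrightarrow> (LINT x|M. (norm (F i x - F j x))\<^sup>2) < e"
      using Cauchy[OF e] by blast
    show ?thesis
    proof (intro exI[of _ N] allI impI)
      fix k assume k: "N \<le> k"
      have conv: "AE x in M. (\<lambda>j. (norm (F k x - F (j + N) x))\<^sup>2) \<longlonglongrightarrow> (norm (F k x - f x))\<^sup>2"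
        using ae by eventually_elim (intro tendsto_intros LIMSEQ_ignore_initial_segment)
      show "integrable M (\<lambda>x. (norm (F k x - f x))\<^sup>2) \<and> (LINT x|M. (norm (F k x - f x))\<^sup>2) \<le> e"
        using Fatou_real[where F = "\<lambda>j x. (norm (F k x - F (j + N) x))\<^sup>2" and r = "\<lambda>_. e" and R = e,
            OF _ diff_int _ _ tendsto_const conv] less_imp_le[OF N[OF k]] by simp
    qed
  qed
  obtain N where "integrable M (\<lambda>x. (norm (F N x - f x))\<^sup>2)"
    using *[of 1] by auto
  \<comment> \<open>The limit is recovered as \<open>F N - (F N - f)\<close>, a difference of two
    square integrable functions.\<close>
  then have "integrable M (\<lambda>x. (norm (F N x - (F N x - f x)))\<^sup>2)"
    by (rule integrable_norm_power2_diff[OF _ _ int, rotated 2]) simp_all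
  moreover have "F N x - (F N x - f x) = f x" for x by simp
  ultimately show "integrable M (\<lambda>x. (norm (f x))\<^sup>2)" by (simp only:)
  show "(\<lambda>k. LINT x|M. (norm (F k x - f x))\<^sup>2) \<longlonglongrightarrow> 0"
  proof (rule LIMSEQ_I)
    fix e :: real assume "0 < e"
    then obtain N where N: "\<forall>k\<ge>N. (LINT x|M. (norm (F k x - f x))\<^sup>2) \<le> e / 2"
      using *[of "e / 2"] by auto
    have "norm ((LINT x|M. (norm (F k x - f x))\<^sup>2) - 0) < e" if "k \<ge> N" for k
    proof -
      have "(LINT x|M. (norm (F k x - f x))\<^sup>2) \<le> e / 2" using N that by blast
      moreover have "0 \<le> (LINT x|M. (norm (F k x - f x))\<^sup>2)" by simp
      ultimately show ?thesis using \<open>0 < e\<close> by simp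
    qed
    then show "\<exists>N. \<forall>k\<ge>N. norm ((LINT x|M. (norm (F k x - f x))\<^sup>2) - 0) < e" by blast
  qed
qed

lemma L2_inner_tendsto:
  fixes F :: "nat \<Rightarrow> 'a \<Rightarrow> 'b::euclidean_space"
  assumes [measurable]: "\<And>k. F k \<in> borel_measurable M" "f \<in> borel_measurable M" "g \<in> borel_measurable M"
    and F: "\<And>k. integrable M (\<lambda>x. (norm (F k x))\<^sup>2)"
    and f: "integrable M (\<lambda>x. (norm (f x))\<^sup>2)" and g: "integrable M (\<lambda>x. (norm (g x))\<^sup>2)"
    and lim: "(\<lambda>k. LINT x|M. (norm (F k x - f x))\<^sup>2) \<longlonglongrightarrow> 0"
  shows "(\<lambda>k. LINT x|M. F k x \<bullet> g x) \<longlonglongrightarrow> (LINT x|M. f x \<bullet> g x)"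
proof -
  have "(\<lambda>k. sqrt (LINT x|M. (norm (F k x - f x))\<^sup>2) * sqrt (LINT x|M. (norm (g x))\<^sup>2)) \<longlonglongrightarrow> sqrt 0 * sqrt (LINT x|M. (norm (g x))\<^sup>2)"
    by (intro tendsto_intros lim)
  then have lim0: "(\<lambda>k. sqrt (LINT x|M. (norm (F k x - f x))\<^sup>2) * sqrt (LINT x|M. (norm (g x))\<^sup>2)) \<longlonglongrightarrow> 0"
    by simp
  have "(\<lambda>k. (LINT x|M. F k x \<bullet> g x) - (LINT x|M. f x \<bullet> g x)) \<longlonglongrightarrow> 0"
  proof (rule tendsto_rabs_zero_cancel, rule tendsto_sandwich[OF _ _ tendsto_const lim0])
    show "\<forall>\<^sub>F k in sequentially. \<bar>(LINT x|M. F k x \<bullet> g x) - (LINT x|M. f x \<bullet> g x)\<bar>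
        \<le> sqrt (LINT x|M. (norm (F k x - f x))\<^sup>2) * sqrt (LINT x|M. (norm (g x))\<^sup>2)"
    proof (intro always_eventually allI)
      fix k
      have "(LINT x|M. F k x \<bullet> g x) - (LINT x|M. f x \<bullet> g x) = (LINT x|M. (F k x - f x) \<bullet> g x)"
        using L2_inner(1)[OF _ _ F g] L2_inner(1)[OF _ _ f g] by (simp add: inner_diff_left)
      then show "\<bar>(LINT x|M. F k x \<bullet> g x) - (LINT x|M. f x \<bullet> g x)\<bar>
          \<le> sqrt (LINT x|M. (norm (F k x - f x))\<^sup>2) * sqrt (LINT x|M. (norm (g x))\<^sup>2)"
        using L2_inner(2)[OF _ _ integrable_norm_power2_diff[OF _ _ F f] g] by simp
    qed
  qed simp
  then show ?thesis by (simp add: LIM_zero_iff)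
qed

text \<open>The counterpart of \<open>B_form\<close> with classical gradients; on test functions it
  involves no chosen representative.\<close>

definition energy :: "real \<Rightarrow> ('a::euclidean_space \<Rightarrow> real) \<Rightarrow> ('a \<Rightarrow> real) \<Rightarrow> real" where
  "energy s \<phi> \<psi> = (LINT x|lebesgue. gradient \<phi> x \<bullet> gradient \<psi> x) + gagliardo_form s \<phi> \<psi>"

context
  fixes s :: real
  assumes s: "0 < s" "s < 1" and dim: "2 \<le> DIM('a::euclidean_space)"
begin

lemma energy_eq:
  fixes \<phi> \<psi> :: "'a \<Rightarrow> real"
  assumes \<phi>: "\<phi> \<in> test_functions \<Omega>" and \<psi>: "\<psi> \<in> test_functions \<Omega>'"
  shows "energy s \<phi> \<psi> = (LINT x|lborel. gradient \<phi> x \<bullet> gradient \<psi> x)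
    + (LINT p|(lborel \<Otimes>\<^sub>M lborel). diff_quot s \<phi> p * diff_quot s \<psi> p)"
proof -
  note [measurable] = test_functions_measurable[OF \<phi>] test_functions_measurable[OF \<psi>]
  have "gagliardo_form s \<phi> \<psi> = (LINT p|(lborel \<Otimes>\<^sub>M lborel). diff_quot s \<phi> p * diff_quot s \<psi> p)"
    using diff_quot_test_function[OF s dim] \<phi> \<psi> by (intro gagliardo_form_eq) auto
  then show ?thesis by (simp add: energy_def integral_completion)
qed

lemma X12_norm_power2:
  fixes \<phi> :: "'a \<Rightarrow> real"
  assumes \<phi>: "\<phi> \<in> test_functions \<Omega>"
  shows "(X12_norm s \<phi>)\<^sup>2 = (LINT x|lborel. (norm (gradient \<phi> x))\<^sup>2)
    + (LINT p|(lborel \<Otimes>\<^sub>M lborel). (norm (diff_quot s \<phi> p))\<^sup>2)"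
proof -
  have "X12_norm s \<phi> = sqrt (energy s \<phi> \<phi>)"
    by (simp add: X12_norm_def energy_def power2_norm_eq_inner)
  moreover have "energy s \<phi> \<phi> = (LINT x|lborel. (norm (gradient \<phi> x))\<^sup>2)
    + (LINT p|(lborel \<Otimes>\<^sub>M lborel). (norm (diff_quot s \<phi> p))\<^sup>2)"
    unfolding energy_eq[OF \<phi> \<phi>] power2_norm_eq_inner by simp
  ultimately show ?thesis by simp
qed

lemma X12_norm_nonneg: "0 \<le> X12_norm s \<phi>" if "\<phi> \<in> test_functions \<Omega>" for \<phi> :: "'a \<Rightarrow> real"
proof -
  have "X12_norm s \<phi> = sqrt (energy s \<phi> \<phi>)"
    by (simp add: X12_norm_def energy_def power2_norm_eq_inner)
  moreover have "0 \<le> energy s \<phi> \<phi>"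
    unfolding energy_eq[OF that that] by (intro add_nonneg_nonneg integral_nonneg_AE) auto
  ultimately show ?thesis by simp
qed

lemma
  fixes \<phi> :: "'a \<Rightarrow> real"
  assumes \<phi>: "\<phi> \<in> test_functions \<Omega>"
  shows gradient_norm_le_X12_norm: "(LINT x|lborel. (norm (gradient \<phi> x))\<^sup>2) \<le> (X12_norm s \<phi>)\<^sup>2"
    and diff_quot_norm_le_X12_norm: "(LINT p|(lborel \<Otimes>\<^sub>M lborel). (norm (diff_quot s \<phi> p))\<^sup>2) \<le> (X12_norm s \<phi>)\<^sup>2"
  unfolding X12_norm_power2[OF \<phi>] by simp_all

lemma diff_quot_test_norm:
  fixes \<phi> :: "'a \<Rightarrow> real"
  assumes \<phi>: "\<phi> \<in> test_functions \<Omega>"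
  shows "integrable (lborel \<Otimes>\<^sub>M lborel) (\<lambda>p. (norm (diff_quot s \<phi> p))\<^sup>2)"
  using diff_quot_test_function[OF s dim \<phi>] by simp

lemma energy_diff:
  fixes \<phi> \<eta> \<psi> :: "'a \<Rightarrow> real"
  assumes \<phi>: "\<phi> \<in> test_functions \<Omega>" and \<eta>: "\<eta> \<in> test_functions \<Omega>" and \<psi>: "\<psi> \<in> test_functions \<Omega>'"
  shows "energy s (\<lambda>x. \<phi> x - \<eta> x) \<psi> = energy s \<phi> \<psi> - energy s \<eta> \<psi>"
proof -
  note [measurable] = test_functions_measurable[OF \<phi>] test_functions_measurable[OF \<psi>] test_functions_measurable[OF \<eta>]
  have "integrable lborel (\<lambda>x. gradient \<phi> x \<bullet> gradient \<psi> x)" "integrable lborel (\<lambda>x. gradient \<eta> x \<bullet> gradient \<psi> x)"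
    using \<phi> \<eta> \<psi> by (auto intro!: L2_inner(1) test_functions_gradient_square(2))
  moreover have "integrable (lborel \<Otimes>\<^sub>M lborel) (\<lambda>p. diff_quot s \<phi> p * diff_quot s \<psi> p)"
    "integrable (lborel \<Otimes>\<^sub>M lborel) (\<lambda>p. diff_quot s \<eta> p * diff_quot s \<psi> p)"
    using L2_inner(1)[OF _ _ diff_quot_test_norm[OF \<phi>] diff_quot_test_norm[OF \<psi>]]
      L2_inner(1)[OF _ _ diff_quot_test_norm[OF \<eta>] diff_quot_test_norm[OF \<psi>]] by simp_all
  ultimately show ?thesis
    unfolding energy_eq[OF test_functions_diff[OF \<phi> \<eta>] \<psi>] energy_eq[OF \<phi> \<psi>] energy_eq[OF \<eta> \<psi>]
    by (simp add: gradient_diff[OF \<phi> \<eta>] diff_quot_diff inner_diff_left left_diff_distrib)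
qed

text \<open>The Cauchy-Schwarz inequality is applied to the local and the nonlocal part separately,
  which accounts for the factor 2.\<close>

lemma energy_le:
  fixes \<phi> \<psi> :: "'a \<Rightarrow> real"
  assumes \<phi>: "\<phi> \<in> test_functions \<Omega>" and \<psi>: "\<psi> \<in> test_functions \<Omega>'"
  shows "\<bar>energy s \<phi> \<psi>\<bar> \<le> 2 * X12_norm s \<phi> * X12_norm s \<psi>"
proof -
  note [measurable] = test_functions_measurable[OF \<phi>] test_functions_measurable[OF \<psi>]
  note nn = X12_norm_nonneg[OF \<phi>] X12_norm_nonneg[OF \<psi>]
  have "\<bar>LINT x|lborel. gradient \<phi> x \<bullet> gradient \<psi> x\<bar>
      \<le> sqrt (LINT x|lborel. (norm (gradient \<phi> x))\<^sup>2) * sqrt (LINT x|lborel. (norm (gradient \<psi> x))\<^sup>2)"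
    using \<phi> \<psi> by (intro L2_inner(2) test_functions_gradient_square(2)) auto
  also have "\<dots> \<le> X12_norm s \<phi> * X12_norm s \<psi>"
    using gradient_norm_le_X12_norm[OF \<phi>] gradient_norm_le_X12_norm[OF \<psi>] nn
    by (intro mult_mono real_le_lsqrt) auto
  finally have 1: "\<bar>LINT x|lborel. gradient \<phi> x \<bullet> gradient \<psi> x\<bar> \<le> X12_norm s \<phi> * X12_norm s \<psi>" .
  have "\<bar>LINT p|(lborel \<Otimes>\<^sub>M lborel). diff_quot s \<phi> p * diff_quot s \<psi> p\<bar>
      \<le> sqrt (LINT p|(lborel \<Otimes>\<^sub>M lborel). (norm (diff_quot s \<phi> p))\<^sup>2) * sqrt (LINT p|(lborel \<Otimes>\<^sub>M lborel). (norm (diff_quot s \<psi> p))\<^sup>2)"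
    using L2_inner(2)[OF _ _ diff_quot_test_norm[OF \<phi>] diff_quot_test_norm[OF \<psi>]] by simp
  also have "\<dots> \<le> X12_norm s \<phi> * X12_norm s \<psi>"
    using diff_quot_norm_le_X12_norm[OF \<phi>] diff_quot_norm_le_X12_norm[OF \<psi>] nn
    by (intro mult_mono real_le_lsqrt) auto
  finally have 2: "\<bar>LINT p|(lborel \<Otimes>\<^sub>M lborel). diff_quot s \<phi> p * diff_quot s \<psi> p\<bar> \<le> X12_norm s \<phi> * X12_norm s \<psi>" .
  show ?thesis
    using 1 2 unfolding energy_eq[OF \<phi> \<psi>] by linarith
qed

end

section \<open>Null sets, Borel representatives and local integrability\<close>

lemma lebesgue_measurable_cong_AE:
  fixes f g :: "'a::euclidean_space \<Rightarrow> 'b::topological_space"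
  assumes g: "g \<in> borel_measurable lebesgue" and ae: "AE x in lebesgue. f x = g x"
  shows "f \<in> borel_measurable lebesgue"
proof (rule measurableI)
  fix A :: "'b set" assume A: "A \<in> sets borel"
  have "AE x in lebesgue. x \<in> g -` A \<inter> space lebesgue \<longleftrightarrow> x \<in> f -` A \<inter> space lebesgue"
    using ae by eventually_elim simp
  then show "f -` A \<inter> space lebesgue \<in> sets lebesgue"
    by (rule complete_measure.in_sets_AE[OF completion.complete_measure_axioms])
       (use measurable_sets[OF g A] in auto)
qed simp

text \<open>Elements of \<open>X12\<close> are only Lebesgue measurable, whereas Fubini's theorem is
  applied on the product of Borel measures; this lemma permits passage to a Borel representative.
  The inner integrals agree for almost every \<open>x\<close>, and completeness of
  \<open>lebesgue\<close> makes the inner integral for \<open>u\<close> measurable in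
  \<open>x\<close>.\<close>

lemma gagliardo_form_cong_AE:
  fixes u u' v :: "'a::euclidean_space \<Rightarrow> real"
  assumes u: "u \<in> borel_measurable lebesgue" and ae: "AE x in lebesgue. u x = u' x"
    and [measurable]: "u' \<in> borel_measurable borel" "v \<in> borel_measurable borel"
  shows "gagliardo_form s u v = gagliardo_form s u' v"
proof -
  define F where "F w x = (LINT y|lebesgue. (w x - w y) * (v x - v y) / norm (x - y) powr (real DIM('a) + 2 * s))" for w x
  have [measurable]: "u \<in> borel_measurable lebesgue" "u' \<in> borel_measurable lebesgue" "v \<in> borel_measurable lebesgue"
    using u by (auto intro: measurable_completion)
  have id_meas [measurable]: "(\<lambda>y. norm (x - y) powr (real DIM('a) + 2 * s)) \<in> borel_measurable lebesgue" for x :: 'a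
    by (intro measurable_completion) simp
  have AE_F: "AE x in lebesgue. F u x = F u' x"
    using ae
  proof eventually_elim
    case (elim x)
    show ?case
      unfolding F_def
    proof (rule integral_cong_AE)
      show "AE y in lebesgue. (u x - u y) * (v x - v y) / norm (x - y) powr (real DIM('a) + 2 * s)
          = (u' x - u' y) * (v x - v y) / norm (x - y) powr (real DIM('a) + 2 * s)"
        using ae by eventually_elim (simp add: elim)
    qed measurable
  qed
  have "F u' = (\<lambda>x. LINT y|lborel. (u' x - u' y) * (v x - v y) / norm (x - y) powr (real DIM('a) + 2 * s))"
    unfolding F_def by (intro ext integral_completion) measurable
  then have "F u' \<in> borel_measurable borel" by simp
  then have meas': "F u' \<in> borel_measurable lebesgue" by (intro measurable_completion) simp
  have "(LINT x|lebesgue. F u x) = (LINT x|lebesgue. F u' x)"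
    by (rule integral_cong_AE[OF lebesgue_measurable_cong_AE[OF meas' AE_F] meas' AE_F])
  then show ?thesis by (simp add: gagliardo_form_def F_def)
qed

lemma locally_integrable_measurable:
  fixes f :: "'a::euclidean_space \<Rightarrow> 'b::euclidean_space"
  assumes "locally_integrable f"
  shows "f \<in> borel_measurable lebesgue"
proof (rule borel_measurable_LIMSEQ_metric)
  show "(\<lambda>x. indicator (cball 0 (real k)) x *\<^sub>R f x) \<in> borel_measurable lebesgue" for k
    using assms unfolding locally_integrable_def set_integrable_def
    by (intro borel_measurable_integrable) simp
  show "(\<lambda>k. indicator (cball 0 (real k)) x *\<^sub>R f x) \<longlonglongrightarrow> f x" for x
  proof (rule tendsto_eventually)
    obtain N :: nat where "norm x \<le> real N" using real_arch_simple by blast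
    then show "\<forall>\<^sub>F k in sequentially. indicator (cball 0 (real k)) x *\<^sub>R f x = f x"
      by (intro eventually_sequentiallyI[of N]) simp
  qed
qed

lemma locally_integrable_L2:
  fixes f :: "'a::euclidean_space \<Rightarrow> 'b::euclidean_space"
  assumes [measurable]: "f \<in> borel_measurable lebesgue" and f: "integrable lebesgue (\<lambda>x. (norm (f x))\<^sup>2)"
  shows "locally_integrable f"
  unfolding locally_integrable_def set_integrable_def
proof (intro allI impI)
  fix K :: "'a set" assume K: "compact K"
  then have [measurable]: "K \<in> sets lebesgue" by (simp add: compact_imp_closed)
  have "integrable lebesgue (indicat_real K)"
    using K emeasure_compact_finite[OF K] by (intro integrable_real_indicator) (auto simp: compact_imp_closed)
  show "integrable lebesgue (\<lambda>x. indicator K x *\<^sub>R f x)"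
  proof (rule Bochner_Integration.integrable_bound)
    show "integrable lebesgue (\<lambda>x. indicat_real K x + (norm (f x))\<^sup>2)"
      using \<open>integrable lebesgue (indicat_real K)\<close> f by (rule Bochner_Integration.integrable_add)
    have "norm (f x) \<le> 1 + (norm (f x))\<^sup>2" for x
      using sum_squares_bound[of "norm (f x)" 1] norm_ge_zero[of "f x"] by (simp add: power2_eq_square; linarith)
    then show "AE x in lebesgue. norm (indicator K x *\<^sub>R f x) \<le> norm (indicat_real K x + (norm (f x))\<^sup>2)"
      by (intro AE_I2) (auto simp: indicator_def)
  qed measurable
qed

lemma AE_pair_both:
  fixes P :: "'a::euclidean_space \<Rightarrow> bool"
  assumes "AE x in lborel. P x"
  shows "AE p in lborel \<Otimes>\<^sub>M lborel. P (fst p) \<and> P (snd p)"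
proof -
  obtain N where N: "N \<in> null_sets lborel" "{x. \<not> P x} \<subseteq> N"
    using assms by (auto simp: eventually_ae_filter)
  then have [measurable]: "N \<in> sets borel" by auto
  have "N \<times> UNIV \<in> null_sets (lborel \<Otimes>\<^sub>M lborel)" "UNIV \<times> N \<in> null_sets (lborel \<Otimes>\<^sub>M lborel)"
    using N(1) by (auto simp: null_sets_def lborel.emeasure_pair_measure_Times)
  then have "N \<times> UNIV \<union> UNIV \<times> N \<in> null_sets (lborel \<Otimes>\<^sub>M lborel)"
    by (rule null_sets.Un)
  then show ?thesis
    by (rule AE_I') (use N(2) in auto)
qed

lemma test_functions_square_integrable:
  fixes \<phi> :: "'a::euclidean_space \<Rightarrow> real"
  assumes \<phi>: "\<phi> \<in> test_functions \<Omega>"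
  shows "integrable lebesgue (\<lambda>x. (norm (\<phi> x))\<^sup>2)"
    and "integrable lebesgue (\<lambda>x. (norm (gradient \<phi> x))\<^sup>2)"
    and "integrable lebesgue (gradient \<phi>)"
proof -
  obtain K where K: "compact K" "\<And>x. x \<notin> K \<Longrightarrow> \<phi> x = 0" "\<And>x. x \<notin> K \<Longrightarrow> gradient \<phi> x = 0"
    using test_functions_support[OF \<phi>] by metis
  show "integrable lebesgue (\<lambda>x. (norm (\<phi> x))\<^sup>2)"
    by (rule continuous_compact_support_integrable_lebesgue[OF _ K(1)])
       (use K(2) in \<open>auto intro!: continuous_intros test_functions_continuous[OF \<phi>]\<close>)
  show "integrable lebesgue (\<lambda>x. (norm (gradient \<phi> x))\<^sup>2)"
    by (rule continuous_compact_support_integrable_lebesgue[OF _ K(1)])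
       (use K(3) in \<open>auto intro!: continuous_intros test_functions_continuous_gradient[OF \<phi>]\<close>)
  show "integrable lebesgue (gradient \<phi>)"
    by (rule continuous_compact_support_integrable_lebesgue[OF test_functions_continuous_gradient[OF \<phi>] K(1) K(3)])
qed

lemma test_functions_measurable_lebesgue:
  assumes "\<phi> \<in> test_functions \<Omega>"
  shows "\<phi> \<in> borel_measurable lebesgue" "gradient \<phi> \<in> borel_measurable lebesgue"
  using test_functions_measurable[OF assms] by (auto intro: measurable_completion)

text \<open>Convergence in the mean gives almost everywhere convergence of a subsequence of the
  approximants. For the gradients the Cauchy property in L^2 is first weakened to L^1, which is
  possible as all supports lie in one ball. A further subsequence then converges almost everywhere
  and defines the candidate \<open>U\<close> for the weak gradient.\<close>

lemma X12_AE_approximation: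
  fixes u :: "'a::euclidean_space \<Rightarrow> real"
  assumes s: "0 < s" "s < 1" and dim: "2 \<le> DIM('a)" and \<Omega>: "bounded \<Omega>" and u: "u \<in> X12 s \<Omega>"
  obtains \<phi> U where "\<And>k. \<phi> k \<in> test_functions \<Omega>"
    and "\<And>e. 0 < e \<Longrightarrow> \<exists>N. \<forall>i\<ge>N. \<forall>j\<ge>N. X12_norm s (\<lambda>x. \<phi> i x - \<phi> j x) < e"
    and "AE x in lebesgue. (\<lambda>k. \<phi> k x) \<longlonglongrightarrow> u x"
    and "integrable lebesgue (\<lambda>x. (norm (u x))\<^sup>2)"
    and "(\<lambda>k. LINT x|lebesgue. (norm (\<phi> k x - u x))\<^sup>2) \<longlonglongrightarrow> 0"
    and "U \<in> borel_measurable lebesgue"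
    and "AE x in lebesgue. (\<lambda>k. gradient (\<phi> k) x) \<longlonglongrightarrow> U x"
proof -
  have um [measurable]: "u \<in> borel_measurable lebesgue" using u by (simp add: X12_def)
  obtain \<phi>0 where \<phi>0: "\<And>k. \<phi>0 k \<in> test_functions \<Omega>"
    and cauchy0: "\<And>e. 0 < e \<Longrightarrow> \<exists>N. \<forall>j\<ge>N. \<forall>k\<ge>N. X12_norm s (\<lambda>x. \<phi>0 j x - \<phi>0 k x) < e"
    and lim0: "(\<lambda>k. \<integral>\<^sup>+x. ennreal ((\<phi>0 k x - u x)\<^sup>2) \<partial>lebesgue) \<longlonglongrightarrow> 0"
    using u by (auto simp: X12_def)
  note \<phi>0m [measurable] = test_functions_measurable_lebesgue[OF \<phi>0]
  \<comment> \<open>Membership in \<open>X12\<close> only says that these extended integrals tend to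
    0. Discarding an initial segment makes all of them finite, so that Bochner integrals can be
    used.\<close>
  obtain N0 where N0: "\<And>k. k \<ge> N0 \<Longrightarrow> (\<integral>\<^sup>+x. ennreal ((\<phi>0 k x - u x)\<^sup>2) \<partial>lebesgue) < 1"
    using order_tendstoD(2)[OF lim0, of 1] by (auto simp: eventually_sequentially)
  define \<phi>1 where "\<phi>1 k = \<phi>0 (k + N0)" for k
  have int1: "integrable lebesgue (\<lambda>x. (\<phi>1 k x - u x)\<^sup>2)" for k
    unfolding \<phi>1_def using N0[of "k + N0"] by (intro integrableI_nonneg) (auto intro: less_trans)
  have lim1: "(\<lambda>k. LINT x|lebesgue. (\<phi>1 k x - u x)\<^sup>2) \<longlonglongrightarrow> 0"
  proof -
    have "(\<lambda>k. ennreal (LINT x|lebesgue. (\<phi>1 k x - u x)\<^sup>2)) \<longlonglongrightarrow> ennreal 0"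
      using LIMSEQ_ignore_initial_segment[OF lim0, of N0] nn_integral_eq_integral[OF int1]
      by (simp add: \<phi>1_def)
    then show ?thesis by (subst (asm) tendsto_ennreal_iff) auto
  qed
  obtain r1 :: "nat \<Rightarrow> nat" where r1: "strict_mono r1" "AE x in lebesgue. (\<lambda>k. (\<phi>1 (r1 k) x - u x)\<^sup>2) \<longlonglongrightarrow> 0"
    using tendsto_L1_AE_subseq[where u = "\<lambda>k x. (\<phi>1 k x - u x)\<^sup>2" and M = lebesgue, OF int1] lim1 by auto
  have ae1: "AE x in lebesgue. (\<lambda>k. \<phi>1 (r1 k) x) \<longlonglongrightarrow> u x"
    using r1(2)
  proof eventually_elim
    case (elim x)
    then have "(\<lambda>k. sqrt ((\<phi>1 (r1 k) x - u x)\<^sup>2)) \<longlonglongrightarrow> sqrt 0" by (rule tendsto_real_sqrt)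
    then have "(\<lambda>k. \<phi>1 (r1 k) x - u x) \<longlonglongrightarrow> 0" by (simp add: tendsto_rabs_zero_iff)
    then show ?case by (simp add: LIM_zero_iff)
  qed
  define \<phi>2 where "\<phi>2 k = \<phi>1 (r1 k)" for k
  have \<phi>2: "\<phi>2 k \<in> test_functions \<Omega>" for k by (simp add: \<phi>2_def \<phi>1_def \<phi>0)
  note [measurable] = test_functions_measurable_lebesgue[OF \<phi>2]
  have cauchy2: "\<exists>N. \<forall>j\<ge>N. \<forall>k\<ge>N. X12_norm s (\<lambda>x. \<phi>2 j x - \<phi>2 k x) < e" if e: "0 < e" for e
  proof -
    obtain N where N: "\<forall>j\<ge>N. \<forall>k\<ge>N. X12_norm s (\<lambda>x. \<phi>0 j x - \<phi>0 k x) < e"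
      using cauchy0[OF e] by blast
    have "N \<le> r1 j + N0" if "N \<le> j" for j using seq_suble[OF r1(1), of j] that by linarith
    then show ?thesis using N by (intro exI[of _ N]) (simp add: \<phi>2_def \<phi>1_def)
  qed
  obtain R where R: "\<Omega> \<subseteq> ball 0 R" using bounded_subset_ballD[OF \<Omega>] by blast
  define V where "V = sqrt (LINT x|lebesgue. (norm (indicat_real (ball (0::'a) R) x))\<^sup>2)"
  have V: "0 \<le> V" by (simp add: V_def)
  have ball_int: "integrable lebesgue (\<lambda>x. (norm (indicat_real (ball (0::'a) R) x))\<^sup>2)"
  proof -
    have "integrable lebesgue (indicat_real (ball (0::'a) R))"
      using emeasure_lborel_ball_finite[of "0::'a" R] by (intro integrable_real_indicator) auto
    moreover have "(norm (indicat_real (ball (0::'a) R) x))\<^sup>2 = indicat_real (ball 0 R) x" for x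
      by (auto simp: indicator_def)
    ultimately show ?thesis by (simp only:)
  qed
  \<comment> \<open>The Cauchy-Schwarz inequality against the indicator of a ball that contains
    \<open>\<Omega>\<close>.\<close>
  have L1: "(LINT x|lebesgue. norm (gradient (\<phi>2 i) x - gradient (\<phi>2 j) x)) \<le> X12_norm s (\<lambda>x. \<phi>2 i x - \<phi>2 j x) * V" for i j
  proof -
    define d where "d x = \<phi>2 i x - \<phi>2 j x" for x
    have d: "d \<in> test_functions \<Omega>" unfolding d_def by (intro test_functions_diff \<phi>2)
    have gd: "gradient d x = gradient (\<phi>2 i) x - gradient (\<phi>2 j) x" for x
      unfolding d_def by (rule gradient_diff[OF \<phi>2 \<phi>2])
    obtain K where K: "K \<subseteq> \<Omega>" "\<And>x. x \<notin> K \<Longrightarrow> gradient d x = 0"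
      using test_functions_support[OF d] by metis
    note [measurable] = test_functions_measurable_lebesgue[OF d]
    have "norm (gradient d x) * indicat_real (ball 0 R) x = norm (gradient d x)" for x
    proof (cases "x \<in> ball 0 R")
      case False
      then have "x \<notin> K" using K(1) R by blast
      then show ?thesis by (simp add: K(2))
    qed simp
    then have "(LINT x|lebesgue. norm (gradient d x)) = (LINT x|lebesgue. norm (gradient d x) \<bullet> indicat_real (ball 0 R) x)"
      by (simp only: inner_real_def)
    also have "\<dots> \<le> sqrt (LINT x|lebesgue. (norm (norm (gradient d x)))\<^sup>2) * V"
      unfolding V_def using test_functions_square_integrable(2)[OF d] ball_int
      by (intro order_trans[OF abs_ge_self L2_inner(2)] borel_measurable_indicator) auto
    also have "(LINT x|lebesgue. (norm (norm (gradient d x)))\<^sup>2) = (LINT x|lborel. (norm (gradient d x))\<^sup>2)"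
      using test_functions_measurable[OF d] by (simp add: integral_completion)
    also have "sqrt \<dots> * V \<le> X12_norm s d * V"
      using gradient_norm_le_X12_norm[OF s dim d] X12_norm_nonneg[OF s dim d] V
      by (intro mult_right_mono real_le_lsqrt) auto
    finally have "(LINT x|lebesgue. norm (gradient d x)) \<le> X12_norm s d * V" .
    moreover have "d = (\<lambda>x. \<phi>2 i x - \<phi>2 j x)" by (simp add: d_def fun_eq_iff)
    ultimately show ?thesis unfolding gd by simp
  qed
  obtain r2 where r2: "strict_mono r2" "AE x in lebesgue. Cauchy (\<lambda>k. gradient (\<phi>2 (r2 k)) x)"
  proof (rule cauchy_L1_AE_cauchy_subseq[of lebesgue "\<lambda>k. gradient (\<phi>2 k)"])
    show "integrable lebesgue (gradient (\<phi>2 k))" for k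
      by (rule test_functions_square_integrable(3)[OF \<phi>2])
    \<comment> \<open>The denominator \<open>V + 1\<close> keeps the quotient meaningful and
      \<open>e / (V + 1) * V\<close> strictly below \<open>e\<close>, whatever the value of
      \<open>V\<close>.\<close>
    fix e :: real assume e: "0 < e"
    then obtain N where N: "\<forall>j\<ge>N. \<forall>k\<ge>N. X12_norm s (\<lambda>x. \<phi>2 j x - \<phi>2 k x) < e / (V + 1)"
      using cauchy2[of "e / (V + 1)"] V by auto
    have "(LINT x|lebesgue. norm (gradient (\<phi>2 i) x - gradient (\<phi>2 j) x)) < e" if "N \<le> i" "N \<le> j" for i j
    proof -
      have "X12_norm s (\<lambda>x. \<phi>2 i x - \<phi>2 j x) * V \<le> e / (V + 1) * V"
        using N that V less_imp_le by (intro mult_right_mono) blast+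
      also have "\<dots> < e" using e V by (simp add: field_simps)
      finally show ?thesis using L1[of i j] by linarith
    qed
    then show "\<exists>N. \<forall>i\<ge>N. \<forall>j\<ge>N. (LINT x|lebesgue. norm (gradient (\<phi>2 i) x - gradient (\<phi>2 j) x)) < e"
      by blast
  qed blast
  define U where "U x = lim (\<lambda>k. gradient (\<phi>2 (r2 k)) x)" for x
  show ?thesis
  proof (rule that[of "\<lambda>k. \<phi>2 (r2 k)" U])
    show "\<phi>2 (r2 k) \<in> test_functions \<Omega>" for k by (rule \<phi>2)
    show "\<exists>N. \<forall>i\<ge>N. \<forall>j\<ge>N. X12_norm s (\<lambda>x. \<phi>2 (r2 i) x - \<phi>2 (r2 j) x) < e" if "0 < e" for e
      using cauchy2[OF that] seq_suble[OF r2(1)] by (meson order_trans)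
    show "AE x in lebesgue. (\<lambda>k. \<phi>2 (r2 k) x) \<longlonglongrightarrow> u x"
      using ae1 unfolding \<phi>2_def
      by eventually_elim (rule LIMSEQ_subseq_LIMSEQ[OF _ r2(1), unfolded comp_def])
    have "integrable lebesgue (\<lambda>x. (norm (\<phi>1 0 x - (\<phi>1 0 x - u x)))\<^sup>2)"
    proof (rule integrable_norm_power2_diff)
      show "integrable lebesgue (\<lambda>x. (norm (\<phi>1 0 x))\<^sup>2)"
        unfolding \<phi>1_def by (rule test_functions_square_integrable(1)[OF \<phi>0])
    qed (use int1[of 0] in \<open>simp_all add: \<phi>1_def\<close>)
    moreover have "\<phi>1 0 x - (\<phi>1 0 x - u x) = u x" for x by simp
    ultimately show "integrable lebesgue (\<lambda>x. (norm (u x))\<^sup>2)" by (simp only:)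
    show "(\<lambda>k. LINT x|lebesgue. (norm (\<phi>2 (r2 k) x - u x))\<^sup>2) \<longlonglongrightarrow> 0"
      using LIMSEQ_subseq_LIMSEQ[OF LIMSEQ_subseq_LIMSEQ[OF lim1 r1(1)] r2(1)]
      by (simp add: comp_def \<phi>2_def)
    show "U \<in> borel_measurable lebesgue"
      unfolding U_def by (rule borel_measurable_lim_metric) measurable
    show "AE x in lebesgue. (\<lambda>k. gradient (\<phi>2 (r2 k)) x) \<longlonglongrightarrow> U x"
      using r2(2) unfolding U_def
      by eventually_elim (simp add: Cauchy_convergent_iff convergent_LIMSEQ_iff)
  qed
qed

text \<open>For fixed \<open>\<psi>\<close> both parts of the energy are L^2 inner products,
  continuous under L^2 limits. The gradients converge to \<open>U\<close>, which is shown to be a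
  weak gradient of \<open>u\<close> and thus agrees almost everywhere with the chosen one; the
  difference quotients converge to those of a Borel representative of \<open>u\<close>.\<close>

lemma X12_approximation:
  fixes u :: "'a::euclidean_space \<Rightarrow> real"
  assumes s: "0 < s" "s < 1" and dim: "2 \<le> DIM('a)" and \<Omega>: "bounded \<Omega>" and u: "u \<in> X12 s \<Omega>"
  obtains \<phi> where "\<And>k. \<phi> k \<in> test_functions \<Omega>"
    and "\<And>e. 0 < e \<Longrightarrow> \<exists>N. \<forall>i\<ge>N. \<forall>j\<ge>N. X12_norm s (\<lambda>x. \<phi> i x - \<phi> j x) < e"
    and "AE x in lebesgue. (\<lambda>k. \<phi> k x) \<longlonglongrightarrow> u x"
    and "\<And>\<psi>. \<psi> \<in> test_functions \<Omega> \<Longrightarrow> (\<lambda>k. energy s (\<phi> k) \<psi>) \<longlonglongrightarrow> B_form s u \<psi>"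
proof -
  obtain \<phi> U where \<phi>: "\<And>k. \<phi> k \<in> test_functions \<Omega>"
    and cauchy: "\<And>e. 0 < e \<Longrightarrow> \<exists>N. \<forall>i\<ge>N. \<forall>j\<ge>N. X12_norm s (\<lambda>x. \<phi> i x - \<phi> j x) < e"
    and ae: "AE x in lebesgue. (\<lambda>k. \<phi> k x) \<longlonglongrightarrow> u x"
    and u2: "integrable lebesgue (\<lambda>x. (norm (u x))\<^sup>2)"
    and lim: "(\<lambda>k. LINT x|lebesgue. (norm (\<phi> k x - u x))\<^sup>2) \<longlonglongrightarrow> 0"
    and Um [measurable]: "U \<in> borel_measurable lebesgue"
    and Uae: "AE x in lebesgue. (\<lambda>k. gradient (\<phi> k) x) \<longlonglongrightarrow> U x"
    using X12_AE_approximation[OF assms] by blast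
  have um [measurable]: "u \<in> borel_measurable lebesgue" using u by (simp add: X12_def)
  note [measurable] = test_functions_measurable_lebesgue[OF \<phi>]
  note \<phi>b = test_functions_measurable[OF \<phi>]
  have cauchy_sq: "\<exists>N. \<forall>i\<ge>N. \<forall>j\<ge>N. (X12_norm s (\<lambda>x. \<phi> i x - \<phi> j x))\<^sup>2 < e" if e: "0 < e" for e
  proof -
    obtain N where N: "\<forall>i\<ge>N. \<forall>j\<ge>N. X12_norm s (\<lambda>x. \<phi> i x - \<phi> j x) < sqrt e"
      using cauchy[of "sqrt e"] e by auto
    have "(X12_norm s (\<lambda>x. \<phi> i x - \<phi> j x))\<^sup>2 < e" if "N \<le> i" "N \<le> j" for i j
    proof -
      have "(X12_norm s (\<lambda>x. \<phi> i x - \<phi> j x))\<^sup>2 < (sqrt e)\<^sup>2"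
        using N that X12_norm_nonneg[OF s dim test_functions_diff[OF \<phi> \<phi>]]
        by (intro power_strict_mono) auto
      then show ?thesis using \<open>0 < e\<close> by simp
    qed
    then show ?thesis by blast
  qed
  have grad_cauchy: "\<exists>N. \<forall>i\<ge>N. \<forall>j\<ge>N. (LINT x|lebesgue. (norm (gradient (\<phi> i) x - gradient (\<phi> j) x))\<^sup>2) < e" if "0 < e" for e
  proof -
    have "(LINT x|lebesgue. (norm (gradient (\<phi> i) x - gradient (\<phi> j) x))\<^sup>2) \<le> (X12_norm s (\<lambda>x. \<phi> i x - \<phi> j x))\<^sup>2" for i j
      using gradient_norm_le_X12_norm[OF s dim test_functions_diff[OF \<phi>[of i] \<phi>[of j]]] \<phi>b
      by (simp add: gradient_diff[OF \<phi> \<phi>] integral_completion)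
    then show ?thesis using cauchy_sq[OF that] by (meson le_less_trans)
  qed
  note U_lim = L2_limit[OF _ Um test_functions_square_integrable(2)[OF \<phi>] grad_cauchy Uae]
  have U2: "integrable lebesgue (\<lambda>x. (norm (U x))\<^sup>2)"
    and U_lim: "(\<lambda>k. LINT x|lebesgue. (norm (gradient (\<phi> k) x - U x))\<^sup>2) \<longlonglongrightarrow> 0"
    using U_lim by simp_all
  have "has_weak_gradient u U"
    unfolding has_weak_gradient_def
  proof (intro conjI ballI locally_integrable_L2 u2 U2 um Um)
    fix \<psi> :: "'a \<Rightarrow> real" assume \<psi>: "\<psi> \<in> test_functions UNIV"
    note [measurable] = test_functions_measurable_lebesgue[OF \<psi>]
    note \<psi>2 = test_functions_square_integrable[OF \<psi>]
    have int1: "integrable lebesgue (\<lambda>x. u x *\<^sub>R gradient \<psi> x)"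
    proof (rule Bochner_Integration.integrable_bound)
      show "integrable lebesgue (\<lambda>x. norm (u x) \<bullet> norm (gradient \<psi> x))"
        by (rule L2_inner(1)) (use u2 \<psi>2 in auto)
      show "(\<lambda>x. u x *\<^sub>R gradient \<psi> x) \<in> borel_measurable lebesgue" by measurable
    qed simp
    have int2: "integrable lebesgue (\<lambda>x. \<psi> x *\<^sub>R U x)"
    proof (rule Bochner_Integration.integrable_bound)
      show "integrable lebesgue (\<lambda>x. norm (\<psi> x) \<bullet> norm (U x))"
        by (rule L2_inner(1)) (use U2 \<psi>2 in auto)
      show "(\<lambda>x. \<psi> x *\<^sub>R U x) \<in> borel_measurable lebesgue" by measurable
    qed simp
    show "(LINT x|lebesgue. u x *\<^sub>R gradient \<psi> x) = - (LINT x|lebesgue. \<psi> x *\<^sub>R U x)"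
    \<comment> \<open>The identity is passed to the limit in each coordinate, where both sides are
      L^2 inner products with a fixed function.\<close>
    proof (rule euclidean_eqI)
      fix b :: 'a assume b: "b \<in> Basis"
      have gb: "integrable lebesgue (\<lambda>x. (norm (gradient \<psi> x \<bullet> b))\<^sup>2)"
        using test_functions_square_integrable(1)[OF test_functions_partial_derivative[OF \<psi> b]] .
      have pb: "integrable lebesgue (\<lambda>x. (norm (\<psi> x *\<^sub>R b))\<^sup>2)"
        using \<psi>2(1) b by simp
      have "(\<lambda>k. LINT x|lebesgue. \<phi> k x \<bullet> (gradient \<psi> x \<bullet> b)) \<longlonglongrightarrow> (LINT x|lebesgue. u x \<bullet> (gradient \<psi> x \<bullet> b))"
        by (intro L2_inner_tendsto test_functions_square_integrable(1)[OF \<phi>] u2 gb lim) measurable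
      moreover have "(\<lambda>k. - (LINT x|lebesgue. gradient (\<phi> k) x \<bullet> (\<psi> x *\<^sub>R b))) \<longlonglongrightarrow> - (LINT x|lebesgue. U x \<bullet> (\<psi> x *\<^sub>R b))"
        by (intro tendsto_minus L2_inner_tendsto test_functions_square_integrable(2)[OF \<phi>] U2 pb U_lim) measurable
      moreover have "(LINT x|lebesgue. \<phi> k x \<bullet> (gradient \<psi> x \<bullet> b)) = - (LINT x|lebesgue. gradient (\<phi> k) x \<bullet> (\<psi> x *\<^sub>R b))" for k
      proof -
        have "(LINT x|lebesgue. \<phi> k x *\<^sub>R gradient \<psi> x) \<bullet> b = - ((LINT x|lebesgue. \<psi> x *\<^sub>R gradient (\<phi> k) x) \<bullet> b)"
          by (simp add: test_functions_integration_by_parts(2)[OF \<phi> \<psi>])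
        then show ?thesis
          using test_functions_integration_by_parts(1)[OF \<phi> \<psi>] test_functions_integration_by_parts(1)[OF \<psi> \<phi>]
          by (simp flip: integral_inner_left)
      qed
      ultimately have "(LINT x|lebesgue. u x \<bullet> (gradient \<psi> x \<bullet> b)) = - (LINT x|lebesgue. U x \<bullet> (\<psi> x *\<^sub>R b))"
        using LIMSEQ_unique by simp
      then show "(LINT x|lebesgue. u x *\<^sub>R gradient \<psi> x) \<bullet> b = - (LINT x|lebesgue. \<psi> x *\<^sub>R U x) \<bullet> b"
        using int1 int2 by (simp flip: integral_inner_left)
    qed
  qed
  then have wg: "AE x in lebesgue. weak_gradient u x = U x"
    and wgm: "weak_gradient u \<in> borel_measurable lebesgue"
    using weak_gradient_AE_eq[of u U] has_weak_gradient_weak_gradient[of u U] locally_integrable_measurable[of "weak_gradient u"]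
    by (auto simp: has_weak_gradient_def)
  obtain u' where u' [measurable]: "u' \<in> borel_measurable borel" and uu': "AE x in lborel. u x = u' x"
    using completion_ex_borel_measurable_real[of u lborel] um by auto
  have ae': "AE x in lborel. (\<lambda>k. \<phi> k x) \<longlonglongrightarrow> u' x"
    using ae[unfolded AE_completion_iff] uu' by eventually_elim simp
  have dq_ae: "AE p in lborel \<Otimes>\<^sub>M lborel. (\<lambda>k. diff_quot s (\<phi> k) p) \<longlonglongrightarrow> diff_quot s u' p"
    using AE_pair_both[OF ae'] unfolding diff_quot_def divide_inverse
    by eventually_elim (elim conjE, intro tendsto_mult tendsto_diff tendsto_const)
  have dq_cauchy: "\<exists>N. \<forall>i\<ge>N. \<forall>j\<ge>N. (LINT p|(lborel \<Otimes>\<^sub>M lborel). (norm (diff_quot s (\<phi> i) p - diff_quot s (\<phi> j) p))\<^sup>2) < e" if "0 < e" for e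
    using cauchy_sq[OF that] diff_quot_norm_le_X12_norm[OF s dim test_functions_diff[OF \<phi> \<phi>]]
    unfolding diff_quot_diff by (meson le_less_trans)
  have dqm: "diff_quot s (\<phi> k) \<in> borel_measurable (lborel \<Otimes>\<^sub>M lborel)" "diff_quot s u' \<in> borel_measurable (lborel \<Otimes>\<^sub>M lborel)" for k
    using \<phi>b(1) by simp_all
  have dq: "integrable (lborel \<Otimes>\<^sub>M lborel) (\<lambda>p. (norm (diff_quot s u' p))\<^sup>2)"
    "(\<lambda>k. LINT p|(lborel \<Otimes>\<^sub>M lborel). (norm (diff_quot s (\<phi> k) p - diff_quot s u' p))\<^sup>2) \<longlonglongrightarrow> 0"
    using L2_limit[OF dqm diff_quot_test_norm[OF s dim \<phi>] dq_cauchy dq_ae] by simp_all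
  show ?thesis
  proof (rule that[OF \<phi> cauchy ae])
    fix \<psi> assume \<psi>: "\<psi> \<in> test_functions \<Omega>"
    note [measurable] = test_functions_measurable_lebesgue[OF \<psi>] test_functions_measurable[OF \<psi>]
    have wg\<psi>: "AE x in lebesgue. weak_gradient \<psi> x = gradient \<psi> x"
      by (rule weak_gradient_AE_eq[OF has_weak_gradient_test_function[OF \<psi>]])
    have wg\<psi>m: "weak_gradient \<psi> \<in> borel_measurable lebesgue"
      using has_weak_gradient_weak_gradient[OF has_weak_gradient_test_function[OF \<psi>]]
      by (auto simp: has_weak_gradient_def intro: locally_integrable_measurable)
    have "(LINT x|lebesgue. weak_gradient u x \<bullet> weak_gradient \<psi> x) = (LINT x|lebesgue. U x \<bullet> gradient \<psi> x)"
    proof (rule integral_cong_AE)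
      show "AE x in lebesgue. weak_gradient u x \<bullet> weak_gradient \<psi> x = U x \<bullet> gradient \<psi> x"
        using wg wg\<psi> by eventually_elim simp
    qed (use wgm wg\<psi>m in measurable)
    moreover have "(\<lambda>k. LINT x|lebesgue. gradient (\<phi> k) x \<bullet> gradient \<psi> x) \<longlonglongrightarrow> (LINT x|lebesgue. U x \<bullet> gradient \<psi> x)"
      by (intro L2_inner_tendsto test_functions_square_integrable(2)[OF \<phi>] test_functions_square_integrable(2)[OF \<psi>] U2 U_lim) measurable
    moreover have "(\<lambda>k. gagliardo_form s (\<phi> k) \<psi>) \<longlonglongrightarrow> gagliardo_form s u \<psi>"
    proof -
      have "gagliardo_form s (\<phi> k) \<psi> = (LINT p|(lborel \<Otimes>\<^sub>M lborel). diff_quot s (\<phi> k) p \<bullet> diff_quot s \<psi> p)" for k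
        using diff_quot_test_function[OF s dim \<phi>] diff_quot_test_function[OF s dim \<psi>] \<phi>b(1)
        by (subst gagliardo_form_eq) auto
      moreover have "gagliardo_form s u \<psi> = (LINT p|(lborel \<Otimes>\<^sub>M lborel). diff_quot s u' p \<bullet> diff_quot s \<psi> p)"
        using gagliardo_form_cong_AE[OF um AE_completion[OF uu'] u', of \<psi> s]
          gagliardo_form_eq[of u' \<psi> s] dq(1) diff_quot_test_function[OF s dim \<psi>] by simp
      moreover have "(\<lambda>k. LINT p|(lborel \<Otimes>\<^sub>M lborel). diff_quot s (\<phi> k) p \<bullet> diff_quot s \<psi> p) \<longlonglongrightarrow> (LINT p|(lborel \<Otimes>\<^sub>M lborel). diff_quot s u' p \<bullet> diff_quot s \<psi> p)"
        by (intro L2_inner_tendsto dqm diff_quot_test_norm[OF s dim \<phi>] diff_quot_test_norm[OF s dim \<psi>] dq) measurable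
      ultimately show ?thesis by simp
    qed
    ultimately show "(\<lambda>k. energy s (\<phi> k) \<psi>) \<longlonglongrightarrow> B_form s u \<psi>"
      unfolding energy_def B_form_def by (auto intro: tendsto_add)
  qed
qed

section \<open>Smooth truncations\<close>

text \<open>A smooth approximation of \<open>max 0 (t - \<kappa>)\<close>: the bound \<open>1 + x \<le> exp x\<close> makes its
  derivative lie between 0 and 1.\<close>

definition trunc :: "real \<Rightarrow> real \<Rightarrow> real \<Rightarrow> real" where
  "trunc \<kappa> \<epsilon> t = (t - \<kappa>) * flat 1 ((t - \<kappa>) / \<epsilon>)"

lemma Ck_trunc: "Ck k (trunc \<kappa> \<epsilon>)"
proof -
  have id: "Ck k (\<lambda>t::real. t)" using Ck_inner_left[of k "1::real"] by simp
  have "Ck k (\<lambda>t. flat 1 ((1 / \<epsilon>) * (t - \<kappa>)))"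
    by (rule Ck_compose[OF Ck_flat]) (intro Ck_cmult Ck_diff id Ck_const)
  then show ?thesis
    unfolding trunc_def[abs_def]
    using Ck_mult[OF Ck_diff[OF id Ck_const[of k \<kappa>]], of "\<lambda>t. flat 1 ((1 / \<epsilon>) * (t - \<kappa>))"] by simp
qed

text \<open>In terms of \<open>y = (t - \<kappa>) / \<epsilon>\<close> the derivative is
  \<open>(1 + 1 / y) * exp (- (1 / y))\<close> for positive \<open>y\<close>: the scale
  \<open>\<epsilon>\<close> cancels, so the bounds do not depend on it.\<close>

lemma trunc_has_derivative:
  assumes "0 < \<epsilon>"
  obtains d where "\<And>t. (trunc \<kappa> \<epsilon> has_real_derivative d t) (at t)" "\<And>t. 0 \<le> d t" "\<And>t. d t \<le> 1"
proof -
  define y where "y t = (t - \<kappa>) / \<epsilon>" for t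
  define d where "d t = flat 1 (y t) + y t * flat (monom 1 2) (y t)" for t
  have "((\<lambda>t. (t - \<kappa>) * flat 1 ((t - \<kappa>) / \<epsilon>)) has_real_derivative
      (1 * flat 1 ((t - \<kappa>) / \<epsilon>) + flat (monom 1 2 * (1 - pderiv 1)) ((t - \<kappa>) / \<epsilon>) * (1 / \<epsilon>) * (t - \<kappa>))) (at t)" for t
  proof (rule DERIV_mult)
    show "((\<lambda>t. t - \<kappa>) has_real_derivative 1) (at t)"
      by (auto intro!: derivative_eq_intros)
    have "((\<lambda>t. (t - \<kappa>) / \<epsilon>) has_real_derivative 1 / \<epsilon>) (at t)"
      using assms by (auto intro!: derivative_eq_intros)
    then show "((\<lambda>t. flat 1 ((t - \<kappa>) / \<epsilon>)) has_real_derivative flat (monom 1 2 * (1 - pderiv 1)) ((t - \<kappa>) / \<epsilon>) * (1 / \<epsilon>)) (at t)"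
      by (rule DERIV_chain2[OF flat_has_derivative])
  qed
  moreover have "1 * flat 1 ((t - \<kappa>) / \<epsilon>) + flat (monom 1 2 * (1 - pderiv 1)) ((t - \<kappa>) / \<epsilon>) * (1 / \<epsilon>) * (t - \<kappa>) = d t" for t
    by (simp add: d_def y_def pderiv_1)
  ultimately have "(trunc \<kappa> \<epsilon> has_real_derivative d t) (at t)" for t
    by (simp add: trunc_def[abs_def])
  moreover have "0 \<le> d t \<and> d t \<le> 1" for t
  proof (cases "0 < y t")
    case True
    have "d t = (1 + 1 / y t) * exp (- (1 / y t))"
      using True by (simp add: d_def flat_def poly_monom power2_eq_square field_simps)
    moreover have "(1 + 1 / y t) * exp (- (1 / y t)) \<le> exp (1 / y t) * exp (- (1 / y t))"
      by (intro mult_right_mono exp_ge_add_one_self) simp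
    moreover have "exp (1 / y t) * exp (- (1 / y t)) = 1"
      by (simp add: exp_minus)
    ultimately show ?thesis using True by simp
  qed (simp add: d_def flat_def)
  ultimately show ?thesis using that by blast
qed

lemma trunc_0: "0 \<le> \<kappa> \<Longrightarrow> 0 < \<epsilon> \<Longrightarrow> trunc \<kappa> \<epsilon> 0 = 0"
  by (auto simp: trunc_def flat_def divide_less_0_iff)

text \<open>Above \<open>\<kappa>\<close> the error is
  \<open>(t - \<kappa>) * (1 - exp (- (\<epsilon> / (t - \<kappa>))))\<close>, and
  \<open>1 - exp (- x) \<le> x\<close> cancels the factor \<open>t - \<kappa>\<close>. The bound is
  uniform in \<open>t\<close>, so truncations of approximants can be compared without control on
  their size.\<close>

lemma trunc_approx:
  assumes "0 < \<epsilon>"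
  shows "\<bar>trunc \<kappa> \<epsilon> t - max 0 (t - \<kappa>)\<bar> \<le> \<epsilon>"
proof (cases "\<kappa> < t")
  case True
  have "1 - exp (- (\<epsilon> / (t - \<kappa>))) \<le> \<epsilon> / (t - \<kappa>)"
    using exp_ge_add_one_self[of "- (\<epsilon> / (t - \<kappa>))"] by simp
  then have "(t - \<kappa>) * (1 - exp (- (\<epsilon> / (t - \<kappa>)))) \<le> (t - \<kappa>) * (\<epsilon> / (t - \<kappa>))"
    using True by (intro mult_left_mono) auto
  moreover have "exp (- (\<epsilon> / (t - \<kappa>))) \<le> 1" using True assms by simp
  then have "0 \<le> (t - \<kappa>) * (1 - exp (- (\<epsilon> / (t - \<kappa>))))"
    using True by (intro mult_nonneg_nonneg) auto
  moreover have "(t - \<kappa>) * (\<epsilon> / (t - \<kappa>)) = \<epsilon>" using True by simp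
  moreover have "max 0 (t - \<kappa>) - trunc \<kappa> \<epsilon> t = (t - \<kappa>) * (1 - exp (- (\<epsilon> / (t - \<kappa>))))"
    using True assms by (simp add: trunc_def flat_def right_diff_distrib)
  ultimately show ?thesis by linarith
next
  case False
  then have "\<not> 0 < (t - \<kappa>) / \<epsilon>" using assms by (simp add: divide_le_0_iff not_less)
  then show ?thesis using False assms by (simp add: trunc_def flat_def)
qed

lemma monotone_Lipschitz_if_derivative:
  fixes G :: "real \<Rightarrow> real"
  assumes d: "\<And>t. (G has_real_derivative d t) (at t)" "\<And>t. 0 \<le> d t" "\<And>t. d t \<le> 1"
  shows "0 \<le> (x - y) * (G x - G y)" "\<bar>G x - G y\<bar> \<le> \<bar>x - y\<bar>"
proof -
  have *: "0 \<le> G b - G a \<and> G b - G a \<le> b - a" if ab: "a < b" for a b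
  proof -
    obtain z where "G b - G a = (b - a) * d z"
      using MVT2[OF ab, of G d] d(1) by blast
    then show ?thesis
      using ab d(2,3)[of z] mult_left_le[of "d z" "b - a"] by simp
  qed
  show "0 \<le> (x - y) * (G x - G y)" "\<bar>G x - G y\<bar> \<le> \<bar>x - y\<bar>"
    using *[of x y] *[of y x]
    by (cases x y rule: linorder_cases; auto intro: mult_nonpos_nonpos)+
qed

text \<open>The second inequality is a contraction property: the bounds on the derivative shrink the
  gradient and every difference quotient pointwise. It keeps the truncated approximants bounded in
  norm.\<close>

lemma energy_compose:
  fixes \<phi> :: "'a::euclidean_space \<Rightarrow> real"
  assumes s: "0 < s" "s < 1" and dim: "2 \<le> DIM('a)" and \<phi>: "\<phi> \<in> test_functions \<Omega>"
    and G: "\<And>k. Ck k G" "G 0 = 0"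
    and d: "\<And>t. (G has_real_derivative d t) (at t)" "\<And>t. 0 \<le> d t" "\<And>t. d t \<le> 1"
  shows "(LINT x|lborel. (norm (gradient (\<lambda>x. G (\<phi> x)) x))\<^sup>2) \<le> energy s \<phi> (\<lambda>x. G (\<phi> x))"
    and "X12_norm s (\<lambda>x. G (\<phi> x)) \<le> X12_norm s \<phi>"
proof -
  define \<psi> where "\<psi> x = G (\<phi> x)" for x
  have \<psi>: "\<psi> \<in> test_functions \<Omega>"
    unfolding \<psi>_def by (rule test_functions_compose[OF \<phi> G])
  have g\<psi>: "gradient \<psi> x = d (\<phi> x) *\<^sub>R gradient \<phi> x" for x
    unfolding \<psi>_def[abs_def] by (rule gradient_compose[OF \<phi> d(1)])
  note [measurable] = test_functions_measurable[OF \<phi>] test_functions_measurable[OF \<psi>]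
  note L = monotone_Lipschitz_if_derivative[OF d]
  have "(LINT x|lborel. (norm (gradient \<psi> x))\<^sup>2) \<le> (LINT x|lborel. gradient \<phi> x \<bullet> gradient \<psi> x)"
  proof (rule integral_mono)
    show "integrable lborel (\<lambda>x. (norm (gradient \<psi> x))\<^sup>2)"
      by (rule test_functions_gradient_square(2)[OF \<psi>])
    show "integrable lborel (\<lambda>x. gradient \<phi> x \<bullet> gradient \<psi> x)"
      by (rule L2_inner(1)) (simp_all add: test_functions_gradient_square(2)[OF \<phi>] test_functions_gradient_square(2)[OF \<psi>])
    show "(norm (gradient \<psi> x))\<^sup>2 \<le> gradient \<phi> x \<bullet> gradient \<psi> x" for x
    proof -
      have "(norm (gradient \<psi> x))\<^sup>2 = d (\<phi> x) * (d (\<phi> x) * (gradient \<phi> x \<bullet> gradient \<phi> x))"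
        unfolding g\<psi> power2_norm_eq_inner by simp
      also have "\<dots> \<le> 1 * (d (\<phi> x) * (gradient \<phi> x \<bullet> gradient \<phi> x))"
        using d(2,3)[of "\<phi> x"] by (intro mult_right_mono) auto
      finally show ?thesis by (simp add: g\<psi>)
    qed
  qed
  moreover have "0 \<le> (LINT p|(lborel \<Otimes>\<^sub>M lborel). diff_quot s \<phi> p * diff_quot s \<psi> p)"
  proof (rule integral_nonneg_AE, rule AE_I2)
    fix p :: "'a \<times> 'a"
    obtain x y where p: "p = (x, y)" by fastforce
    show "0 \<le> diff_quot s \<phi> p * diff_quot s \<psi> p"
      unfolding p diff_quot_mult \<psi>_def using L(1)[of "\<phi> x" "\<phi> y"] by (intro divide_nonneg_nonneg) auto
  qed
  ultimately show "(LINT x|lborel. (norm (gradient (\<lambda>x. G (\<phi> x)) x))\<^sup>2) \<le> energy s \<phi> (\<lambda>x. G (\<phi> x))"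
    using energy_eq[OF s dim \<phi> \<psi>] unfolding \<psi>_def[abs_def] by linarith
  have "(LINT x|lborel. (norm (gradient \<psi> x))\<^sup>2) \<le> (LINT x|lborel. (norm (gradient \<phi> x))\<^sup>2)"
  proof (rule integral_mono)
    show "(norm (gradient \<psi> x))\<^sup>2 \<le> (norm (gradient \<phi> x))\<^sup>2" for x
      using d(2,3)[of "\<phi> x"] by (intro power_mono) (auto simp: g\<psi> mult_left_le_one_le)
  qed (use test_functions_gradient_square(2) \<phi> \<psi> in auto)
  moreover have "(LINT p|(lborel \<Otimes>\<^sub>M lborel). (norm (diff_quot s \<psi> p))\<^sup>2) \<le> (LINT p|(lborel \<Otimes>\<^sub>M lborel). (norm (diff_quot s \<phi> p))\<^sup>2)"
  proof (rule integral_mono)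
    show "(norm (diff_quot s \<psi> p))\<^sup>2 \<le> (norm (diff_quot s \<phi> p))\<^sup>2" for p
      using L(2)[of "\<phi> (fst p)" "\<phi> (snd p)"]
      by (intro power_mono) (auto simp: diff_quot_def \<psi>_def divide_right_mono)
  qed (rule diff_quot_test_norm[OF s dim \<psi>] diff_quot_test_norm[OF s dim \<phi>])+
  ultimately have "(X12_norm s \<psi>)\<^sup>2 \<le> (X12_norm s \<phi>)\<^sup>2"
    unfolding X12_norm_power2[OF s dim \<phi>] X12_norm_power2[OF s dim \<psi>] by linarith
  then show "X12_norm s (\<lambda>x. G (\<phi> x)) \<le> X12_norm s \<phi>"
    unfolding \<psi>_def[abs_def] using X12_norm_nonneg[OF s dim \<phi>] by (rule power2_le_imp_le)
qed

text \<open>A triangle inequality with a constant, obtained from the pointwise bound for squared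
  norms. It suffices to show that a Cauchy sequence of test functions is bounded.\<close>

lemma X12_norm_power2_le:
  fixes \<phi> \<psi> :: "'a::euclidean_space \<Rightarrow> real"
  assumes s: "0 < s" "s < 1" and dim: "2 \<le> DIM('a)"
    and \<phi>: "\<phi> \<in> test_functions \<Omega>" and \<psi>: "\<psi> \<in> test_functions \<Omega>"
  shows "(X12_norm s \<phi>)\<^sup>2 \<le> 2 * (X12_norm s (\<lambda>x. \<phi> x - \<psi> x))\<^sup>2 + 2 * (X12_norm s \<psi>)\<^sup>2"
proof -
  have par: "(norm a)\<^sup>2 \<le> 2 * (norm (a - b))\<^sup>2 + 2 * (norm b)\<^sup>2" for a b :: "'c::euclidean_space"
  proof -
    have "(norm a)\<^sup>2 \<le> (norm (a - b) + norm b)\<^sup>2"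
      using norm_triangle_ineq[of "a - b" b] by (intro power_mono) auto
    then show ?thesis
      using sum_squares_bound[of "norm (a - b)" "norm b"] by (simp add: power2_sum)
  qed
  note \<delta> = test_functions_diff[OF \<phi> \<psi>]
  have "(LINT x|lborel. (norm (gradient \<phi> x))\<^sup>2)
      \<le> (LINT x|lborel. 2 * (norm (gradient (\<lambda>x. \<phi> x - \<psi> x) x))\<^sup>2 + 2 * (norm (gradient \<psi> x))\<^sup>2)"
    using par
    by (intro integral_mono Bochner_Integration.integrable_add integrable_mult_right test_functions_gradient_square(2)[OF \<phi>]
        test_functions_gradient_square(2)[OF \<psi>] test_functions_gradient_square(2)[OF \<delta>])
      (simp add: gradient_diff[OF \<phi> \<psi>])
  also have "\<dots> = 2 * (LINT x|lborel. (norm (gradient (\<lambda>x. \<phi> x - \<psi> x) x))\<^sup>2) + 2 * (LINT x|lborel. (norm (gradient \<psi> x))\<^sup>2)"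
    using test_functions_gradient_square(2)[OF \<psi>] test_functions_gradient_square(2)[OF \<delta>] by simp
  finally have 1: "(LINT x|lborel. (norm (gradient \<phi> x))\<^sup>2)
      \<le> 2 * (LINT x|lborel. (norm (gradient (\<lambda>x. \<phi> x - \<psi> x) x))\<^sup>2) + 2 * (LINT x|lborel. (norm (gradient \<psi> x))\<^sup>2)" .
  note int = diff_quot_test_norm[OF s dim \<phi>] diff_quot_test_norm[OF s dim \<psi>] diff_quot_test_norm[OF s dim \<delta>]
  have "(LINT p|(lborel \<Otimes>\<^sub>M lborel). (norm (diff_quot s \<phi> p))\<^sup>2)
      \<le> (LINT p|(lborel \<Otimes>\<^sub>M lborel). 2 * (norm (diff_quot s (\<lambda>x. \<phi> x - \<psi> x) p))\<^sup>2 + 2 * (norm (diff_quot s \<psi> p))\<^sup>2)"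
  proof (rule integral_mono[OF int(1) Bochner_Integration.integrable_add[OF integrable_mult_right[OF int(3)] integrable_mult_right[OF int(2)]]])
    show "(norm (diff_quot s \<phi> p))\<^sup>2 \<le> 2 * (norm (diff_quot s (\<lambda>x. \<phi> x - \<psi> x) p))\<^sup>2 + 2 * (norm (diff_quot s \<psi> p))\<^sup>2" for p
      using par[of "diff_quot s \<phi> p" "diff_quot s \<psi> p"] by (simp only: diff_quot_diff)
  qed
  also have "\<dots> = 2 * (LINT p|(lborel \<Otimes>\<^sub>M lborel). (norm (diff_quot s (\<lambda>x. \<phi> x - \<psi> x) p))\<^sup>2) + 2 * (LINT p|(lborel \<Otimes>\<^sub>M lborel). (norm (diff_quot s \<psi> p))\<^sup>2)"
    using int by simp
  finally show ?thesis
    using 1 unfolding X12_norm_power2[OF s dim \<phi>] X12_norm_power2[OF s dim \<psi>] X12_norm_power2[OF s dim \<delta>] distrib_left by linarith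
qed

section \<open>Sums of functions with integrable powers\<close>

lemma powr_add_le:
  fixes a b p :: real
  assumes "0 \<le> a" "0 \<le> b" "0 \<le> p"
  shows "(a + b) powr p \<le> 2 powr p * (a powr p + b powr p)"
proof -
  have "(a + b) powr p \<le> (2 * max a b) powr p"
    using assms by (intro powr_mono2) auto
  also have "\<dots> = 2 powr p * max a b powr p"
    using assms by (simp add: powr_mult)
  also have "\<dots> \<le> 2 powr p * (a powr p + b powr p)"
    by (intro mult_left_mono) (auto simp: max_def)
  finally show ?thesis .
qed

lemma integrable_powr_add:
  fixes f g :: "'a \<Rightarrow> real"
  assumes [measurable]: "f \<in> borel_measurable M" "g \<in> borel_measurable M"
    and f: "integrable M (\<lambda>x. \<bar>f x\<bar> powr p)" and g: "integrable M (\<lambda>x. \<bar>g x\<bar> powr p)" and "0 \<le> p"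
  shows "integrable M (\<lambda>x. (\<bar>f x\<bar> + \<bar>g x\<bar>) powr p)"
    and "(LINT x|M. (\<bar>f x\<bar> + \<bar>g x\<bar>) powr p) \<le> 2 powr p * ((LINT x|M. \<bar>f x\<bar> powr p) + (LINT x|M. \<bar>g x\<bar> powr p))"
proof -
  have int: "integrable M (\<lambda>x. 2 powr p * (\<bar>f x\<bar> powr p + \<bar>g x\<bar> powr p))"
    using f g by simp
  show *: "integrable M (\<lambda>x. (\<bar>f x\<bar> + \<bar>g x\<bar>) powr p)"
    by (rule Bochner_Integration.integrable_bound[OF int])
       (use powr_add_le[OF abs_ge_zero abs_ge_zero \<open>0 \<le> p\<close>] in \<open>auto intro!: AE_I2 order_trans[OF _ abs_ge_self]\<close>)
  have "(LINT x|M. (\<bar>f x\<bar> + \<bar>g x\<bar>) powr p) \<le> (LINT x|M. 2 powr p * (\<bar>f x\<bar> powr p + \<bar>g x\<bar> powr p))"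
    by (rule integral_mono[OF * int]) (intro powr_add_le abs_ge_zero \<open>0 \<le> p\<close>)
  also have "\<dots> = 2 powr p * ((LINT x|M. \<bar>f x\<bar> powr p) + (LINT x|M. \<bar>g x\<bar> powr p))"
    using f g by simp
  finally show "(LINT x|M. (\<bar>f x\<bar> + \<bar>g x\<bar>) powr p) \<le> 2 powr p * ((LINT x|M. \<bar>f x\<bar> powr p) + (LINT x|M. \<bar>g x\<bar> powr p))" .
qed

section \<open>Boundedness of weak solutions\<close>

lemma test_functions_integral_lebesgue_on:
  fixes \<phi> :: "'a::euclidean_space \<Rightarrow> real"
  assumes \<phi>: "\<phi> \<in> test_functions \<Omega>" and \<Omega>: "open \<Omega>" and q: "0 < q"
    and int: "integrable lborel (\<lambda>x. \<bar>\<phi> x\<bar> powr q)"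
  shows "integrable (lebesgue_on \<Omega>) (\<lambda>x. \<bar>\<phi> x\<bar> powr q)"
    and "(LINT x|lebesgue_on \<Omega>. \<bar>\<phi> x\<bar> powr q) = (LINT x|lborel. \<bar>\<phi> x\<bar> powr q)"
proof -
  note [measurable] = test_functions_measurable[OF \<phi>]
  have \<Omega>m: "\<Omega> \<inter> space lebesgue \<in> sets lebesgue" using \<Omega> by simp
  obtain K where K: "K \<subseteq> \<Omega>" "\<And>x. x \<notin> K \<Longrightarrow> \<phi> x = 0"
    using test_functions_support[OF \<phi>] by metis
  have eq: "indicator \<Omega> x *\<^sub>R \<bar>\<phi> x\<bar> powr q = \<bar>\<phi> x\<bar> powr q" for x
    using K by (cases "x \<in> \<Omega>") auto
  show "integrable (lebesgue_on \<Omega>) (\<lambda>x. \<bar>\<phi> x\<bar> powr q)"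
    unfolding integrable_restrict_space[OF \<Omega>m] eq using int by (simp add: integrable_completion)
  show "(LINT x|lebesgue_on \<Omega>. \<bar>\<phi> x\<bar> powr q) = (LINT x|lborel. \<bar>\<phi> x\<bar> powr q)"
    unfolding integral_restrict_space[OF \<Omega>m] eq by (simp add: integral_completion)
qed

text \<open>The hypothesis \<open>lim\<close> is the weak formulation of \<open>- \<Delta> u + (- \<Delta>)\<^sup>s u + a u = f\<close> with \<open>u\<close>
  replaced by an approximating sequence of test functions. In this form it is invariant under
  \<open>(u, f) \<mapsto> (- u, - f)\<close>.\<close>

lemma weak_solution_bounded_above:
  fixes \<Omega> :: "'a::euclidean_space set" and a f u :: "'a \<Rightarrow> real"
  assumes s: "0 < s" "s < 1" and dim: "3 \<le> DIM('a)" and \<Omega>: "open \<Omega>" "bounded \<Omega>"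
    and l: "real DIM('a) / 2 < l" and a: "a \<in> L_p l \<Omega>" and f: "f \<in> L_p l \<Omega>"
    and um: "u \<in> borel_measurable (lebesgue_on \<Omega>)"
    and \<phi>: "\<And>k. \<phi> k \<in> test_functions \<Omega>"
    and cauchy: "\<And>e. 0 < e \<Longrightarrow> \<exists>N. \<forall>i\<ge>N. \<forall>j\<ge>N. X12_norm s (\<lambda>x. \<phi> i x - \<phi> j x) < e"
    and ae: "AE x in lebesgue_on \<Omega>. (\<lambda>k. \<phi> k x) \<longlonglongrightarrow> u x"
    and lim: "\<And>\<psi>. \<psi> \<in> test_functions \<Omega> \<Longrightarrow> (\<lambda>k. energy s (\<phi> k) \<psi>) \<longlonglongrightarrow>
      (LINT x|lebesgue_on \<Omega>. f x * \<psi> x) - (LINT x|lebesgue_on \<Omega>. a x * u x * \<psi> x)"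
  shows "\<exists>K. AE x in lebesgue_on \<Omega>. u x \<le> K"
proof -
  define n where "n = real DIM('a)"
  have n: "3 \<le> n" using dim by (simp add: n_def)
  have dim2: "2 \<le> DIM('a)" using dim by simp
  have l1: "1 < l" using l n by (simp add: n_def)
  have "2 * l / (l - 1) < 2 * n / (n - 2)"
    using l l1 n by (simp add: n_def[symmetric] field_simps)
  then obtain q where q: "2 * l / (l - 1) < q" "q < 2 * n / (n - 2)"
    using dense by blast
  have "2 < 2 * l / (l - 1)" using l1 by (simp add: field_simps)
  with q have q2: "2 < q" by linarith
  have q_lt: "q * (n - 2) < 2 * n" using q(2) n by (simp add: field_simps)
  \<comment> \<open>The lower bound on \<open>q\<close>, rewritten as the exponent condition of the
    De Giorgi iteration.\<close>
  have lq: "1 / l + 2 / q < 1"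
  proof -
    have "2 * l < q * (l - 1)" using q(1) l1 by (simp add: field_simps)
    then show ?thesis using l1 q2 by (simp add: field_simps)
  qed
  define M where "M = lebesgue_on \<Omega>"
  have \<Omega>_sets: "\<Omega> \<in> sets lebesgue" using \<Omega> by simp
  have "emeasure lborel \<Omega> < \<infinity>" by (rule emeasure_bounded_finite[OF \<Omega>(2)])
  then have "finite_measure M"
    unfolding M_def using \<Omega> by (intro finite_measureI) (simp add: emeasure_restrict_space space_restrict_space)
  then interpret finite_measure M .
  have am [measurable]: "a \<in> borel_measurable M" and a_int: "integrable M (\<lambda>x. \<bar>a x\<bar> powr l)"
    using a by (auto simp: L_p_def M_def)
  have fm [measurable]: "f \<in> borel_measurable M" and f_int: "integrable M (\<lambda>x. \<bar>f x\<bar> powr l)"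
    using f by (auto simp: L_p_def M_def)
  have [measurable]: "u \<in> borel_measurable M" using um by (simp add: M_def)
  have tm [measurable]: "\<psi> \<in> borel_measurable M" if "\<psi> \<in> test_functions \<Omega>" for \<psi>
    unfolding M_def using test_functions_measurable_lebesgue(1)[OF that] by (rule measurable_restrict_space1)
  note \<phi>m [measurable] = tm[OF \<phi>]
  obtain R where R: "0 < R" "\<Omega> \<subseteq> ball 0 R"
    using bounded_subset_ballD[OF \<Omega>(2)] by blast
  obtain C where C: "0 \<le> C"
    and Sob_int: "\<And>\<psi>::'a \<Rightarrow> real. \<psi> \<in> test_functions (ball 0 R) \<Longrightarrow> integrable lborel (\<lambda>x. \<bar>\<psi> x\<bar> powr q)"
    and Sob_le: "\<And>\<psi>::'a \<Rightarrow> real. \<psi> \<in> test_functions (ball 0 R) \<Longrightarrow>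
      (LINT x|lborel. \<bar>\<psi> x\<bar> powr q) powr (2 / q) \<le> C * (LINT x|lborel. (norm (gradient \<psi> x))\<^sup>2)"
    using subcritical_Sobolev[of R q, where 'a = 'a] R(1) q2 q_lt unfolding n_def by metis
  have S_int: "integrable M (\<lambda>x. \<bar>\<psi> x\<bar> powr q)"
    and S_le: "(LINT x|M. \<bar>\<psi> x\<bar> powr q) powr (2 / q) \<le> C * (LINT x|lborel. (norm (gradient \<psi> x))\<^sup>2)"
    if \<psi>: "\<psi> \<in> test_functions \<Omega>" for \<psi>
    using test_functions_integral_lebesgue_on[OF \<psi> \<Omega>(1), of q] q2
      Sob_int[OF test_functions_mono[OF \<psi> R(2)]] Sob_le[OF test_functions_mono[OF \<psi> R(2)]]
    by (auto simp: M_def)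
  have le_powr: "X \<le> Y powr (q / 2)" if "X powr (2 / q) \<le> Y" "0 \<le> X" for X Y :: real
  proof -
    have "(X powr (2 / q)) powr (q / 2) \<le> Y powr (q / 2)"
      using that q2 by (intro powr_mono2) auto
    then show ?thesis using that q2 by (simp add: powr_powr)
  qed
  \<comment> \<open>Convergence in L^q: the Sobolev inequality bounds the differences of
    approximants by their \<open>X12_norm\<close> distance, and Fatou's lemma replaces the second
    approximant by \<open>u\<close>.\<close>
  have Lq: "\<exists>N. \<forall>k\<ge>N. integrable M (\<lambda>x. \<bar>\<phi> k x - u x\<bar> powr q) \<and> (LINT x|M. \<bar>\<phi> k x - u x\<bar> powr q) \<le> e"
    if e: "0 < e" for e
  proof -
    \<comment> \<open>Chosen so that \<open>C\<close> times its square is at most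
      \<open>e powr (2 / q)\<close>, the scale on which the Sobolev inequality is stated; adding 1
      to \<open>C\<close> excludes division by zero.\<close>
    define e' where "e' = sqrt (e powr (2 / q) / (C + 1))"
    have e': "0 < e'" using e C by (simp add: e'_def)
    obtain N where N: "\<forall>i\<ge>N. \<forall>j\<ge>N. X12_norm s (\<lambda>x. \<phi> i x - \<phi> j x) < e'"
      using cauchy[OF e'] by blast
    have le: "(LINT x|M. \<bar>\<phi> i x - \<phi> j x\<bar> powr q) \<le> e" if ij: "N \<le> i" "N \<le> j" for i j
    proof -
      note d = test_functions_diff[OF \<phi>[of i] \<phi>[of j]]
      have "(LINT x|M. \<bar>\<phi> i x - \<phi> j x\<bar> powr q) powr (2 / q) \<le> C * (X12_norm s (\<lambda>x. \<phi> i x - \<phi> j x))\<^sup>2"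
        using S_le[OF d] gradient_norm_le_X12_norm[OF s dim2 d] mult_left_mono[OF _ C] by (meson order_trans)
      also have "\<dots> \<le> C * e'\<^sup>2"
        using N ij X12_norm_nonneg[OF s dim2 d] C less_imp_le by (intro mult_left_mono power_mono) blast+
      also have "e'\<^sup>2 = e powr (2 / q) / (C + 1)"
        using C by (simp add: e'_def)
      also have "C * (e powr (2 / q) / (C + 1)) \<le> e powr (2 / q)"
        using C by (simp add: field_simps)
      finally have "(LINT x|M. \<bar>\<phi> i x - \<phi> j x\<bar> powr q) \<le> (e powr (2 / q)) powr (q / 2)"
        by (rule le_powr) simp
      then show ?thesis using e q2 by (simp add: powr_powr)
    qed
    show ?thesis
    proof (intro exI[of _ N] allI impI)
      fix k assume k: "N \<le> k"
      have conv: "AE x in M. (\<lambda>j. \<bar>\<phi> k x - \<phi> (j + N) x\<bar> powr q) \<longlonglongrightarrow> \<bar>\<phi> k x - u x\<bar> powr q"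
        using ae[folded M_def]
      proof eventually_elim
        case (elim x)
        have "(\<lambda>j. \<bar>\<phi> k x - \<phi> (j + N) x\<bar>) \<longlonglongrightarrow> \<bar>\<phi> k x - u x\<bar>"
          using LIMSEQ_ignore_initial_segment[OF elim, of N] by (intro tendsto_rabs tendsto_diff tendsto_const)
        then show ?case
          using q2 by (intro tendsto_powr' tendsto_const) auto
      qed
      show "integrable M (\<lambda>x. \<bar>\<phi> k x - u x\<bar> powr q) \<and> (LINT x|M. \<bar>\<phi> k x - u x\<bar> powr q) \<le> e"
        using Fatou_real[where F = "\<lambda>j x. \<bar>\<phi> k x - \<phi> (j + N) x\<bar> powr q" and r = "\<lambda>_. e" and R = e,
            OF _ S_int[OF test_functions_diff[OF \<phi> \<phi>]] _ _ tendsto_const conv] le[OF k] by simp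
    qed
  qed
  have uq: "integrable M (\<lambda>x. \<bar>u x\<bar> powr q)"
  proof -
    obtain N where N: "integrable M (\<lambda>x. \<bar>\<phi> N x - u x\<bar> powr q)" using Lq[of 1] by auto
    have "integrable M (\<lambda>x. (\<bar>\<phi> N x\<bar> + \<bar>\<phi> N x - u x\<bar>) powr q)"
      by (rule integrable_powr_add(1)) (use N S_int[OF \<phi>] q2 in auto)
    then show ?thesis
      by (rule Bochner_Integration.integrable_bound) (use q2 in \<open>auto intro!: AE_I2 powr_mono2\<close>)
  qed
  define g where "g x = \<bar>f x\<bar> + \<bar>a x\<bar>" for x
  have [measurable]: "g \<in> borel_measurable M" unfolding g_def[abs_def] by measurable
  have g0: "0 \<le> g x" for x by (simp add: g_def)
  have g_int: "integrable M (\<lambda>x. g x powr l)"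
    unfolding g_def using l1 by (intro integrable_powr_add(1) a_int f_int) auto
  have fau: "\<bar>f x\<bar> + \<bar>a x * u x\<bar> \<le> g x * (1 + \<bar>u x\<bar>)" for x
    by (simp add: g_def abs_mult algebra_simps)
  \<comment> \<open>The third Hoelder exponent, next to \<open>g\<close> in L^l and a test function
    in L^q. The condition \<open>1 / l + 2 / q < 1\<close> says that \<open>q' < q\<close>; since
    the measure is finite, \<open>1 + \<bar>u\<bar>\<close> then lies in the required space.\<close>
  define q' where "q' = 1 / (1 - 1 / l - 1 / q)"
  have q': "0 < 1 / q'" "1 / l + 1 / q' + 1 / q = 1" "0 < q'" "q' \<le> q"
  proof -
    have *: "1 / q < 1 - 1 / l - 1 / q" using lq by simp
    then have pos: "0 < 1 - 1 / l - 1 / q" using q2 by (smt (verit) divide_pos_pos)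
    then show "0 < 1 / q'" "1 / l + 1 / q' + 1 / q = 1" "0 < q'" by (simp_all add: q'_def)
    have "1 / (1 - 1 / l - 1 / q) \<le> 1 / (1 / q)" using * q2 by (intro divide_left_mono) (use q2 pos in \<open>auto intro: divide_pos_pos\<close>)
    then show "q' \<le> q" by (simp add: q'_def)
  qed
  have u1_int: "integrable M (\<lambda>x. (1 + \<bar>u x\<bar>) powr q')"
  proof (rule Bochner_Integration.integrable_bound)
    show "integrable M (\<lambda>x. (\<bar>1\<bar> + \<bar>u x\<bar>) powr q)"
      by (rule integrable_powr_add(1)) (use uq q2 in auto)
    show "AE x in M. norm ((1 + \<bar>u x\<bar>) powr q') \<le> norm ((\<bar>1\<bar> + \<bar>u x\<bar>) powr q)"
      using q' by (intro AE_I2) (auto intro!: powr_mono)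
  qed measurable
  define B where "B = (LINT x|M. g x powr l) powr (1 / l) * (LINT x|M. (1 + \<bar>u x\<bar>) powr q') powr (1 / q')"
  have H_int: "integrable M (\<lambda>x. g x * (1 + \<bar>u x\<bar>) * v x)"
    and H_le: "(LINT x|M. g x * (1 + \<bar>u x\<bar>) * v x) \<le> B * (LINT x|M. v x powr q) powr (1 / q)"
    if v: "integrable M (\<lambda>x. v x powr q)" "\<And>x. 0 \<le> v x" for v
  proof -
    have eq: "g x * (1 + \<bar>u x\<bar>) * v x
      = (g x powr l) powr (1 / l) * ((1 + \<bar>u x\<bar>) powr q') powr (1 / q') * (v x powr q) powr (1 / q)" for x
      using l1 q2 q' g0[of x] v(2)[of x] by (simp add: powr_powr)
    have *: "0 < 1 / l" "0 < 1 / q" using l1 q2 by auto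
    show "integrable M (\<lambda>x. g x * (1 + \<bar>u x\<bar>) * v x)"
      unfolding eq by (rule Hoelder3(1)[OF g_int _ u1_int _ v(1) _ *(1) q'(1) *(2) q'(2)]) simp_all
    show "(LINT x|M. g x * (1 + \<bar>u x\<bar>) * v x) \<le> B * (LINT x|M. v x powr q) powr (1 / q)"
      unfolding eq B_def by (rule Hoelder3(2)[OF g_int _ u1_int _ v(1) _ *(1) q'(1) *(2) q'(2)]) simp_all
  qed
  \<comment> \<open>The right-hand side of the weak formulation as a linear functional of the test
    function. \<open>F_le\<close> and \<open>H_le\<close> together bound it by the L^q norm, which
    makes it continuous under the convergence of the truncations.\<close>
  define F where "F v = (LINT x|M. f x * v x) - (LINT x|M. a x * u x * v x)" for v
  have F_ints: "integrable M (\<lambda>x. f x * v x)" "integrable M (\<lambda>x. a x * u x * v x)"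
    and F_le: "\<bar>F v\<bar> \<le> (LINT x|M. g x * (1 + \<bar>u x\<bar>) * \<bar>v x\<bar>)"
    if [measurable]: "v \<in> borel_measurable M" and v: "integrable M (\<lambda>x. \<bar>v x\<bar> powr q)" for v
  proof -
    note H = H_int[OF v abs_ge_zero]
    have pt: "\<bar>f x * v x\<bar> + \<bar>a x * u x * v x\<bar> \<le> g x * (1 + \<bar>u x\<bar>) * \<bar>v x\<bar>" for x
      using mult_right_mono[OF fau[of x] abs_ge_zero[of "v x"]] by (simp add: abs_mult algebra_simps)
    have pt1: "norm (f x * v x) \<le> norm (g x * (1 + \<bar>u x\<bar>) * \<bar>v x\<bar>)"
      and pt2: "norm (a x * u x * v x) \<le> norm (g x * (1 + \<bar>u x\<bar>) * \<bar>v x\<bar>)" for x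
      using pt[of x] unfolding real_norm_def by linarith+
    show i1: "integrable M (\<lambda>x. f x * v x)"
      by (rule Bochner_Integration.integrable_bound[OF H]) (use pt1 in \<open>auto intro!: AE_I2\<close>)
    show i2: "integrable M (\<lambda>x. a x * u x * v x)"
      by (rule Bochner_Integration.integrable_bound[OF H]) (use pt2 in \<open>auto intro!: AE_I2\<close>)
    have "\<bar>F v\<bar> = \<bar>LINT x|M. f x * v x - a x * u x * v x\<bar>"
      using i1 i2 by (simp add: F_def)
    also have "\<dots> \<le> (LINT x|M. \<bar>f x * v x - a x * u x * v x\<bar>)"
      by (rule integral_abs_bound)
    also have "\<dots> \<le> (LINT x|M. g x * (1 + \<bar>u x\<bar>) * \<bar>v x\<bar>)"
    proof (rule integral_mono[OF _ H])
      show "integrable M (\<lambda>x. \<bar>f x * v x - a x * u x * v x\<bar>)" using i1 i2 by simp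
      show "\<bar>f x * v x - a x * u x * v x\<bar> \<le> g x * (1 + \<bar>u x\<bar>) * \<bar>v x\<bar>" for x
        using pt[of x] by linarith
    qed
    finally show "\<bar>F v\<bar> \<le> (LINT x|M. g x * (1 + \<bar>u x\<bar>) * \<bar>v x\<bar>)" .
  qed
  \<comment> \<open>All norms from index \<open>E\<close> onwards are bounded by one constant. With
    \<open>N\<close> the norm at index \<open>E\<close>, the inequality for squares gives
    \<open>2 + 2 * N^2\<close>, which is at most \<open>(2 * N + 2)^2\<close>.\<close>
  obtain E where E: "\<And>k. X12_norm s (\<phi> (k + E)) \<le> X12_norm s (\<phi> E) * 2 + 2"
  proof -
    obtain N where N: "\<forall>i\<ge>N. \<forall>j\<ge>N. X12_norm s (\<lambda>x. \<phi> i x - \<phi> j x) < 1"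
      using cauchy[of 1] by auto
    have "X12_norm s (\<phi> (k + N)) \<le> X12_norm s (\<phi> N) * 2 + 2" for k
    proof (rule power2_le_imp_le)
      have nn: "0 \<le> X12_norm s (\<lambda>x. \<phi> (k + N) x - \<phi> N x)" "0 \<le> X12_norm s (\<phi> N)"
        using X12_norm_nonneg[OF s dim2 test_functions_diff[OF \<phi> \<phi>]] X12_norm_nonneg[OF s dim2 \<phi>] by auto
      have "(X12_norm s (\<lambda>x. \<phi> (k + N) x - \<phi> N x))\<^sup>2 \<le> 1"
        using N nn by (intro power_le_one) (auto intro: less_imp_le)
      then have "(X12_norm s (\<phi> (k + N)))\<^sup>2 \<le> 2 * 1 + 2 * (X12_norm s (\<phi> N))\<^sup>2"
        using X12_norm_power2_le[OF s dim2 \<phi>[of "k + N"] \<phi>[of N]] by linarith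
      also have "\<dots> \<le> (X12_norm s (\<phi> N) * 2 + 2)\<^sup>2"
        using nn(2) by (simp add: power2_eq_square algebra_simps)
      finally show "(X12_norm s (\<phi> (k + N)))\<^sup>2 \<le> (X12_norm s (\<phi> N) * 2 + 2)\<^sup>2" .
      show "0 \<le> X12_norm s (\<phi> N) * 2 + 2" using nn(2) by simp
    qed
    then show ?thesis by (rule that)
  qed
  define A where "A = X12_norm s (\<phi> E) * 2 + 2"
  have A: "0 < A" using X12_norm_nonneg[OF s dim2 \<phi>[of E]] by (simp add: A_def)
  have energy_ineq: "(LINT x|M. max 0 (u x - \<kappa>) powr q) powr (2 / q) \<le> C * (LINT x|M. g x * (1 + \<bar>u x\<bar>) * max 0 (u x - \<kappa>))"
    if \<kappa>: "1 \<le> \<kappa>" for \<kappa>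
  proof -
    define w where "w x = max 0 (u x - \<kappa>)" for x
    define \<epsilon> where "\<epsilon> k = inverse (real (Suc k))" for k
    have \<epsilon>: "0 < \<epsilon> k" for k by (simp add: \<epsilon>_def)
    have \<epsilon>_lim: "\<epsilon> \<longlonglongrightarrow> 0" unfolding \<epsilon>_def[abs_def] by (rule LIMSEQ_inverse_real_of_nat)
    define \<psi> where "\<psi> k x = trunc \<kappa> (\<epsilon> k) (\<phi> k x)" for k x
    have \<psi>: "\<psi> k \<in> test_functions \<Omega>" for k
      unfolding \<psi>_def[abs_def] using \<kappa> \<epsilon> by (intro test_functions_compose[OF \<phi> Ck_trunc] trunc_0) auto
    note \<psi>m [measurable] = tm[OF \<psi>]
    have [measurable]: "w \<in> borel_measurable M" unfolding w_def[abs_def] by measurable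
    have w_int: "integrable M (\<lambda>x. \<bar>w x\<bar> powr q)"
      by (rule Bochner_Integration.integrable_bound[OF uq])
         (use \<kappa> q2 in \<open>auto simp: w_def intro!: AE_I2 powr_mono2\<close>)
    have \<psi>_energy: "(LINT x|lborel. (norm (gradient (\<psi> k) x))\<^sup>2) \<le> energy s (\<phi> k) (\<psi> k)"
      "X12_norm s (\<psi> k) \<le> X12_norm s (\<phi> k)" for k
    proof -
      obtain d where d: "\<And>t. (trunc \<kappa> (\<epsilon> k) has_real_derivative d t) (at t)" "\<And>t. 0 \<le> d t" "\<And>t. d t \<le> 1"
        using trunc_has_derivative[OF \<epsilon>] by blast
      have T0: "trunc \<kappa> (\<epsilon> k) 0 = 0" using \<kappa> by (intro trunc_0 \<epsilon>) simp
      show "(LINT x|lborel. (norm (gradient (\<psi> k) x))\<^sup>2) \<le> energy s (\<phi> k) (\<psi> k)"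
        unfolding \<psi>_def[abs_def] by (rule energy_compose(1)[OF s dim2 \<phi> Ck_trunc T0 d])
      show "X12_norm s (\<psi> k) \<le> X12_norm s (\<phi> k)"
        unfolding \<psi>_def[abs_def] by (rule energy_compose(2)[OF s dim2 \<phi> Ck_trunc T0 d])
    qed
    have dist: "\<bar>\<psi> k x - w x\<bar> \<le> \<epsilon> k + \<bar>\<phi> k x - u x\<bar>" for k x
    proof -
      have "\<bar>max 0 (\<phi> k x - \<kappa>) - w x\<bar> \<le> \<bar>\<phi> k x - u x\<bar>" unfolding w_def by linarith
      then show ?thesis using trunc_approx[OF \<epsilon>, of \<kappa> k "\<phi> k x"] unfolding \<psi>_def by linarith
    qed
    have ae_\<psi>: "AE x in M. (\<lambda>k. \<psi> k x) \<longlonglongrightarrow> w x"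
      using ae[folded M_def]
    proof eventually_elim
      case (elim x)
      have "(\<lambda>k. \<epsilon> k + \<bar>\<phi> k x - u x\<bar>) \<longlonglongrightarrow> 0 + \<bar>u x - u x\<bar>"
        by (intro tendsto_add tendsto_rabs tendsto_diff tendsto_const \<epsilon>_lim elim)
      then have null: "(\<lambda>k. \<epsilon> k + \<bar>\<phi> k x - u x\<bar>) \<longlonglongrightarrow> 0" by simp
      have "(\<lambda>k. \<psi> k x - w x) \<longlonglongrightarrow> 0"
        by (rule Lim_null_comparison[OF always_eventually[OF allI] null]) (use dist in simp)
      then show ?case by (simp add: LIM_zero_iff)
    qed
    have dist_q: "(\<lambda>k. (LINT x|M. \<bar>\<psi> k x - w x\<bar> powr q)) \<longlonglongrightarrow> 0"
    proof (rule LIMSEQ_I)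
      fix e :: real assume e: "0 < e"
      \<comment> \<open>Two contributions of at most \<open>e1\<close>, multiplied by
        \<open>2 powr q\<close>, add up to \<open>e / 2\<close>.\<close>
      define e1 where "e1 = e / (4 * 2 powr q)"
      have e1: "0 < e1" using e by (simp add: e1_def)
      obtain N1 where N1: "\<forall>k\<ge>N1. integrable M (\<lambda>x. \<bar>\<phi> k x - u x\<bar> powr q) \<and> (LINT x|M. \<bar>\<phi> k x - u x\<bar> powr q) \<le> e1"
        using Lq[OF e1] by blast
      have "(\<lambda>k. \<epsilon> k powr q * measure M (space M)) \<longlonglongrightarrow> 0 powr q * measure M (space M)"
        using q2 \<epsilon> by (intro tendsto_mult tendsto_powr' \<epsilon>_lim tendsto_const) (auto intro!: always_eventually less_imp_le)
      then have "\<forall>\<^sub>F k in sequentially. \<epsilon> k powr q * measure M (space M) < e1"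
        using e1 by (intro order_tendstoD(2)) auto
      then obtain N2 where N2: "\<forall>k\<ge>N2. \<epsilon> k powr q * measure M (space M) < e1"
        by (auto simp: eventually_sequentially)
      have "norm ((LINT x|M. \<bar>\<psi> k x - w x\<bar> powr q) - 0) < e" if k: "max N1 N2 \<le> k" for k
      proof -
        have i1: "integrable M (\<lambda>x. \<bar>\<phi> k x - u x\<bar> powr q)" "(LINT x|M. \<bar>\<phi> k x - u x\<bar> powr q) \<le> e1"
          using N1 k by auto
        have i2: "integrable M (\<lambda>x. \<bar>\<epsilon> k\<bar> powr q)" "(LINT x|M. \<bar>\<epsilon> k\<bar> powr q) \<le> e1"
          using N2 k \<epsilon>[of k] by (auto simp: mult.commute less_imp_le)
        have mono: "\<bar>\<psi> k x - w x\<bar> powr q \<le> (\<bar>\<epsilon> k\<bar> + \<bar>\<phi> k x - u x\<bar>) powr q" for x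
          using dist[of k x] q2 \<epsilon>[of k] by (intro powr_mono2) auto
        have sum: "integrable M (\<lambda>x. (\<bar>\<epsilon> k\<bar> + \<bar>\<phi> k x - u x\<bar>) powr q)"
          "(LINT x|M. (\<bar>\<epsilon> k\<bar> + \<bar>\<phi> k x - u x\<bar>) powr q) \<le> 2 powr q * ((LINT x|M. \<bar>\<epsilon> k\<bar> powr q) + (LINT x|M. \<bar>\<phi> k x - u x\<bar> powr q))"
          using integrable_powr_add[of "\<lambda>x. \<epsilon> k" M "\<lambda>x. \<phi> k x - u x" q] i1(1) i2(1) q2 by auto
        have "(LINT x|M. \<bar>\<psi> k x - w x\<bar> powr q) \<le> (LINT x|M. (\<bar>\<epsilon> k\<bar> + \<bar>\<phi> k x - u x\<bar>) powr q)"
          using mono by (intro integral_mono' sum(1)) auto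
        also have "\<dots> \<le> 2 powr q * (e1 + e1)"
          using i1(2) i2(2) by (intro order_trans[OF sum(2)] mult_left_mono add_mono) auto
        also have "\<dots> < e" using e by (simp add: e1_def)
        finally show ?thesis by simp
      qed
      then show "\<exists>N. \<forall>k\<ge>N. norm ((LINT x|M. \<bar>\<psi> k x - w x\<bar> powr q) - 0) < e" by blast
    qed
    have \<psi>w_int: "integrable M (\<lambda>x. \<bar>\<psi> k x - w x\<bar> powr q)" for k
    proof (rule Bochner_Integration.integrable_bound)
      show "integrable M (\<lambda>x. (\<bar>\<psi> k x\<bar> + \<bar>w x\<bar>) powr q)"
        by (rule integrable_powr_add(1)) (use S_int[OF \<psi>] w_int q2 in auto)
    qed (use q2 in \<open>auto intro!: AE_I2 powr_mono2\<close>)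
    have F_lim: "(\<lambda>k. F (\<psi> k)) \<longlonglongrightarrow> F w"
    proof -
      have le: "\<bar>F (\<psi> k) - F w\<bar> \<le> B * (LINT x|M. \<bar>\<psi> k x - w x\<bar> powr q) powr (1 / q)" for k
      proof -
        have "F (\<psi> k) - F w = F (\<lambda>x. \<psi> k x - w x)"
          unfolding F_def using F_ints[OF \<psi>m S_int[OF \<psi>]] F_ints[OF _ w_int]
          by (simp add: right_diff_distrib)
        then show ?thesis
          using F_le[OF _ \<psi>w_int[of k]] H_le[OF \<psi>w_int[of k]] by auto
      qed
      have "(\<lambda>k. B * (LINT x|M. \<bar>\<psi> k x - w x\<bar> powr q) powr (1 / q)) \<longlonglongrightarrow> B * 0 powr (1 / q)"
        using q2 by (intro tendsto_mult tendsto_const tendsto_powr' dist_q) auto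
      then have null: "(\<lambda>k. B * (LINT x|M. \<bar>\<psi> k x - w x\<bar> powr q) powr (1 / q)) \<longlonglongrightarrow> 0" by simp
      have "(\<lambda>k. F (\<psi> k) - F w) \<longlonglongrightarrow> 0"
        by (rule Lim_null_comparison[OF always_eventually[OF allI] null]) (use le in simp)
      then show ?thesis by (simp add: LIM_zero_iff)
    qed
    \<comment> \<open>The diagonal argument. With \<open>\<psi> k\<close> fixed, the weak
      formulation identifies the limit over \<open>j\<close> of
      \<open>energy s (\<phi> j) (\<psi> k)\<close> as \<open>F (\<psi> k)\<close>; replacing
      \<open>\<phi> j\<close> by \<open>\<phi> k\<close> costs at most twice the distance of the two
      approximants times the bound \<open>A\<close> for the norm of \<open>\<psi> k\<close>.\<close>
    have \<delta>_lim: "(\<lambda>k. energy s (\<phi> k) (\<psi> k) - F (\<psi> k)) \<longlonglongrightarrow> 0"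
    proof (rule LIMSEQ_I)
      fix e :: real assume e: "0 < e"
      obtain N where N: "\<forall>i\<ge>N. \<forall>j\<ge>N. X12_norm s (\<lambda>x. \<phi> i x - \<phi> j x) < e / (4 * A)"
        using cauchy[of "e / (4 * A)"] e A by auto
      have "norm (energy s (\<phi> k) (\<psi> k) - F (\<psi> k) - 0) < e" if k: "max N E \<le> k" for k
      proof -
        have lim': "(\<lambda>j. \<bar>energy s (\<phi> k) (\<psi> k) - energy s (\<phi> (j + N)) (\<psi> k)\<bar>) \<longlonglongrightarrow> \<bar>energy s (\<phi> k) (\<psi> k) - F (\<psi> k)\<bar>"
          unfolding F_def M_def
          by (intro tendsto_rabs tendsto_diff tendsto_const LIMSEQ_ignore_initial_segment lim \<psi>)
        have \<psi>A: "X12_norm s (\<psi> k) \<le> A"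
          using \<psi>_energy(2)[of k] E[of "k - E"] k by (simp add: A_def)
        have "\<bar>energy s (\<phi> k) (\<psi> k) - energy s (\<phi> (j + N)) (\<psi> k)\<bar> \<le> e / 2" for j
        proof -
          note d = test_functions_diff[OF \<phi>[of k] \<phi>[of "j + N"]]
          have "\<bar>energy s (\<phi> k) (\<psi> k) - energy s (\<phi> (j + N)) (\<psi> k)\<bar> = \<bar>energy s (\<lambda>x. \<phi> k x - \<phi> (j + N) x) (\<psi> k)\<bar>"
            by (simp add: energy_diff[OF s dim2 \<phi> \<phi> \<psi>])
          also have "\<dots> \<le> 2 * X12_norm s (\<lambda>x. \<phi> k x - \<phi> (j + N) x) * X12_norm s (\<psi> k)"
            by (rule energy_le[OF s dim2 d \<psi>])
          also have "\<dots> \<le> 2 * (e / (4 * A)) * A"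
            using N k \<psi>A e A X12_norm_nonneg[OF s dim2 d] X12_norm_nonneg[OF s dim2 \<psi>[of k]]
            by (intro mult_mono) (auto intro: less_imp_le)
          finally show ?thesis using A by simp
        qed
        then have "\<bar>energy s (\<phi> k) (\<psi> k) - F (\<psi> k)\<bar> \<le> e / 2"
          by (intro LIMSEQ_le_const2[OF lim']) auto
        then show ?thesis using e by simp
      qed
      then show "\<exists>N. \<forall>k\<ge>N. norm (energy s (\<phi> k) (\<psi> k) - F (\<psi> k) - 0) < e" by blast
    qed
    have energy_lim: "(\<lambda>k. C * energy s (\<phi> k) (\<psi> k)) \<longlonglongrightarrow> C * F w"
      using tendsto_mult_left[OF tendsto_add[OF \<delta>_lim F_lim], of C] by simp
    have Nq_le: "(LINT x|M. \<bar>\<psi> k x\<bar> powr q) powr (2 / q) \<le> C * energy s (\<phi> k) (\<psi> k)" for k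
      using S_le[OF \<psi>[of k]] mult_left_mono[OF \<psi>_energy(1)[of k] C] by linarith
    then have pos: "0 \<le> C * energy s (\<phi> k) (\<psi> k)" for k
      using powr_ge_zero order_trans by blast
    then have CF: "0 \<le> C * F w"
      by (intro LIMSEQ_le_const[OF energy_lim]) auto
    have r: "(\<lambda>k. (C * energy s (\<phi> k) (\<psi> k)) powr (q / 2)) \<longlonglongrightarrow> (C * F w) powr (q / 2)"
      using q2 pos by (intro tendsto_powr' energy_lim tendsto_const) auto
    have conv: "AE x in M. (\<lambda>k. \<bar>\<psi> k x\<bar> powr q) \<longlonglongrightarrow> \<bar>w x\<bar> powr q"
      using ae_\<psi>
    proof eventually_elim
      case (elim x)
      then show ?case
        using q2 by (intro tendsto_powr' tendsto_rabs tendsto_const) auto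
    qed
    \<comment> \<open>Fatou's lemma needs bounds on the integrals themselves, so the estimate is
      raised to the power \<open>q / 2\<close> before the limit and lowered again
      afterwards.\<close>
    have "(LINT x|M. \<bar>w x\<bar> powr q) \<le> (C * F w) powr (q / 2)"
      by (rule Fatou_real(2)[OF _ S_int[OF \<psi>] _ _ r conv])
         (use le_powr[OF Nq_le] in \<open>auto intro!: integral_nonneg_AE\<close>)
    then have "(LINT x|M. \<bar>w x\<bar> powr q) powr (2 / q) \<le> ((C * F w) powr (q / 2)) powr (2 / q)"
      using q2 by (intro powr_mono2) auto
    also have "\<dots> = C * F w" using q2 CF by (simp add: powr_powr)
    also have "\<dots> \<le> C * (LINT x|M. g x * (1 + \<bar>u x\<bar>) * \<bar>w x\<bar>)"
      using F_le[OF _ w_int] C by (intro mult_left_mono) auto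
    finally show ?thesis by (simp add: w_def)
  qed
  have "\<exists>K. AE x in M. u x \<le> K"
    by (rule De_Giorgi_iteration[where g = g and l = l and q = q and C = C])
       (use \<open>finite_measure M\<close> g_int g0 uq l1 q2 lq C energy_ineq in auto)
  then show ?thesis by (simp only: M_def)
qed

lemma test_functions_subset_X12:
  fixes \<psi> :: "'a::euclidean_space \<Rightarrow> real"
  assumes \<psi>: "\<psi> \<in> test_functions \<Omega>"
  shows "\<psi> \<in> X12 s \<Omega>"
proof -
  have "gradient (\<lambda>x::'a. 0) x = 0" for x
    by (rule gradient_eqI) simp
  then have "X12_norm s (\<lambda>x::'a. 0) = 0"
    by (simp add: X12_norm_def gagliardo_form_def)
  then show ?thesis
    using test_functions_measurable_lebesgue(1)[OF \<psi>] \<psi>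
    unfolding X12_def by (intro CollectI conjI exI[of _ "\<lambda>_. \<psi>"]) auto
qed

lemma energy_uminus:
  fixes \<phi> \<psi> :: "'a::euclidean_space \<Rightarrow> real"
  assumes s: "0 < s" "s < 1" and dim: "2 \<le> DIM('a)"
    and \<phi>: "\<phi> \<in> test_functions \<Omega>" and \<psi>: "\<psi> \<in> test_functions \<Omega>"
  shows "energy s (\<lambda>x. - \<phi> x) \<psi> = - energy s \<phi> \<psi>"
proof -
  have zero: "(\<lambda>x. 0) \<in> test_functions \<Omega>"
    using test_functions_diff[OF \<phi> \<phi>] by simp
  have "energy s (\<lambda>x. 0) \<psi> = 0"
    using energy_diff[OF s dim \<phi> \<phi> \<psi>] by simp
  then show ?thesis
    using energy_diff[OF s dim zero \<phi> \<psi>] by simp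
qed

lemma L_p_uminus: "f \<in> L_p p \<Omega> \<Longrightarrow> (\<lambda>x. - f x) \<in> L_p p \<Omega>"
  by (auto simp: L_p_def)

theorem theorem1p4:
  fixes \<Omega> :: "(real ^ 'n) set"
    and s l :: real
    and a f u :: "real ^ 'n \<Rightarrow> real"
  assumes "CARD('n) \<ge> 3"
    and "0 < s" and "s < 1"
    and "open \<Omega>" and "bounded \<Omega>" and "connected \<Omega>" and "\<Omega> \<noteq> {}"
    and "l > real CARD('n) / 2"
    and "a \<in> L_p l \<Omega>" and "f \<in> L_p l \<Omega>"
    and "weak_solution s \<Omega> a f u"
  shows "u \<in> L_infinity \<Omega>"
proof -
  note s = \<open>0 < s\<close> \<open>s < 1\<close>
  have dim: "3 \<le> DIM(real ^ 'n)" "2 \<le> DIM(real ^ 'n)" and l: "real DIM(real ^ 'n) / 2 < l"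
    using assms by simp_all
  \<comment> \<open>Of the weak formulation only its instances at test functions are kept, since
    every truncation used later is smooth.\<close>
  have u: "u \<in> X12 s \<Omega>"
    and weak: "\<And>\<psi>. \<psi> \<in> test_functions \<Omega> \<Longrightarrow>
      B_form s u \<psi> = (LINT x|lebesgue_on \<Omega>. f x * \<psi> x) - (LINT x|lebesgue_on \<Omega>. a x * u x * \<psi> x)"
    using \<open>weak_solution s \<Omega> a f u\<close> test_functions_subset_X12[of _ \<Omega> s]
    unfolding weak_solution_def by (auto simp: eq_diff_eq)
  have um: "u \<in> borel_measurable (lebesgue_on \<Omega>)"
    using u by (auto simp: X12_def intro: measurable_restrict_space1)
  obtain \<phi> where \<phi>: "\<And>k. \<phi> k \<in> test_functions \<Omega>"
    and cauchy: "\<And>e. 0 < e \<Longrightarrow> \<exists>N. \<forall>i\<ge>N. \<forall>j\<ge>N. X12_norm s (\<lambda>x. \<phi> i x - \<phi> j x) < e"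
    and ae: "AE x in lebesgue. (\<lambda>k. \<phi> k x) \<longlonglongrightarrow> u x"
    and lim: "\<And>\<psi>. \<psi> \<in> test_functions \<Omega> \<Longrightarrow> (\<lambda>k. energy s (\<phi> k) \<psi>) \<longlonglongrightarrow> B_form s u \<psi>"
    using X12_approximation[OF s dim(2) \<open>bounded \<Omega>\<close> u] by blast
  have ae': "AE x in lebesgue_on \<Omega>. (\<lambda>k. \<phi> k x) \<longlonglongrightarrow> u x"
    using ae \<open>open \<Omega>\<close> by (subst AE_restrict_space_iff) (auto elim: eventually_mono)
  obtain K1 where K1: "AE x in lebesgue_on \<Omega>. u x \<le> K1"
    using weak_solution_bounded_above[OF s dim(1) \<open>open \<Omega>\<close> \<open>bounded \<Omega>\<close> l \<open>a \<in> L_p l \<Omega>\<close> \<open>f \<in> L_p l \<Omega>\<close> um \<phi> cauchy ae']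
      lim weak by auto
  have "\<exists>K. AE x in lebesgue_on \<Omega>. - u x \<le> K"
  proof (rule weak_solution_bounded_above[OF s dim(1) \<open>open \<Omega>\<close> \<open>bounded \<Omega>\<close> l \<open>a \<in> L_p l \<Omega>\<close>
        L_p_uminus[OF \<open>f \<in> L_p l \<Omega>\<close>], where \<phi> = "\<lambda>k x. - \<phi> k x"])
    show "(\<lambda>x. - u x) \<in> borel_measurable (lebesgue_on \<Omega>)"
      using um by simp
    show "(\<lambda>x. - \<phi> k x) \<in> test_functions \<Omega>" for k
      by (rule test_functions_uminus[OF \<phi>])
    show "\<exists>N. \<forall>i\<ge>N. \<forall>j\<ge>N. X12_norm s (\<lambda>x. - \<phi> i x - - \<phi> j x) < e" if "0 < e" for e
      using cauchy[OF that] by auto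
    show "AE x in lebesgue_on \<Omega>. (\<lambda>k. - \<phi> k x) \<longlonglongrightarrow> - u x"
      using ae' by eventually_elim (rule tendsto_minus)
    show "(\<lambda>k. energy s (\<lambda>x. - \<phi> k x) \<psi>) \<longlonglongrightarrow>
        (LINT x|lebesgue_on \<Omega>. - f x * \<psi> x) - (LINT x|lebesgue_on \<Omega>. a x * - u x * \<psi> x)"
      if \<psi>: "\<psi> \<in> test_functions \<Omega>" for \<psi>
      using tendsto_minus[OF lim[OF \<psi>]] by (simp add: energy_uminus[OF s dim(2) \<phi> \<psi>] weak[OF \<psi>])
  qed
  then obtain K2 where K2: "AE x in lebesgue_on \<Omega>. - u x \<le> K2" by blast
  have "AE x in lebesgue_on \<Omega>. \<bar>u x\<bar> \<le> max K1 K2"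
    using K1 K2 by eventually_elim auto
  with um show ?thesis
    unfolding L_infinity_def by blast
qed

end
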